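(* Let $\mathcal X\subset\mathbb R^d$ be nonempty and compact, let $\ell:\mathcal X\times\Xi\to\mathbb R$ be a loss function, and suppose there is a measurable $M:\Xi\to\mathbb R_+$ such that for all $\xi\in\Xi$ the function $\ell(\cdot;\xi)$ is $M(\xi)$-Lipschitz on $\mathcal X$ with respect to some norm. Assume $\mathbb E_{P_0}[M(\xi)^2]<\infty$ and $\mathbb E_{P_0}[|\ell(x_0;\xi)|^2]<\infty$ for some $x_0\in\mathcal X$. Let $f$ satisfy the smoothness assumption in the context and let $\rho>0$. Suppose $\xi_1,\xi_2,\dots$ are i.i.d. with distribution $P_0$, with empirical distributions $\widehat P_n$, and that the optimizer $x^\star=\operatorname{argmin}_{x\in\mathcal X}\mathbb E_{P_0}[\ell(x;\xi)]$ is unique. Then, with $T_{\rm opt}(P)=\inf_{x\in\mathcal X}\mathbb E_P[\ell(x;\xi)]$, $$\lim_{n\to\infty}\mathbb P\Big(T_{\rm opt}(P_0)\in\big\{T_{\rm opt}(P):P\ll\widehat P_n,\ D_f(P\|\widehat P_n)\le\tfrac{\rho}{n}\big\}\Big)=\mathbb P(\chi^2_1\le\rho),$$ where $\chi_1^2$ denotes a chi-squared random variable with one degree of freedom.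
   Context: $(\Xi,\mathcal A,P_0)$ is a probability space with $\Xi$ a subset of a separable metric space; $\ell(x;\cdot)$ is measurable for each $x$. Smoothness assumption on $f$: $f:[0,\infty)\to\mathbb R\cup\{+\infty\}$ is lower semicontinuous and convex, three times differentiable in a neighborhood of $1$, with $f(1)=f'(1)=0$ and $f''(1)=2$. For probability measures $P\ll Q$, $D_f(P\|Q)=\int f\!\left(\frac{dP}{dQ}\right)dQ$. $\widehat P_n$ is the empirical distribution of $\xi_1,\dots,\xi_n$.
   Formalization: The formal theorem additionally assumes that ℓ(x*;ξ) has nonzero variance under P_0; without this the claim fails, e.g. for X=[-1,1], ℓ(x;ξ)=|x|, where the coverage probability is 1 for every n. *)

theory Defs
  imports "HOL-Probability.Probability"
begin

definition is_norm :: "('v::real_vector \<Rightarrow> real) \<Rightarrow> bool" where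
  "is_norm N \<longleftrightarrow>
     (\<forall>x. N x = 0 \<longleftrightarrow> x = 0) \<and>
     (\<forall>c x. N (c *\<^sub>R x) = \<bar>c\<bar> * N x) \<and>
     (\<forall>x y. N (x + y) \<le> N x + N y)"

text \<open>The generators \<open>f : [0, \<infinity>) \<rightarrow> \<real> \<union> {+\<infinity>}\<close> are functions
  \<open>real \<Rightarrow> ereal\<close> whose values at negative arguments are irrelevant. Since \<open>0 * \<infinity> = 0\<close> in
  \<open>ereal\<close>, the end points of the convexity inequality are harmless.\<close>

definition divergence_generator :: "(real \<Rightarrow> ereal) \<Rightarrow> bool" where
  "divergence_generator f \<longleftrightarrow>
     (\<forall>t\<ge>0. f t \<noteq> -\<infinity>) \<and>
     (\<forall>t\<ge>0. f t \<le> Liminf (at t within {0..}) f) \<and>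
     (\<forall>s\<ge>0. \<forall>t\<ge>0. \<forall>u\<in>{0..1}.
        f (u * s + (1 - u) * t) \<le> ereal u * f s + ereal (1 - u) * f t)"

definition smooth_generator :: "(real \<Rightarrow> ereal) \<Rightarrow> bool" where
  "smooth_generator f \<longleftrightarrow>
     divergence_generator f \<and>
     (let g = (\<lambda>t. real_of_ereal (f t)) in
       (\<exists>U\<subseteq>{0..}. open U \<and> 1 \<in> U \<and>
          (\<forall>t\<in>U. \<bar>f t\<bar> \<noteq> \<infinity> \<and> (\<forall>k<3. (deriv ^^ k) g differentiable (at t)))) \<and>
       f 1 = 0 \<and> deriv g 1 = 0 \<and> (deriv ^^ 2) g 1 = 2)"

text \<open>Integral of an extended-real function, as the integral of the positive part minus the
  integral of the negative part (\<open>e2ennreal\<close> truncates negative values to \<open>0\<close>).\<close>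

definition ext_integral :: "'a measure \<Rightarrow> ('a \<Rightarrow> ereal) \<Rightarrow> ereal" where
  "ext_integral Q h =
     enn2ereal (\<integral>\<^sup>+z. e2ennreal (h z) \<partial>Q) - enn2ereal (\<integral>\<^sup>+z. e2ennreal (- h z) \<partial>Q)"

text \<open>\<open>D\<^sub>f(P \<parallel> Q)\<close> for \<open>P \<lless> Q\<close>. In the library, \<open>RN_deriv Q P\<close> is \<open>dP/dQ\<close>, and
  \<open>absolutely_continuous Q P\<close> is \<open>P \<lless> Q\<close>.\<close>

definition f_divergence :: "(real \<Rightarrow> ereal) \<Rightarrow> 'a measure \<Rightarrow> 'a measure \<Rightarrow> ereal" where
  "f_divergence f P Q = ext_integral Q (\<lambda>z. f (enn2real (RN_deriv Q P z)))"

text \<open>\<open>1/n\<close> times the sum of the Dirac measures at \<open>z 0, \<dots>, z (n - 1)\<close>, on the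
  \<open>\<sigma>\<close>-algebra of \<open>S\<close>.\<close>

definition empirical_measure :: "'a measure \<Rightarrow> nat \<Rightarrow> (nat \<Rightarrow> 'a) \<Rightarrow> 'a measure" where
  "empirical_measure S n z = distr (uniform_count_measure {..<n}) S z"

definition T_opt :: "'x set \<Rightarrow> ('x \<Rightarrow> 'a \<Rightarrow> real) \<Rightarrow> 'a measure \<Rightarrow> real" where
  "T_opt X l P = (INF x\<in>X. \<integral>z. l x z \<partial>P)"

definition chi_squared :: "nat \<Rightarrow> real measure" where
  "chi_squared k =
     distr (\<Pi>\<^sub>M i\<in>{..<k}. std_normal_distribution) borel (\<lambda>z. \<Sum>i<k. (z i)\<^sup>2)"

end

theory Submission
  imports Defs
begin

text \<open>The members of the divergence ball are weight vectors \<open>w\<close> on the sample, and near the uniform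
  weights the divergence is the quadratic form \<open>\<Sum> (n w i - 1)\<^sup>2\<close>. Hence, for a fixed decision \<open>x\<close>, the
  weighted means over the ball fill the interval of radius \<open>sqrt (\<rho> / n)\<close> times the sample standard
  deviation around the sample mean, up to \<open>o(1 / sqrt n)\<close>. The infimum over \<open>x\<close> only matters at the
  optimizer \<open>xs\<close>: far from \<open>xs\<close> the population gap dominates, and near \<open>xs\<close> the empirical process is
  equicontinuous at scale \<open>sqrt n\<close>, by symmetrization and chaining over dyadic grids. So the optimal value
  under \<open>P0\<close> is covered iff the studentized mean of the loss at \<open>xs\<close> is at most \<open>sqrt \<rho>\<close> in absolute value,
  up to small errors, and the central limit theorem gives the limit. The set of values is an interval
  because the ball is convex and compact, which also makes the event measurable.\<close>

section \<open>Maxima of Rademacher averages\<close>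

text \<open>The Lipschitz modulus is only square integrable, so the sums of loss differences have no
  exponential concentration of their own. Random signs supply it: given the sample they are bounded,
  and the chaining estimate sees the data only through the sum of the squared moduli. A first moment
  bound and Markov's inequality are then enough. Maxima are taken over finite sets, so that their
  measurability and integrals are unproblematic; a countable dense set and continuity recover all of
  \<open>X\<close>. The generator is close to a quadratic only near 1, while a feasible weight may
  be far from uniform. There convexity gives a linear lower bound, so the far weights have bounded
  total relative deviation, and they multiply sample maxima, which are o(sqrt n) under a second
  moment. Every approximation holds outside a small exceptional set, whereas coverage is an exact
  equation. This is why coverage is enclosed between two events about the mean, and why an
  intermediate value argument produces the exact equality.\<close>

definition rademacher_sign :: "'i set \<Rightarrow> 'i \<Rightarrow> real" where
  "rademacher_sign S i = (if i \<in> S then 1 else - 1)"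

text \<open>Expectation over independent fair signs, written as a finite average over the set of
  indices that carry the sign \<open>+1\<close>. No second probability space is involved.\<close>

definition rademacher_avg :: "'i set \<Rightarrow> ('i set \<Rightarrow> real) \<Rightarrow> real" where
  "rademacher_avg I g = (\<Sum>S\<in>Pow I. g S) / 2 ^ card I"

lemma rademacher_avg_mono:
  "(\<And>S. S \<subseteq> I \<Longrightarrow> g S \<le> h S) \<Longrightarrow> rademacher_avg I g \<le> rademacher_avg I h"
  unfolding rademacher_avg_def by (intro divide_right_mono sum_mono) auto

lemma rademacher_avg_const: "finite I \<Longrightarrow> rademacher_avg I (\<lambda>_. c) = c"
  unfolding rademacher_avg_def by (simp add: card_Pow)

lemma rademacher_avg_add:
  "rademacher_avg I (\<lambda>S. g S + h S) = rademacher_avg I g + rademacher_avg I h"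
  unfolding rademacher_avg_def by (simp add: sum.distrib add_divide_distrib)

lemma rademacher_avg_cmult: "rademacher_avg I (\<lambda>S. c * g S) = c * rademacher_avg I g"
  unfolding rademacher_avg_def by (simp add: sum_distrib_left)

lemma rademacher_avg_sum:
  "rademacher_avg I (\<lambda>S. \<Sum>j\<in>J. g j S) = (\<Sum>j\<in>J. rademacher_avg I (g j))"
  unfolding rademacher_avg_def by (subst sum.swap) (simp add: sum_divide_distrib)

text \<open>This is \<open>cosh x \<le> exp (x^2 / 2)\<close>. Hoeffding's bound
  \<open>h^2 / 8\<close> on the log-moment generating function, taken at \<open>h = 2 y\<close> and
  success probability \<open>1/2\<close>, is exactly \<open>y^2 / 2\<close>.\<close>

lemma exp_add_exp_minus_le: "exp x + exp (- x) \<le> 2 * exp (x\<^sup>2 / 2)" for x :: real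
proof -
  have *: "exp y + exp (- y) \<le> 2 * exp (y\<^sup>2 / 2)" if "0 \<le> y" for y :: real
  proof -
    have "- (2 * y) * (1/2) + ln (1 + 1/2 * (exp (2 * y) - 1)) \<le> (2 * y)\<^sup>2 / 8"
      using that by (intro Hoeffdings_lemma_aux) auto
    moreover have "1 + 1/2 * (exp (2 * y) - 1) = (1 + exp (2 * y)) / 2" by (simp add: field_simps)
    ultimately have "- (2 * y) * (1/2) + ln ((1 + exp (2 * y)) / 2) \<le> (2 * y)\<^sup>2 / 8" by argo
    then have "ln ((1 + exp (2 * y)) / 2) \<le> y + y\<^sup>2 / 2" by (simp add: power_mult_distrib)
    moreover have "0 < (1 + exp (2 * y)) / 2" by (auto intro: add_pos_pos)
    ultimately have "(1 + exp (2 * y)) / 2 \<le> exp (y + y\<^sup>2 / 2)"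
      by (metis exp_le_cancel_iff exp_ln)
    then have "exp (- y) * (1 + exp (2 * y)) \<le> exp (- y) * (2 * exp (y + y\<^sup>2 / 2))"
      by (intro mult_left_mono) auto
    also have "exp (- y) * (2 * exp (y + y\<^sup>2 / 2)) = 2 * exp (y\<^sup>2 / 2)"
      by (simp add: exp_add exp_minus)
    also have "exp (- y) * (1 + exp (2 * y)) = exp y + exp (- y)"
      by (simp add: algebra_simps flip: exp_add)
    finally show ?thesis .
  qed
  show ?thesis
    using *[of x] *[of "- x"] by (cases "0 \<le> x") (auto simp: add.commute)
qed

text \<open>Independence of the signs appears here as the expansion of a product of binomials over
  subsets (\<open>prod_add\<close>); each factor is a hyperbolic cosine.\<close>

lemma rademacher_avg_exp_le:
  assumes "finite I"
  shows "rademacher_avg I (\<lambda>S. exp (\<Sum>i\<in>I. rademacher_sign S i * c i)) \<le> exp ((\<Sum>i\<in>I. (c i)\<^sup>2) / 2)"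
proof -
  have "(\<Sum>S\<in>Pow I. exp (\<Sum>i\<in>I. rademacher_sign S i * c i)) =
      (\<Sum>S\<in>Pow I. (\<Prod>i\<in>S. exp (c i)) * (\<Prod>i\<in>I - S. exp (- c i)))"
  proof (intro sum.cong refl)
    fix S assume "S \<in> Pow I"
    then have S: "S \<subseteq> I" "finite S" using assms finite_subset by auto
    have "(\<Sum>i\<in>I. rademacher_sign S i * c i) =
        (\<Sum>i\<in>I - S. rademacher_sign S i * c i) + (\<Sum>i\<in>S. rademacher_sign S i * c i)"
      using S assms by (intro sum.subset_diff) auto
    also have "\<dots> = (\<Sum>i\<in>I - S. - c i) + (\<Sum>i\<in>S. c i)"
      by (intro arg_cong2[where f="(+)"] sum.cong) (auto simp: rademacher_sign_def)
    finally show "exp (\<Sum>i\<in>I. rademacher_sign S i * c i) = (\<Prod>i\<in>S. exp (c i)) * (\<Prod>i\<in>I - S. exp (- c i))"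
      using S assms by (simp only: exp_add exp_sum finite_Diff mult.commute)
  qed
  also have "\<dots> = (\<Prod>i\<in>I. exp (c i) + exp (- c i))"
    using prod_add[OF assms, of "\<lambda>i. exp (c i)" "\<lambda>i. exp (- c i)"] by simp
  also have "\<dots> \<le> (\<Prod>i\<in>I. 2 * exp ((c i)\<^sup>2 / 2))"
    by (intro prod_mono conjI exp_add_exp_minus_le) (auto intro: add_nonneg_nonneg)
  also have "\<dots> = 2 ^ card I * exp ((\<Sum>i\<in>I. (c i)\<^sup>2) / 2)"
    using assms by (simp add: prod.distrib exp_sum sum_divide_distrib)
  finally show ?thesis
    unfolding rademacher_avg_def by (simp add: field_simps)
qed

text \<open>From \<open>y \<le> a + exp (y - a)\<close> the maximum is bounded through a sum of
  exponentials, each averaging to at most \<open>exp (1/2)\<close> after scaling by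
  \<open>s\<close>; \<open>4\<close> bounds \<open>2 * exp (1/2)\<close>. The logarithm enters
  linearly instead of under a root. In the chaining sum this only changes the constant, since the
  scales decay geometrically.\<close>

lemma rademacher_avg_Max_le:
  fixes b :: "'j \<Rightarrow> 'i \<Rightarrow> real"
  assumes I: "finite I" and J: "finite J" "J \<noteq> {}" and s: "0 \<le> s"
    and b: "\<And>j. j \<in> J \<Longrightarrow> (\<Sum>i\<in>I. (b j i)\<^sup>2) \<le> s\<^sup>2"
  shows "rademacher_avg I (\<lambda>S. Max ((\<lambda>j. \<bar>\<Sum>i\<in>I. rademacher_sign S i * b j i\<bar>) ` J))
      \<le> s * (ln (card J) + 4)"
proof (cases "s = 0")
  case True
  have "b j i = 0" if "j \<in> J" "i \<in> I" for i j
  proof -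
    have "(\<Sum>i\<in>I. (b j i)\<^sup>2) = 0"
      using b[OF that(1)] True sum_nonneg[of I "\<lambda>i. (b j i)\<^sup>2"] by auto
    then show ?thesis using that I by (simp add: sum_nonneg_eq_0_iff)
  qed
  then have "(\<lambda>j. \<bar>\<Sum>i\<in>I. rademacher_sign S i * b j i\<bar>) ` J = {0}" for S
    using J by (auto simp: image_iff)
  then show ?thesis using True I by (simp add: rademacher_avg_const)
next
  case False
  then have s: "0 < s" using s by simp
  define T where "T S j = (\<Sum>i\<in>I. rademacher_sign S i * b j i)" for S j
  \<comment> \<open>With this choice \<open>exp (- a)\<close> cancels the number of
    summands.\<close>
  define a where "a = ln (card J)"
  have cJ: "0 < card J" using J by (simp add: card_gt_0_iff)
  have y_le: "y \<le> a + exp (y - a)" for y :: real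
    using exp_ge_add_one_self[of "y - a"] by linarith
  have "rademacher_avg I (\<lambda>S. Max ((\<lambda>j. \<bar>T S j\<bar>) ` J))
      \<le> rademacher_avg I (\<lambda>S. s * (a + exp (- a) * (\<Sum>j\<in>J. exp (T S j / s) + exp (- T S j / s))))"
  proof (intro rademacher_avg_mono)
    fix S
    have "\<bar>T S j\<bar> \<le> s * (a + exp (- a) * (\<Sum>j\<in>J. exp (T S j / s) + exp (- T S j / s)))"
      if j: "j \<in> J" for j
    proof -
      have "\<bar>T S j\<bar> / s \<le> a + exp (\<bar>T S j\<bar> / s - a)"
        by (rule y_le)
      also have "exp (\<bar>T S j\<bar> / s - a) = exp (- a) * exp (\<bar>T S j\<bar> / s)"
        by (simp flip: exp_add)
      also have "exp (\<bar>T S j\<bar> / s) \<le> exp (T S j / s) + exp (- T S j / s)"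
        by (cases "0 \<le> T S j") auto
      also have "\<dots> \<le> (\<Sum>j\<in>J. exp (T S j / s) + exp (- T S j / s))"
        using J j by (intro member_le_sum) (auto intro: add_nonneg_nonneg)
      finally show ?thesis using s by (simp add: field_simps)
    qed
    then show "Max ((\<lambda>j. \<bar>T S j\<bar>) ` J) \<le> s * (a + exp (- a) * (\<Sum>j\<in>J. exp (T S j / s) + exp (- T S j / s)))"
      using J by auto
  qed
  also have "\<dots> = s * (a + exp (- a) * (\<Sum>j\<in>J. rademacher_avg I (\<lambda>S. exp (T S j / s)) + rademacher_avg I (\<lambda>S. exp (- T S j / s))))"
    using I by (simp add: rademacher_avg_cmult rademacher_avg_add rademacher_avg_const rademacher_avg_sum)
  also have "\<dots> \<le> s * (a + exp (- a) * (\<Sum>j\<in>J. exp (1/2) + exp (1/2)))"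
  proof -
    have 1: "rademacher_avg I (\<lambda>S. exp (T S j / s)) \<le> exp (1/2)" "rademacher_avg I (\<lambda>S. exp (- T S j / s)) \<le> exp (1/2)"
      if j: "j \<in> J" for j
    proof -
      have q: "(\<Sum>i\<in>I. (b j i / s)\<^sup>2) \<le> 1"
        using b[OF j] s by (simp add: power_divide divide_le_eq flip: sum_divide_distrib)
      have "(\<lambda>S. T S j / s) = (\<lambda>S. \<Sum>i\<in>I. rademacher_sign S i * (b j i / s))"
        by (simp add: T_def sum_divide_distrib)
      then show "rademacher_avg I (\<lambda>S. exp (T S j / s)) \<le> exp (1/2)"
        using rademacher_avg_exp_le[OF I, of "\<lambda>i. b j i / s"] q
        by (auto simp: fun_eq_iff elim!: order_trans)
      have "(\<lambda>S. - T S j / s) = (\<lambda>S. \<Sum>i\<in>I. rademacher_sign S i * (- b j i / s))"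
        by (simp add: T_def sum_divide_distrib sum_negf)
      then show "rademacher_avg I (\<lambda>S. exp (- T S j / s)) \<le> exp (1/2)"
        using rademacher_avg_exp_le[OF I, of "\<lambda>i. - b j i / s"] q
        by (auto simp: fun_eq_iff elim!: order_trans)
    qed
    show ?thesis
      using s by (intro mult_left_mono add_left_mono sum_mono add_mono 1) auto
  qed
  also have "\<dots> = s * (a + 2 * exp (1/2))"
    using cJ by (simp add: a_def exp_minus)
  also have "\<dots> \<le> s * (a + 4)"
  proof -
    have "exp (1/2 :: real) ^ 2 \<le> 2 ^ 2"
      using exp_le by (simp add: power2_eq_square flip: exp_add)
    then have "exp (1/2 :: real) \<le> 2" by (rule power2_le_imp_le) simp
    then show ?thesis using s by simp
  qed
  finally show ?thesis by (simp add: T_def a_def)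
qed

lemma sum_geometric_weighted: "(\<Sum>k<K. (real k + 2) / 2 ^ k) = 6 - (real K + 3) * 2 / 2 ^ K"
proof (induction K)
  case (Suc K)
  then show ?case by (simp only: sum.lessThan_Suc) (simp add: field_simps)
qed simp

text \<open>The factor \<open>3 d\<close> comes from the link lengths, \<open>2 d + 4\<close> from
  the logarithm of the number of links plus \<open>4\<close>, relative to \<open>k + 2\<close>, and
  \<open>6\<close> bounds the sum of \<open>(k + 2) / 2^k\<close>.\<close>

definition chaining_const :: "nat \<Rightarrow> real" where
  "chaining_const d = 3 * real d * (12 * real d + 24)"

text \<open>The point \<open>p (Suc k) x\<close> represents the cell of \<open>x\<close> in the grid of mesh \<open>r / 2 ^ k\<close>. Level \<open>k\<close> has at
  most \<open>2 ^ (2 d (k + 2))\<close> links, each of length at most \<open>3 d r / 2 ^ k\<close>, where \<open>d\<close> is the dimension.\<close>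

lemma rademacher_avg_chaining:
  fixes h :: "real ^ 'd \<Rightarrow> 'i \<Rightarrow> real"
  assumes I: "finite I" and F: "finite F" "F \<noteq> {}" "F \<subseteq> cball xs r" and r: "0 < r"
    and h0: "\<And>i. h xs i = 0"
    and v: "\<And>i. i \<in> I \<Longrightarrow> 0 \<le> v i"
    and h: "\<And>i x y. i \<in> I \<Longrightarrow> x \<in> insert xs F \<Longrightarrow> y \<in> insert xs F \<Longrightarrow> \<bar>h x i - h y i\<bar> \<le> v i * norm (x - y)"
  shows "rademacher_avg I (\<lambda>S. Max ((\<lambda>x. \<bar>\<Sum>i\<in>I. rademacher_sign S i * h x i\<bar>) ` F))
      \<le> chaining_const CARD('d) * r * sqrt (\<Sum>i\<in>I. (v i)\<^sup>2)"
proof -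
  define d where "d = real CARD('d)"
  define B where "B = sqrt (\<Sum>i\<in>I. (v i)\<^sup>2)"
  have d: "1 \<le> d" unfolding d_def by (simp add: Suc_le_eq)
  have B: "0 \<le> B" unfolding B_def by (simp add: sum_nonneg)
  define T where "T S x = (\<Sum>i\<in>I. rademacher_sign S i * h x i)" for S x
  define cell where "cell k x = (\<lambda>j. \<lfloor>2 ^ k * (x $ j - xs $ j) / r\<rfloor>)" for k and x :: "real ^ 'd"
  define pick where "pick k c = (SOME y. y \<in> F \<and> cell k y = c)" for k c
  \<comment> \<open>The chain starts at the root \<open>xs\<close>, where \<open>h\<close> vanishes,
    so the telescoping sum has no initial term. This shifts the index: \<open>p (Suc m)\<close>
    belongs to mesh \<open>r / 2^m\<close>.\<close>
  define p where "p k x = (case k of 0 \<Rightarrow> xs | Suc m \<Rightarrow> pick m (cell m x))" for k x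
  have p0: "p 0 x = xs" and pS: "p (Suc k) x = pick k (cell k x)" for k x
    by (simp_all add: p_def)
  have pick: "pick k (cell k x) \<in> F" "cell k (pick k (cell k x)) = cell k x" if "x \<in> F" for k x
    using someI[of "\<lambda>y. y \<in> F \<and> cell k y = cell k x" x] that unfolding pick_def by auto
  have pF: "p k x \<in> insert xs F" if "x \<in> F" for k x
    using pick[OF that] by (cases k) (auto simp: p0 pS)
  have same_cell: "norm (y - x) \<le> d * r / 2 ^ k" if "cell k y = cell k x" for k x y
  proof -
    have "\<bar>(y - x) $ j\<bar> \<le> r / 2 ^ k" for j
    proof -
      have "\<lfloor>2 ^ k * (y $ j - xs $ j) / r\<rfloor> = \<lfloor>2 ^ k * (x $ j - xs $ j) / r\<rfloor>"
        using that by (simp add: cell_def fun_eq_iff)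
      then have "\<bar>2 ^ k * (y $ j - xs $ j) / r - 2 ^ k * (x $ j - xs $ j) / r\<bar> < 1"
        by linarith
      also have "2 ^ k * (y $ j - xs $ j) / r - 2 ^ k * (x $ j - xs $ j) / r = (y - x) $ j * (2 ^ k / r)"
        using r by (simp add: field_simps)
      finally have "\<bar>(y - x) $ j\<bar> * (2 ^ k / r) < 1"
        using r by (simp add: abs_mult del: vector_minus_component)
      then show ?thesis using r by (simp add: field_simps del: vector_minus_component)
    qed
    then have "(\<Sum>j\<in>UNIV. \<bar>(y - x) $ j\<bar>) \<le> (\<Sum>j\<in>(UNIV::'d set). r / 2 ^ k)"
      by (intro sum_mono) auto
    then show ?thesis using norm_le_l1_cart[of "y - x"] by (simp add: d_def)
  qed
  have close: "norm (x - p (Suc k) x) \<le> d * r / 2 ^ k" if "x \<in> F" for x k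
    using same_cell[of k x "pick k (cell k x)"] pick[OF that] by (simp add: pS)
  \<comment> \<open>Consecutive representatives are both close to \<open>x\<close>, at distances
    \<open>d r / 2^k\<close> and \<open>2 d r / 2^k\<close>, which gives the factor 3. The first
    link is a radius of the ball.\<close>
  have step: "norm (p (Suc k) x - p k x) \<le> 3 * d * r / 2 ^ k" if x: "x \<in> F" for x k
  proof (cases k)
    case 0
    have "p (Suc k) x \<in> cball xs r" using subsetD[OF F(3) pick(1)[OF x, of k]] by (simp only: pS)
    then have "norm (p (Suc k) x - p k x) \<le> r" using 0 by (simp add: p0 dist_norm norm_minus_commute)
    also have "\<dots> \<le> 3 * d * r / 2 ^ k" using d r 0 by simp
    finally show ?thesis .
  next
    case (Suc m)
    have "norm (p (Suc k) x - p k x) \<le> norm (x - p (Suc k) x) + norm (x - p k x)"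
      using norm_triangle_ineq4[of "x - p k x" "x - p (Suc k) x"] by simp
    also have "\<dots> \<le> d * r / 2 ^ k + d * r / 2 ^ m"
      using close[OF x, of k] close[OF x, of m] Suc by simp
    also have "\<dots> = 3 * d * r / 2 ^ k" using Suc by (simp add: field_simps)
    finally show ?thesis .
  qed
  \<comment> \<open>A representative depends on the cell alone, and for points within
    \<open>r\<close> of \<open>xs\<close> each cell coordinate lies in
    \<open>{- (2^k)..2^k}\<close>. This leaves \<open>2 * 2^k + 1 \<le> 2^(k + 2)\<close> values per
    coordinate.\<close>
  have card_p: "card (p (Suc k) ` F) \<le> (2 ^ (k + 2)) ^ CARD('d)" for k
  proof -
    have "p (Suc k) ` F = pick k ` cell k ` F" by (auto simp: pS)
    then have "card (p (Suc k) ` F) \<le> card (cell k ` F)"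
      using card_image_le[of "cell k ` F" "pick k"] F(1) by simp
    also have "cell k ` F \<subseteq> (\<Pi>\<^sub>E j\<in>UNIV. {- (2 ^ k)..2 ^ k})"
    proof -
      have "- (2 ^ k) \<le> cell k x j \<and> cell k x j \<le> 2 ^ k" if "x \<in> F" for x j
      proof -
      from that have "norm (x - xs) \<le> r" using F by (auto simp: dist_norm norm_minus_commute)
      then have "\<bar>x $ j - xs $ j\<bar> \<le> r" using component_le_norm_cart[of "x - xs" j] by simp
      then have 1: "\<bar>(x $ j - xs $ j) / r\<bar> \<le> 1" using r by simp
      have 2: "\<bar>2 ^ k * (x $ j - xs $ j) / r\<bar> \<le> 2 ^ k"
        using mult_left_mono[OF 1, of "2 ^ k"] by (simp add: abs_mult)
      then have "2 ^ k * (x $ j - xs $ j) / r \<le> 2 ^ k" "- (2 ^ k) \<le> 2 ^ k * (x $ j - xs $ j) / r" by linarith+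
      then show ?thesis
        unfolding cell_def by (simp add: le_floor_iff floor_le_iff)
      qed
      then show ?thesis by auto
    qed
    then have "card (cell k ` F) \<le> card (\<Pi>\<^sub>E j\<in>(UNIV::'d set). {- (2 ^ k)..(2::int) ^ k})"
      by (intro card_mono finite_PiE) auto
    also have "\<dots> = nat (2 * 2 ^ k + 1) ^ CARD('d)"
      by (simp add: card_PiE)
    also have "\<dots> \<le> (2 ^ (k + 2)) ^ CARD('d)"
    proof (intro power_mono)
      have "(1::int) \<le> 2 ^ k" by simp
      then have "2 * 2 ^ k + 1 \<le> (4::int) * 2 ^ k" by linarith
      then show "nat (2 * 2 ^ k + 1) \<le> 2 ^ (k + 2)"
        by (simp add: nat_le_iff)
    qed auto
    finally show ?thesis .
  qed
  \<comment> \<open>Maximizing over distinct links instead of over points makes the bound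
    independent of the cardinality of \<open>F\<close>.\<close>
  define J where "J k = (\<lambda>x. (p k x, p (Suc k) x)) ` F" for k
  have J: "finite (J k)" "J k \<noteq> {}" for k using F by (auto simp: J_def)
  have ln_J: "ln (card (J k)) \<le> 2 * d * (real k + 2)" for k
  proof -
    have "J k \<subseteq> p k ` F \<times> p (Suc k) ` F" by (auto simp: J_def)
    then have "card (J k) \<le> card (p k ` F \<times> p (Suc k) ` F)"
      using F by (intro card_mono) auto
    also have "\<dots> = card (p k ` F) * card (p (Suc k) ` F)" by (rule card_cartesian_product)
    also have "\<dots> \<le> (2 ^ (k + 2)) ^ CARD('d) * (2 ^ (k + 2)) ^ CARD('d)"
    proof (intro mult_mono card_p)
      show "card (p k ` F) \<le> (2 ^ (k + 2)) ^ CARD('d)"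
      proof (cases k)
        case 0
        then have "p k ` F \<subseteq> {xs}" by (auto simp: p0)
        then have "card (p k ` F) \<le> 1" using card_mono[of "{xs}"] by fastforce
        also have "\<dots> \<le> (2 ^ (k + 2)) ^ CARD('d)" by simp
        finally show ?thesis .
      next
        case (Suc m)
        have "card (p k ` F) \<le> (2 ^ (m + 2)) ^ CARD('d)" using card_p[of m] Suc by simp
        also have "\<dots> \<le> (2 ^ (k + 2)) ^ CARD('d)" using Suc by (intro power_mono power_increasing) auto
        finally show ?thesis .
      qed
    qed auto
    also have "\<dots> = 2 ^ (2 * CARD('d) * (k + 2))"
    proof -
      have "(k + 2) * CARD('d) + (k + 2) * CARD('d) = 2 * CARD('d) * (k + 2)" by (simp add: algebra_simps)
      then show ?thesis by (simp only: power_mult [symmetric] power_add [symmetric])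
    qed
    finally have "real (card (J k)) \<le> 2 ^ (2 * CARD('d) * (k + 2))"
      by (metis of_nat_le_iff of_nat_numeral of_nat_power)
    moreover have "0 < card (J k)" using J by (simp add: card_gt_0_iff)
    ultimately have "ln (card (J k)) \<le> ln (2 ^ (2 * CARD('d) * (k + 2)))"
      by (subst ln_le_cancel_iff) auto
    also have "\<dots> = 2 * d * (real k + 2) * ln 2"
      by (subst ln_realpow) (auto simp: d_def algebra_simps)
    also have "\<dots> \<le> 2 * d * (real k + 2) * 1"
      using d ln_2_less_1 by (intro mult_left_mono) auto
    finally show ?thesis by simp
  qed
  define link where "link S u = \<bar>\<Sum>i\<in>I. rademacher_sign S i * (h (snd u) i - h (fst u) i)\<bar>" for S and u :: "(real ^ 'd) \<times> (real ^ 'd)"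
  have level: "rademacher_avg I (\<lambda>S. Max (link S ` J k)) \<le> 3 * d * r * B * (2 * d + 4) * ((real k + 2) / 2 ^ k)" for k
  proof -
    define s where "s = 3 * d * r / 2 ^ k * B"
    have s: "0 \<le> s" using d r B by (simp add: s_def)
    have "rademacher_avg I (\<lambda>S. Max (link S ` J k)) \<le> s * (ln (card (J k)) + 4)"
      unfolding link_def
    proof (rule rademacher_avg_Max_le[OF I J s])
      fix u assume "u \<in> J k"
      then obtain x where x: "x \<in> F" and u: "u = (p k x, p (Suc k) x)" by (auto simp: J_def)
      have "(\<Sum>i\<in>I. (h (snd u) i - h (fst u) i)\<^sup>2) \<le> (\<Sum>i\<in>I. (v i * (3 * d * r / 2 ^ k))\<^sup>2)"
      proof (intro sum_mono)
        fix i assume i: "i \<in> I"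
        have "\<bar>h (snd u) i - h (fst u) i\<bar> \<le> v i * norm (p (Suc k) x - p k x)"
          using h[OF i pF[OF x, of "Suc k"] pF[OF x, of k]] u by simp
        also have "\<dots> \<le> v i * (3 * d * r / 2 ^ k)" by (intro mult_left_mono step x v i)
        finally show "(h (snd u) i - h (fst u) i)\<^sup>2 \<le> (v i * (3 * d * r / 2 ^ k))\<^sup>2"
          by (metis abs_ge_zero power2_abs power_mono)
      qed
      also have "\<dots> = s\<^sup>2"
        unfolding s_def B_def power_mult_distrib sum_distrib_right[symmetric]
        by (simp add: sum_nonneg mult.commute)
      finally show "(\<Sum>i\<in>I. (h (snd u) i - h (fst u) i)\<^sup>2) \<le> s\<^sup>2" .
    qed
    also have "\<dots> \<le> s * ((2 * d + 4) * (real k + 2))"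
    proof (intro mult_left_mono s)
      have "ln (card (J k)) + 4 \<le> 2 * d * (real k + 2) + 4" using ln_J[of k] by simp
      also have "\<dots> \<le> 2 * d * (real k + 2) + 4 * (real k + 2)" by simp
      finally show "ln (card (J k)) + 4 \<le> (2 * d + 4) * (real k + 2)" by (simp add: algebra_simps)
    qed
    also have "s * ((2 * d + 4) * (real k + 2)) = 3 * d * r * B * (2 * d + 4) * ((real k + 2) / 2 ^ k)"
      by (simp add: s_def)
    finally show ?thesis .
  qed
  define M where "M = rademacher_avg I (\<lambda>S. Max ((\<lambda>x. \<bar>T S x\<bar>) ` F))"
  \<comment> \<open>The chain is cut at level \<open>m\<close>. The remainder from the last
    representative to \<open>x\<close> is bounded deterministically, with no use of the signs, and
    vanishes as \<open>m\<close> tends to infinity.\<close>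
  have "M \<le> 3 * d * r * B * (2 * d + 4) * 6 + (\<Sum>i\<in>I. v i) * (d * r / 2 ^ m)" for m
  proof -
    have "M \<le> rademacher_avg I (\<lambda>S. (\<Sum>k<Suc m. Max (link S ` J k)) + (\<Sum>i\<in>I. v i) * (d * r / 2 ^ m))"
      unfolding M_def
    proof (intro rademacher_avg_mono)
      fix S
      have "\<bar>T S x\<bar> \<le> (\<Sum>k<Suc m. Max (link S ` J k)) + (\<Sum>i\<in>I. v i) * (d * r / 2 ^ m)" if x: "x \<in> F" for x
      proof -
        have "T S (p 0 x) = 0" by (simp add: T_def p0 h0)
        then have "T S x = (\<Sum>k<Suc m. T S (p (Suc k) x) - T S (p k x)) + (T S x - T S (p (Suc m) x))"
          by (subst sum_lessThan_telescope) simp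
        then have "\<bar>T S x\<bar> \<le> (\<Sum>k<Suc m. \<bar>T S (p (Suc k) x) - T S (p k x)\<bar>) + \<bar>T S x - T S (p (Suc m) x)\<bar>"
          using sum_abs[of "\<lambda>k. T S (p (Suc k) x) - T S (p k x)" "{..<Suc m}"] by linarith
        also have "\<dots> \<le> (\<Sum>k<Suc m. Max (link S ` J k)) + (\<Sum>i\<in>I. v i) * (d * r / 2 ^ m)"
        proof (intro add_mono sum_mono)
          fix k
          have "\<bar>T S (p (Suc k) x) - T S (p k x)\<bar> = link S (p k x, p (Suc k) x)"
            by (simp add: T_def link_def sum_subtractf right_diff_distrib)
          also have "\<dots> \<le> Max (link S ` J k)"
            using J x by (intro Max_ge) (auto simp: J_def)
          finally show "\<bar>T S (p (Suc k) x) - T S (p k x)\<bar> \<le> Max (link S ` J k)" .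
        next
          have "\<bar>T S x - T S (p (Suc m) x)\<bar> \<le> (\<Sum>i\<in>I. \<bar>rademacher_sign S i * (h x i - h (p (Suc m) x) i)\<bar>)"
            by (simp add: T_def right_diff_distrib flip: sum_subtractf)
          also have "\<dots> \<le> (\<Sum>i\<in>I. v i * (d * r / 2 ^ m))"
          proof (intro sum_mono)
            fix i assume i: "i \<in> I"
            have "\<bar>rademacher_sign S i * (h x i - h (p (Suc m) x) i)\<bar> \<le> \<bar>h x i - h (p (Suc m) x) i\<bar>"
              by (simp add: rademacher_sign_def abs_mult)
            also have "\<dots> \<le> v i * norm (x - p (Suc m) x)" using h[OF i _ pF[OF x]] x by simp
            also have "\<dots> \<le> v i * (d * r / 2 ^ m)" by (intro mult_left_mono close x v i)
            finally show "\<bar>rademacher_sign S i * (h x i - h (p (Suc m) x) i)\<bar> \<le> v i * (d * r / 2 ^ m)" .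
          qed
          finally show "\<bar>T S x - T S (p (Suc m) x)\<bar> \<le> (\<Sum>i\<in>I. v i) * (d * r / 2 ^ m)"
            by (simp only: sum_distrib_right)
        qed
        finally show ?thesis .
      qed
      then show "Max ((\<lambda>x. \<bar>T S x\<bar>) ` F) \<le> (\<Sum>k<Suc m. Max (link S ` J k)) + (\<Sum>i\<in>I. v i) * (d * r / 2 ^ m)"
        using F by auto
    qed
    also have "\<dots> = (\<Sum>k<Suc m. rademacher_avg I (\<lambda>S. Max (link S ` J k))) + (\<Sum>i\<in>I. v i) * (d * r / 2 ^ m)"
      using I by (simp only: rademacher_avg_add rademacher_avg_sum rademacher_avg_const)
    also have "\<dots> \<le> (\<Sum>k<Suc m. 3 * d * r * B * (2 * d + 4) * ((real k + 2) / 2 ^ k)) + (\<Sum>i\<in>I. v i) * (d * r / 2 ^ m)"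
      by (intro add_mono sum_mono level order_refl)
    also have "(\<Sum>k<Suc m. 3 * d * r * B * (2 * d + 4) * ((real k + 2) / 2 ^ k))
        = 3 * d * r * B * (2 * d + 4) * (6 - (real (Suc m) + 3) * 2 / 2 ^ Suc m)"
      by (simp only: sum_distrib_left[symmetric] sum_geometric_weighted)
    also have "\<dots> \<le> 3 * d * r * B * (2 * d + 4) * 6"
      using d r B by (intro mult_left_mono) auto
    finally show ?thesis by simp
  qed
  moreover have "(\<lambda>m. 3 * d * r * B * (2 * d + 4) * 6 + (\<Sum>i\<in>I. v i) * (d * r / 2 ^ m)) \<longlonglongrightarrow> 3 * d * r * B * (2 * d + 4) * 6 + (\<Sum>i\<in>I. v i) * 0"
    by (intro tendsto_intros LIMSEQ_divide_realpow_zero) auto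
  ultimately have "M \<le> 3 * d * r * B * (2 * d + 4) * 6"
    using LIMSEQ_le_const by fastforce
  also have "\<dots> = chaining_const CARD('d) * r * B"
    by (simp add: d_def chaining_const_def algebra_simps)
  finally show ?thesis unfolding M_def T_def B_def .
qed

section \<open>Symmetrization\<close>

lemma rademacher_avg_insert:
  assumes "finite I" "i \<notin> I"
  shows "rademacher_avg (insert i I) g = rademacher_avg I (\<lambda>S. 1/2 * g (insert i S) + 1/2 * g S)"
proof -
  have "inj_on (insert i) (Pow I)" using assms by (auto simp: inj_on_def)
  moreover have "Pow I \<inter> insert i ` Pow I = {}" using assms by auto
  ultimately have "(\<Sum>S\<in>Pow (insert i I). g S) = (\<Sum>S\<in>Pow I. g S) + (\<Sum>S\<in>Pow I. g (insert i S))"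
    using assms by (simp add: Pow_insert sum.union_disjoint sum.reindex)
  then show ?thesis
    using assms by (simp add: rademacher_avg_def sum.distrib add_divide_distrib flip: sum_divide_distrib)
qed

lemma ennreal_rademacher_avg:
  assumes "\<And>S. 0 \<le> g S"
  shows "ennreal (rademacher_avg I g) = ennreal (1 / 2 ^ card I) * (\<Sum>S\<in>Pow I. ennreal (g S))"
  using assms by (simp add: rademacher_avg_def sum_ennreal sum_nonneg flip: ennreal_mult'')

text \<open>The centred summand is split as \<open>u + h - E = (u + 2 h) / 2 + (u - 2 E) / 2\<close>; Jensen's inequality
  bounds the second half, and the two halves become the two values of a random sign.\<close>

lemma nn_integral_Max_centred_le:
  fixes h :: "'p \<Rightarrow> 'a \<Rightarrow> real"
  assumes P: "prob_space P" and F: "finite F" "F \<noteq> {}" and h: "\<And>x. integrable P (h x)"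
  shows "(\<integral>\<^sup>+y. ennreal (Max ((\<lambda>x. \<bar>u x + (h x y - (\<integral>z. h x z \<partial>P))\<bar>) ` F)) \<partial>P)
      \<le> (\<integral>\<^sup>+y. ennreal (1/2 * Max ((\<lambda>x. \<bar>u x + 2 * h x y\<bar>) ` F) + 1/2 * Max ((\<lambda>x. \<bar>u x - 2 * h x y\<bar>) ` F)) \<partial>P)"
proof -
  interpret prob_space P by fact
  note [measurable] = borel_measurable_integrable[OF h]
  define \<Phi> where "\<Phi> w = Max ((\<lambda>x. \<bar>w x\<bar>) ` F)" for w :: "'p \<Rightarrow> real"
  define E where "E x = (\<integral>z. h x z \<partial>P)" for x
  have ge: "\<bar>w x\<bar> \<le> \<Phi> w" if "x \<in> F" for w x using F that by (auto simp: \<Phi>_def)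
  have le: "\<Phi> w \<le> c" if "\<And>x. x \<in> F \<Longrightarrow> \<bar>w x\<bar> \<le> c" for w c using F that by (auto simp: \<Phi>_def)
  have attain: "\<exists>x\<in>F. \<Phi> w = \<bar>w x\<bar>" for w
  proof -
    have "\<Phi> w \<in> (\<lambda>x. \<bar>w x\<bar>) ` F" unfolding \<Phi>_def using F by (intro Max_in) auto
    then show ?thesis by auto
  qed
  have nonneg: "0 \<le> \<Phi> w" for w using attain[of w] by auto
  have [measurable]: "(\<lambda>y. \<Phi> (\<lambda>x. w x y)) \<in> borel_measurable P" if "\<And>x. w x \<in> borel_measurable P" for w
    using F that unfolding \<Phi>_def by (intro borel_measurable_Max) auto
  have pt: "\<Phi> (\<lambda>x. u x + (h x y - E x)) \<le> 1/2 * \<Phi> (\<lambda>x. u x + 2 * h x y) + 1/2 * \<Phi> (\<lambda>x. u x - 2 * E x)" for y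
  proof (intro le)
    fix x assume x: "x \<in> F"
    have "u x + (h x y - E x) = 1/2 * (u x + 2 * h x y) + 1/2 * (u x - 2 * E x)" by algebra
    then have "\<bar>u x + (h x y - E x)\<bar> \<le> \<bar>1/2 * (u x + 2 * h x y)\<bar> + \<bar>1/2 * (u x - 2 * E x)\<bar>"
      by (metis abs_triangle_ineq)
    also have "\<dots> = 1/2 * \<bar>u x + 2 * h x y\<bar> + 1/2 * \<bar>u x - 2 * E x\<bar>"
      by (simp only: abs_mult)
    also have "\<dots> \<le> 1/2 * \<Phi> (\<lambda>x. u x + 2 * h x y) + 1/2 * \<Phi> (\<lambda>x. u x - 2 * E x)"
      using ge[OF x, of "\<lambda>x. u x + 2 * h x y"] ge[OF x, of "\<lambda>x. u x - 2 * E x"] by simp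
    finally show "\<bar>u x + (h x y - E x)\<bar> \<le> 1/2 * \<Phi> (\<lambda>x. u x + 2 * h x y) + 1/2 * \<Phi> (\<lambda>x. u x - 2 * E x)" .
  qed
  \<comment> \<open>The maximum is attained at one index, so Jensen's inequality for the absolute
    value at that index is enough.\<close>
  have jensen: "ennreal (\<Phi> (\<lambda>x. u x - 2 * E x)) \<le> (\<integral>\<^sup>+y. ennreal (\<Phi> (\<lambda>x. u x - 2 * h x y)) \<partial>P)"
  proof -
    obtain x where x: "x \<in> F" "\<Phi> (\<lambda>x. u x - 2 * E x) = \<bar>u x - 2 * E x\<bar>" using attain by blast
    have "u x - 2 * E x = (\<integral>y. u x - 2 * h x y \<partial>P)" using h by (simp add: E_def prob_space)
    then have "ennreal (\<Phi> (\<lambda>x. u x - 2 * E x)) = ennreal (norm (\<integral>y. u x - 2 * h x y \<partial>P))" using x by simp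
    also have "\<dots> \<le> (\<integral>\<^sup>+y. ennreal (norm (u x - 2 * h x y)) \<partial>P)"
      using h by (intro integral_norm_bound_ennreal) auto
    also have "\<dots> \<le> (\<integral>\<^sup>+y. ennreal (\<Phi> (\<lambda>x. u x - 2 * h x y)) \<partial>P)"
      using ge[OF x(1)] by (intro nn_integral_mono ennreal_leI) auto
    finally show ?thesis .
  qed
  have half: "ennreal (1/2 * a) + ennreal (1/2) * ennreal b = ennreal (1/2 * a + 1/2 * b)"
    if "0 \<le> a" "0 \<le> b" for a b
  proof -
    have "ennreal (1/2) * ennreal b = ennreal (1/2 * b)"
      by (rule ennreal_mult[symmetric]) (use that in auto)
    moreover have "ennreal (1/2 * a) + ennreal (1/2 * b) = ennreal (1/2 * a + 1/2 * b)"
      by (rule ennreal_plus[symmetric]) (use that in auto)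
    ultimately show ?thesis by (simp only:)
  qed
  have "(\<integral>\<^sup>+y. ennreal (\<Phi> (\<lambda>x. u x + (h x y - E x))) \<partial>P)
      \<le> (\<integral>\<^sup>+y. ennreal (1/2 * \<Phi> (\<lambda>x. u x + 2 * h x y)) + ennreal (1/2) * ennreal (\<Phi> (\<lambda>x. u x - 2 * E x)) \<partial>P)"
    by (rule nn_integral_mono) (simp only: half nonneg, rule ennreal_leI, rule pt)
  also have "\<dots> = (\<integral>\<^sup>+y. ennreal (1/2 * \<Phi> (\<lambda>x. u x + 2 * h x y)) \<partial>P) + ennreal (1/2) * ennreal (\<Phi> (\<lambda>x. u x - 2 * E x))"
    by (subst nn_integral_add) (auto simp: emeasure_space_1)
  also have "\<dots> \<le> (\<integral>\<^sup>+y. ennreal (1/2 * \<Phi> (\<lambda>x. u x + 2 * h x y)) \<partial>P) + ennreal (1/2) * (\<integral>\<^sup>+y. ennreal (\<Phi> (\<lambda>x. u x - 2 * h x y)) \<partial>P)"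
    by (intro add_left_mono mult_left_mono jensen) auto
  also have "\<dots> = (\<integral>\<^sup>+y. ennreal (1/2 * \<Phi> (\<lambda>x. u x + 2 * h x y)) + ennreal (1/2) * ennreal (\<Phi> (\<lambda>x. u x - 2 * h x y)) \<partial>P)"
    by (subst nn_integral_add) (auto simp: nn_integral_cmult)
  also have "\<dots> = (\<integral>\<^sup>+y. ennreal (1/2 * \<Phi> (\<lambda>x. u x + 2 * h x y) + 1/2 * \<Phi> (\<lambda>x. u x - 2 * h x y)) \<partial>P)"
    by (simp only: half nonneg)
  finally show ?thesis unfolding \<Phi>_def E_def .
qed

text \<open>One coordinate is symmetrized at a time. The arbitrary offset \<open>v\<close> absorbs
  the coordinate held fixed while the induction hypothesis treats the others, so no independent copy
  of the sample is introduced. Fubini is used in both orders: the new coordinate is outermost for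
  the induction hypothesis and innermost for the single-coordinate inequality.\<close>

lemma symmetrization:
  fixes h :: "'p \<Rightarrow> 'a \<Rightarrow> real"
  assumes P: "prob_space P" and F: "finite F" "F \<noteq> {}" and h: "\<And>x. integrable P (h x)" and I: "finite I"
  shows "(\<integral>\<^sup>+\<omega>. ennreal (Max ((\<lambda>x. \<bar>v x + (\<Sum>i\<in>I. h x (\<omega> i) - (\<integral>z. h x z \<partial>P))\<bar>) ` F)) \<partial>PiM I (\<lambda>_. P))
      \<le> (\<integral>\<^sup>+\<omega>. ennreal (rademacher_avg I (\<lambda>S. Max ((\<lambda>x. \<bar>v x + 2 * (\<Sum>i\<in>I. rademacher_sign S i * h x (\<omega> i))\<bar>) ` F))) \<partial>PiM I (\<lambda>_. P))"
  using I
proof (induction I arbitrary: v rule: finite_induct)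
  case empty
  show ?case by (simp add: rademacher_avg_def)
next
  case (insert i I)
  interpret prob_space P by fact
  interpret product_sigma_finite "\<lambda>_. P" by unfold_locales
  note [measurable] = borel_measurable_integrable[OF h]
  note [simp] = insert(1,2) F
  define \<Phi> where "\<Phi> w = Max ((\<lambda>x. \<bar>w x\<bar>) ` F)" for w :: "'p \<Rightarrow> real"
  define E where "E x = (\<integral>z. h x z \<partial>P)" for x
  have nonneg: "0 \<le> \<Phi> w" for w
  proof -
    have "\<Phi> w \<in> (\<lambda>x. \<bar>w x\<bar>) ` F" unfolding \<Phi>_def by (intro Max_in) auto
    then show ?thesis by auto
  qed
  define G where "G \<omega> = ennreal (rademacher_avg I (\<lambda>S. \<Phi> (\<lambda>x. v x + (h x (\<omega> i) - E x) + 2 * (\<Sum>j\<in>I. rademacher_sign S j * h x (\<omega> j)))))" for \<omega>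
  have [measurable]: "G \<in> borel_measurable (PiM (insert i I) (\<lambda>_. P))"
    unfolding G_def \<Phi>_def rademacher_avg_def by measurable
  have ne: "j \<noteq> i" if "j \<in> I" for j using that insert(2) by auto
  have "(\<integral>\<^sup>+\<omega>. ennreal (\<Phi> (\<lambda>x. v x + (\<Sum>j\<in>insert i I. h x (\<omega> j) - E x))) \<partial>PiM (insert i I) (\<lambda>_. P))
      = (\<integral>\<^sup>+y. (\<integral>\<^sup>+\<omega>. ennreal (\<Phi> (\<lambda>x. v x + (\<Sum>j\<in>insert i I. h x (fun_upd \<omega> i y j) - E x))) \<partial>PiM I (\<lambda>_. P)) \<partial>P)"
    unfolding \<Phi>_def by (rule product_nn_integral_insert_rev) (simp_all, measurable)
  also have "\<dots> = (\<integral>\<^sup>+y. (\<integral>\<^sup>+\<omega>. ennreal (\<Phi> (\<lambda>x. (v x + (h x y - E x)) + (\<Sum>j\<in>I. h x (\<omega> j) - E x))) \<partial>PiM I (\<lambda>_. P)) \<partial>P)"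
    using ne by (simp add: add.assoc cong: sum.cong)
  also have "\<dots> \<le> (\<integral>\<^sup>+y. (\<integral>\<^sup>+\<omega>. ennreal (rademacher_avg I (\<lambda>S. \<Phi> (\<lambda>x. (v x + (h x y - E x)) + 2 * (\<Sum>j\<in>I. rademacher_sign S j * h x (\<omega> j))))) \<partial>PiM I (\<lambda>_. P)) \<partial>P)"
    unfolding \<Phi>_def E_def by (rule nn_integral_mono, rule insert.IH)
  also have "\<dots> = (\<integral>\<^sup>+y. (\<integral>\<^sup>+\<omega>. G (fun_upd \<omega> i y) \<partial>PiM I (\<lambda>_. P)) \<partial>P)"
    unfolding G_def using ne by (simp cong: sum.cong)
  also have "\<dots> = (\<integral>\<^sup>+\<omega>. G \<omega> \<partial>PiM (insert i I) (\<lambda>_. P))"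
    by (subst product_nn_integral_insert_rev) simp_all
  also have "\<dots> = (\<integral>\<^sup>+\<omega>. (\<integral>\<^sup>+y. G (fun_upd \<omega> i y) \<partial>P) \<partial>PiM I (\<lambda>_. P))"
    by (subst product_nn_integral_insert) simp_all
  also have "\<dots> \<le> (\<integral>\<^sup>+\<omega>. (\<integral>\<^sup>+y. ennreal (rademacher_avg (insert i I) (\<lambda>S. \<Phi> (\<lambda>x. v x + 2 * (\<Sum>j\<in>insert i I. rademacher_sign S j * h x (fun_upd \<omega> i y j))))) \<partial>P) \<partial>PiM I (\<lambda>_. P))"
  \<comment> \<open>With the old coordinates and their signs fixed, everything except the new
    summand is the constant offset \<open>u S\<close>, and \<open>nn_integral_Max_centred_le\<close>
    applies for each \<open>S\<close>.\<close>
  proof (rule nn_integral_mono)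
    fix \<omega> assume "\<omega> \<in> space (PiM I (\<lambda>_. P))"
    define u where "u S x = v x + 2 * (\<Sum>j\<in>I. rademacher_sign S j * h x (\<omega> j))" for S x
    have S1: "rademacher_sign (insert i S) j = rademacher_sign S j" if "j \<in> I" for S j
      using ne[OF that] by (simp add: rademacher_sign_def)
    have [measurable]: "(\<lambda>y. \<Phi> (\<lambda>x. w x y)) \<in> borel_measurable P" if "\<And>x. w x \<in> borel_measurable P" for w
      using that unfolding \<Phi>_def by (intro borel_measurable_Max) auto
    have "(\<integral>\<^sup>+y. G (fun_upd \<omega> i y) \<partial>P) = (\<integral>\<^sup>+y. ennreal (rademacher_avg I (\<lambda>S. \<Phi> (\<lambda>x. u S x + (h x y - E x)))) \<partial>P)"
      unfolding G_def u_def using ne by (simp add: algebra_simps cong: sum.cong)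
    also have "\<dots> = ennreal (1 / 2 ^ card I) * (\<Sum>S\<in>Pow I. \<integral>\<^sup>+y. ennreal (\<Phi> (\<lambda>x. u S x + (h x y - E x))) \<partial>P)"
      by (simp only: ennreal_rademacher_avg nonneg) (subst nn_integral_cmult; simp add: nn_integral_sum)
    also have "\<dots> \<le> ennreal (1 / 2 ^ card I) * (\<Sum>S\<in>Pow I. \<integral>\<^sup>+y. ennreal (1/2 * \<Phi> (\<lambda>x. u S x + 2 * h x y) + 1/2 * \<Phi> (\<lambda>x. u S x - 2 * h x y)) \<partial>P)"
      unfolding \<Phi>_def E_def by (intro mult_left_mono sum_mono nn_integral_Max_centred_le[OF P F h]) auto
    also have "\<dots> = (\<integral>\<^sup>+y. ennreal (rademacher_avg I (\<lambda>S. 1/2 * \<Phi> (\<lambda>x. u S x + 2 * h x y) + 1/2 * \<Phi> (\<lambda>x. u S x - 2 * h x y))) \<partial>P)"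
      by (simp only: ennreal_rademacher_avg nonneg add_nonneg_nonneg mult_nonneg_nonneg zero_le_divide_1_iff zero_le_numeral)
        (subst nn_integral_cmult; simp add: nn_integral_sum)
    also have "\<dots> = (\<integral>\<^sup>+y. ennreal (rademacher_avg (insert i I) (\<lambda>S. \<Phi> (\<lambda>x. v x + 2 * (\<Sum>j\<in>insert i I. rademacher_sign S j * h x (fun_upd \<omega> i y j))))) \<partial>P)"
    proof (intro nn_integral_cong arg_cong[where f = ennreal])
      fix y
      have A: "(\<Sum>j\<in>insert i I. rademacher_sign (insert i S) j * h x (fun_upd \<omega> i y j)) = h x y + (\<Sum>j\<in>I. rademacher_sign S j * h x (\<omega> j))" for S x
        using ne S1 by (simp cong: sum.cong) (simp add: rademacher_sign_def)
      have B: "(\<Sum>j\<in>insert i I. rademacher_sign S j * h x (fun_upd \<omega> i y j)) = - h x y + (\<Sum>j\<in>I. rademacher_sign S j * h x (\<omega> j))" if "S \<in> Pow I" for S x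
        using ne that insert(2) by (simp cong: sum.cong) (auto simp add: rademacher_sign_def)
      show "rademacher_avg I (\<lambda>S. 1/2 * \<Phi> (\<lambda>x. u S x + 2 * h x y) + 1/2 * \<Phi> (\<lambda>x. u S x - 2 * h x y))
        = rademacher_avg (insert i I) (\<lambda>S. \<Phi> (\<lambda>x. v x + 2 * (\<Sum>j\<in>insert i I. rademacher_sign S j * h x (fun_upd \<omega> i y j))))"
        unfolding rademacher_avg_insert[OF insert(1,2)] A unfolding rademacher_avg_def
        by (intro arg_cong2[where f = "(/)"] sum.cong refl) (simp only: B u_def, simp add: algebra_simps)
    qed
    finally show "(\<integral>\<^sup>+y. G (fun_upd \<omega> i y) \<partial>P) \<le> (\<integral>\<^sup>+y. ennreal (rademacher_avg (insert i I) (\<lambda>S. \<Phi> (\<lambda>x. v x + 2 * (\<Sum>j\<in>insert i I. rademacher_sign S j * h x (fun_upd \<omega> i y j))))) \<partial>P)" .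
  qed
  also have "\<dots> = (\<integral>\<^sup>+\<omega>. ennreal (rademacher_avg (insert i I) (\<lambda>S. \<Phi> (\<lambda>x. v x + 2 * (\<Sum>j\<in>insert i I. rademacher_sign S j * h x (\<omega> j))))) \<partial>PiM (insert i I) (\<lambda>_. P))"
    by (subst product_nn_integral_insert) (simp_all add: \<Phi>_def rademacher_avg_def, measurable)
  finally show ?case unfolding \<Phi>_def E_def .
qed

section \<open>Modulus of continuity of the empirical process\<close>

locale iid_sample = prob_space W for W :: "'w measure" +
  fixes P :: "'a measure" and \<xi> :: "nat \<Rightarrow> 'w \<Rightarrow> 'a"
  assumes prob_space_P: "prob_space P"
    and indep_\<xi>: "indep_vars (\<lambda>_. P) \<xi> UNIV"
    and distr_\<xi>: "\<And>i. distr W P (\<xi> i) = P"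
begin

sublocale P: prob_space P by (rule prob_space_P)

lemma measurable_\<xi> [measurable]: "\<xi> i \<in> measurable W P"
  using indep_\<xi> by (simp add: indep_vars_def2)

lemma \<xi>_in_space: "\<omega> \<in> space W \<Longrightarrow> \<xi> i \<omega> \<in> space P"
  using measurable_space[OF measurable_\<xi>] .

lemma distr_sample:
  assumes "0 < n"
  shows "distr W (PiM {..<n} (\<lambda>_. P)) (\<lambda>\<omega>. \<lambda>i\<in>{..<n}. \<xi> i \<omega>) = PiM {..<n} (\<lambda>_. P)"
  using indep_vars_iff_distr_eq_PiM[of "{..<n}" \<xi> "\<lambda>_. P"] indep_vars_subset[OF indep_\<xi>, of "{..<n}"] assms
  by (simp add: distr_\<xi> lessThan_empty_iff)

lemma integrable_\<xi>: "integrable P g \<Longrightarrow> integrable W (\<lambda>\<omega>. g (\<xi> i \<omega>))" for g :: "'a \<Rightarrow> real"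
  using integrable_distr[OF measurable_\<xi>[of i], of g] distr_\<xi> by simp

lemma expectation_\<xi>: "g \<in> borel_measurable P \<Longrightarrow> expectation (\<lambda>\<omega>. g (\<xi> i \<omega>)) = (\<integral>z. g z \<partial>P)" for g :: "'a \<Rightarrow> real"
  using integral_distr[OF measurable_\<xi>[of i], of g] distr_\<xi> by simp

lemma indep_vars_\<xi>: "g \<in> borel_measurable P \<Longrightarrow> indep_vars (\<lambda>_. borel) (\<lambda>i \<omega>. g (\<xi> i \<omega>)) UNIV" for g :: "'a \<Rightarrow> real"
  by (rule indep_vars_compose2[OF indep_\<xi>]) simp

end

lemma continuous_on_if_abs_diff_le:
  fixes f :: "'a::real_normed_vector \<Rightarrow> real"
  assumes "0 \<le> c" "\<And>x y. x \<in> S \<Longrightarrow> y \<in> S \<Longrightarrow> \<bar>f x - f y\<bar> \<le> c * norm (x - y)"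
  shows "continuous_on S f"
  by (rule lipschitz_on_continuous_on[of c]) (use assms in \<open>auto intro!: lipschitz_onI simp: dist_real_def dist_norm\<close>)

locale lipschitz_loss = iid_sample W P \<xi>
  for W :: "'w measure" and P :: "'a measure" and \<xi> :: "nat \<Rightarrow> 'w \<Rightarrow> 'a" +
  fixes X :: "(real ^ 'd) set" and l :: "real ^ 'd \<Rightarrow> 'a \<Rightarrow> real" and V :: "'a \<Rightarrow> real" and xs :: "real ^ 'd"
  assumes compact_X: "compact X" and xs: "xs \<in> X"
    and l_meas: "\<And>x. x \<in> X \<Longrightarrow> l x \<in> borel_measurable P"
    and V_meas [measurable]: "V \<in> borel_measurable P"
    and V_nonneg: "\<And>z. z \<in> space P \<Longrightarrow> 0 \<le> V z"
    and Lipschitz: "\<And>z x y. z \<in> space P \<Longrightarrow> x \<in> X \<Longrightarrow> y \<in> X \<Longrightarrow> \<bar>l x z - l y z\<bar> \<le> V z * norm (x - y)"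
    and integrable_V_sq: "integrable P (\<lambda>z. (V z)\<^sup>2)"
    and integrable_l_sq: "integrable P (\<lambda>z. (l xs z)\<^sup>2)"
    and minimal: "\<And>x. x \<in> X \<Longrightarrow> x \<noteq> xs \<Longrightarrow> (\<integral>z. l xs z \<partial>P) < (\<integral>z. l x z \<partial>P)"
begin

definition gap :: "real ^ 'd \<Rightarrow> real" where
  "gap x = (\<integral>z. l x z \<partial>P) - (\<integral>z. l xs z \<partial>P)"

text \<open>The unnormalized empirical process indexed by the loss differences
  \<open>l x - l xs\<close>; its natural size is \<open>sqrt n\<close>.\<close>

definition dev :: "nat \<Rightarrow> real ^ 'd \<Rightarrow> 'w \<Rightarrow> real" where
  "dev n x \<omega> = (\<Sum>i<n. l x (\<xi> i \<omega>) - l xs (\<xi> i \<omega>) - gap x)"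

text \<open>The added 1 makes \<open>Q\<close> positive and leaves room for the law of large
  numbers: the empirical second moment of \<open>V\<close> is below \<open>Q\<close> with high
  probability.\<close>

definition Q :: real where "Q = (\<integral>z. (V z)\<^sup>2 \<partial>P) + 1"

lemma Q_pos: "0 < Q" unfolding Q_def by (intro add_nonneg_pos integral_nonneg) auto

lemma integrable_V: "integrable P V"
  using P.square_integrable_imp_integrable[OF V_meas integrable_V_sq] .

lemma integrable_l_xs: "integrable P (l xs)"
  using P.square_integrable_imp_integrable[OF l_meas[OF xs] integrable_l_sq] .

lemma integrable_l: assumes "x \<in> X" shows "integrable P (l x)"
proof -
  have "integrable P (\<lambda>z. l x z - l xs z)"
    by (rule Bochner_Integration.integrable_bound[of _ "\<lambda>z. V z * norm (x - xs)"])
      (use Lipschitz[OF _ assms xs] V_nonneg integrable_V l_meas[OF assms] l_meas[OF xs] in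
        \<open>auto intro!: borel_measurable_diff AE_I2 simp: abs_mult\<close>)
  from Bochner_Integration.integrable_add[OF this integrable_l_xs] show ?thesis by simp
qed

lemma measurable_l [measurable]: "x \<in> X \<Longrightarrow> l x \<in> borel_measurable P"
  using l_meas .

lemma continuous_on_l: "z \<in> space P \<Longrightarrow> continuous_on X (\<lambda>x. l x z)"
  by (rule continuous_on_if_abs_diff_le[of "V z"]) (use Lipschitz V_nonneg in auto)

lemma continuous_on_gap: "continuous_on X gap"
proof (rule continuous_on_if_abs_diff_le[of "\<integral>z. V z \<partial>P"])
  show "0 \<le> (\<integral>z. V z \<partial>P)" using V_nonneg by (intro integral_nonneg_AE AE_I2) auto
  fix x y assume xy: "x \<in> X" "y \<in> X"
  have "\<bar>gap x - gap y\<bar> = \<bar>\<integral>z. l x z - l y z \<partial>P\<bar>"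
    unfolding gap_def using integrable_l xy by simp
  also have "\<dots> \<le> (\<integral>z. \<bar>l x z - l y z\<bar> \<partial>P)" by (rule integral_abs_bound)
  also have "\<dots> \<le> (\<integral>z. V z * norm (x - y) \<partial>P)"
    using integrable_l xy integrable_V Lipschitz by (intro integral_mono) auto
  finally show "\<bar>gap x - gap y\<bar> \<le> (\<integral>z. V z \<partial>P) * norm (x - y)" by simp
qed

lemma continuous_on_dev: "\<omega> \<in> space W \<Longrightarrow> continuous_on X (\<lambda>x. dev n x \<omega>)"
  unfolding dev_def
  by (intro continuous_intros continuous_on_l continuous_on_gap xs) (simp_all add: \<xi>_in_space)

lemma measurable_dev [measurable]: "x \<in> X \<Longrightarrow> dev n x \<in> borel_measurable W"
  unfolding dev_def[abs_def] using xs by measurable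

text \<open>Symmetrization on the product space is followed by chaining for each fixed sample. The
  bound is linear in \<open>r\<close> and does not depend on \<open>F\<close>, which is what
  equicontinuity at scale \<open>sqrt n\<close> requires.\<close>

lemma nn_integral_Max_dev_le:
  assumes n: "0 < n" and F: "finite F" "F \<noteq> {}" "F \<subseteq> X \<inter> cball xs r" and r: "0 < r"
  shows "(\<integral>\<^sup>+\<omega>. ennreal (Max ((\<lambda>x. \<bar>dev n x \<omega>\<bar>) ` F)) \<partial>W)
      \<le> ennreal (2 * chaining_const CARD('d) * r * sqrt (n * Q))"
proof -
  define C where "C = chaining_const CARD('d)"
  have C: "0 \<le> C" by (simp add: C_def chaining_const_def)
  \<comment> \<open>Extension by 0 outside \<open>X\<close> makes \<open>h x\<close> integrable for
    every \<open>x\<close>, as \<open>symmetrization\<close> demands.\<close>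
  define h where "h x z = (if x \<in> X then l x z - l xs z else 0)" for x z
  have h_int: "integrable P (h x)" for x
    using integrable_l[of x] integrable_l_xs by (cases "x \<in> X") (auto simp: h_def[abs_def])
  have hE: "(\<integral>z. h x z \<partial>P) = gap x" if "x \<in> X" for x
    using that integrable_l[of x] integrable_l_xs by (simp add: h_def gap_def)
  note [measurable] = borel_measurable_integrable[OF h_int]
  let ?M = "PiM {..<n} (\<lambda>_. P)"
  let ?s = "\<lambda>\<omega>. \<lambda>i\<in>{..<n}. \<xi> i \<omega>"
  have s [measurable]: "?s \<in> measurable W ?M"
    by (intro measurable_restrict measurable_\<xi>)
  define G where "G y = ennreal (Max ((\<lambda>x. \<bar>0 + (\<Sum>i\<in>{..<n}. h x (y i) - (\<integral>z. h x z \<partial>P))\<bar>) ` F))" for y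
  define H where "H y = ennreal (rademacher_avg {..<n} (\<lambda>S. Max ((\<lambda>x. \<bar>0 + 2 * (\<Sum>i\<in>{..<n}. rademacher_sign S i * h x (y i))\<bar>) ` F)))" for y
  have G [measurable]: "G \<in> borel_measurable ?M"
    unfolding G_def using F(1) by measurable
  have H [measurable]: "H \<in> borel_measurable ?M"
    unfolding H_def rademacher_avg_def using F(1) by measurable
  \<comment> \<open>The inequality \<open>y \<le> (y^2 / a + a) / 2\<close> linearizes the random
    square root, so its expectation is computed from that of the squares.\<close>
  define a where "a = sqrt (n * Q)"
  have a: "0 < a" "a\<^sup>2 = n * Q" using n Q_pos by (auto simp: a_def)
  have "(\<integral>\<^sup>+\<omega>. ennreal (Max ((\<lambda>x. \<bar>dev n x \<omega>\<bar>) ` F)) \<partial>W) = (\<integral>\<^sup>+\<omega>. G (?s \<omega>) \<partial>W)"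
  proof (intro nn_integral_cong)
    fix \<omega>
    have "dev n x \<omega> = 0 + (\<Sum>i\<in>{..<n}. h x (?s \<omega> i) - (\<integral>z. h x z \<partial>P))" if "x \<in> F" for x
    proof -
      have x: "x \<in> X" using that F(3) by auto
      show ?thesis unfolding dev_def hE[OF x] using x by (simp add: h_def)
    qed
    then have "(\<lambda>x. \<bar>dev n x \<omega>\<bar>) ` F = (\<lambda>x. \<bar>0 + (\<Sum>i\<in>{..<n}. h x (?s \<omega> i) - (\<integral>z. h x z \<partial>P))\<bar>) ` F"
      by (intro image_cong refl) (simp only:)
    then show "ennreal (Max ((\<lambda>x. \<bar>dev n x \<omega>\<bar>) ` F)) = G (?s \<omega>)" by (simp add: G_def)
  qed
  also have "\<dots> = (\<integral>\<^sup>+y. G y \<partial>distr W ?M ?s)" by (rule nn_integral_distr[symmetric, OF s]) simp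
  also have "\<dots> = (\<integral>\<^sup>+y. G y \<partial>?M)" by (simp only: distr_sample[OF n])
  also have "\<dots> \<le> (\<integral>\<^sup>+y. H y \<partial>?M)"
    unfolding G_def H_def by (rule symmetrization[OF prob_space_P F(1,2) h_int]) simp
  also have "\<dots> = (\<integral>\<^sup>+y. H y \<partial>distr W ?M ?s)" by (simp only: distr_sample[OF n])
  also have "\<dots> = (\<integral>\<^sup>+\<omega>. H (?s \<omega>) \<partial>W)" by (rule nn_integral_distr[OF s]) simp
  also have "\<dots> \<le> (\<integral>\<^sup>+\<omega>. ennreal (2 * C * r * (((\<Sum>i<n. (V (\<xi> i \<omega>))\<^sup>2) / a + a) / 2)) \<partial>W)"
  proof (intro nn_integral_mono)
    fix \<omega> assume \<omega>: "\<omega> \<in> space W"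
    define R where "R S x = \<bar>\<Sum>i\<in>{..<n}. rademacher_sign S i * h x (\<xi> i \<omega>)\<bar>" for S x
    have two: "Max ((\<lambda>x. 2 * R S x) ` F) \<le> 2 * Max (R S ` F)" for S
      using F by (subst Max_le_iff) auto
    have "rademacher_avg {..<n} (\<lambda>S. Max ((\<lambda>x. \<bar>0 + 2 * (\<Sum>i\<in>{..<n}. rademacher_sign S i * h x (?s \<omega> i))\<bar>) ` F))
        = rademacher_avg {..<n} (\<lambda>S. Max ((\<lambda>x. 2 * R S x) ` F))"
    proof -
      have "(\<Sum>i\<in>{..<n}. rademacher_sign S i * h x (?s \<omega> i)) = (\<Sum>i\<in>{..<n}. rademacher_sign S i * h x (\<xi> i \<omega>))" for S x
        by (intro sum.cong) auto
      then show ?thesis by (simp add: R_def abs_mult)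
    qed
    also have "\<dots> \<le> 2 * rademacher_avg {..<n} (\<lambda>S. Max (R S ` F))"
      unfolding rademacher_avg_cmult[symmetric] by (intro rademacher_avg_mono two)
    finally have H1: "rademacher_avg {..<n} (\<lambda>S. Max ((\<lambda>x. \<bar>0 + 2 * (\<Sum>i\<in>{..<n}. rademacher_sign S i * h x (?s \<omega> i))\<bar>) ` F)) \<le> 2 * rademacher_avg {..<n} (\<lambda>S. Max (R S ` F))" .
    have "rademacher_avg {..<n} (\<lambda>S. Max (R S ` F)) \<le> C * r * sqrt (\<Sum>i\<in>{..<n}. (V (\<xi> i \<omega>))\<^sup>2)"
      unfolding R_def C_def
    proof (rule rademacher_avg_chaining)
      show "h xs (\<xi> i \<omega>) = 0" for i by (simp add: h_def)
      show "0 \<le> V (\<xi> i \<omega>)" for i using V_nonneg \<xi>_in_space \<omega> by auto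
      fix i x y assume "x \<in> insert xs F" "y \<in> insert xs F"
      then have "x \<in> X" "y \<in> X" using F xs by auto
      then show "\<bar>h x (\<xi> i \<omega>) - h y (\<xi> i \<omega>)\<bar> \<le> V (\<xi> i \<omega>) * norm (x - y)"
        using Lipschitz[OF \<xi>_in_space[OF \<omega>], of x y] by (simp add: h_def)
    qed (use F r in auto)
    also have "\<dots> \<le> C * r * (((\<Sum>i<n. (V (\<xi> i \<omega>))\<^sup>2) / a + a) / 2)"
    proof (rule mult_left_mono)
    show "sqrt (\<Sum>i\<in>{..<n}. (V (\<xi> i \<omega>))\<^sup>2) \<le> ((\<Sum>i<n. (V (\<xi> i \<omega>))\<^sup>2) / a + a) / 2"
    proof -
      define y where "y = sqrt (\<Sum>i\<in>{..<n}. (V (\<xi> i \<omega>))\<^sup>2)"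
      have y: "(\<Sum>i<n. (V (\<xi> i \<omega>))\<^sup>2) = y\<^sup>2" by (simp add: y_def sum_nonneg)
      have "0 \<le> (y - a)\<^sup>2" by simp
      then have "2 * y * a \<le> y\<^sup>2 + a\<^sup>2" by (simp add: power2_diff algebra_simps)
      then have "y \<le> (y\<^sup>2 / a + a) / 2" using a by (simp add: field_simps power2_eq_square)
      then show ?thesis unfolding y[symmetric] y_def[symmetric] .
    qed
    qed (use C r in auto)
    finally show "H (?s \<omega>) \<le> ennreal (2 * C * r * (((\<Sum>i<n. (V (\<xi> i \<omega>))\<^sup>2) / a + a) / 2))"
      unfolding H_def using H1 by (intro ennreal_leI) simp
  qed
  also have "\<dots> = ennreal (\<integral>\<omega>. 2 * C * r * (((\<Sum>i<n. (V (\<xi> i \<omega>))\<^sup>2) / a + a) / 2) \<partial>W)"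
    using C r a integrable_\<xi>[OF integrable_V_sq]
    by (intro nn_integral_eq_integral AE_I2) (auto intro!: mult_nonneg_nonneg add_nonneg_nonneg divide_nonneg_pos sum_nonneg)
  also have "(\<integral>\<omega>. 2 * C * r * (((\<Sum>i<n. (V (\<xi> i \<omega>))\<^sup>2) / a + a) / 2) \<partial>W) = 2 * C * r * ((n * (Q - 1) / a + a) / 2)"
    using integrable_\<xi>[OF integrable_V_sq] expectation_\<xi>[of "\<lambda>z. (V z)\<^sup>2"]
    by (simp add: prob_space Q_def)
  also have "\<dots> \<le> 2 * C * r * a"
  proof (intro mult_left_mono)
    have "n * (Q - 1) / a \<le> a" using a by (simp add: field_simps power2_eq_square)
    then show "(n * (Q - 1) / a + a) / 2 \<le> a" by simp
  qed (use C r in auto)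
  finally show ?thesis by (auto simp: C_def a_def ennreal_leI)
qed

text \<open>Markov's inequality holds with one bound for all finite pieces \<open>F m\<close> of a
  countable dense set. The events \<open>E m\<close> increase, so continuity from below keeps the
  bound for their union, and continuity in \<open>x\<close> extends the estimate to the whole ball.
  The exceptional set is measurable and the same for all \<open>x\<close>.\<close>

lemma dev_tail:
  assumes n: "0 < n" and r: "0 < r" and t: "0 < t"
  shows "\<exists>B\<in>sets W. prob B \<le> 2 * chaining_const CARD('d) * r * sqrt Q / t \<and>
    (\<forall>\<omega>\<in>space W - B. \<forall>x\<in>X \<inter> cball xs r. \<bar>dev n x \<omega>\<bar> \<le> t * sqrt n)"
proof -
  define S where "S = X \<inter> cball xs r"
  define D where "D = 2 * chaining_const CARD('d) * r"
  have D: "0 \<le> D" using r by (simp add: D_def chaining_const_def)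
  obtain A where A: "countable A" "A \<subseteq> S" "S \<subseteq> closure A" using separable by blast
  have "xs \<in> S" using xs r by (simp add: S_def)
  then have "A \<noteq> {}" using A(3) by fastforce
  then have range: "range (from_nat_into A) = A" using A by (simp add: range_from_nat_into)
  have cl: "closure A \<subseteq> S"
    using A compact_X by (intro closure_minimal) (auto simp: S_def intro: closed_Int compact_imp_closed)
  define c where "c = t * sqrt n"
  have c: "0 < c" using n t by (simp add: c_def)
  define F where "F m = from_nat_into A ` {..m}" for m
  have F: "finite (F m)" "F m \<noteq> {}" "F m \<subseteq> X \<inter> cball xs r" for m
    using range A(2) by (auto simp: F_def S_def)
  have [measurable]: "dev n x \<in> borel_measurable W" if "x \<in> F m" for x m
    by (rule measurable_dev) (use F(3)[of m] that in blast)
  define E where "E m = {\<omega>\<in>space W. \<exists>x\<in>F m. c < \<bar>dev n x \<omega>\<bar>}" for m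
  have E: "E m \<in> sets W" for m
  proof -
    have "E m = (\<Union>x\<in>F m. {\<omega>\<in>space W. c < \<bar>dev n x \<omega>\<bar>})" by (auto simp: E_def)
    also have "\<dots> \<in> sets W" using F by (intro sets.finite_UN) auto
    finally show ?thesis .
  qed
  have bound: "prob (E m) \<le> D * sqrt Q / t" for m
  proof -
    define Y where "Y \<omega> = ennreal (Max ((\<lambda>x. \<bar>dev n x \<omega>\<bar>) ` F m))" for \<omega>
    have Y [measurable]: "Y \<in> borel_measurable W"
      unfolding Y_def by (intro measurable_compose[OF borel_measurable_Max measurable_ennreal] F) auto
    have sub: "E m \<subseteq> {\<omega>\<in>space W. 1 \<le> ennreal (1 / c) * Y \<omega>}"
    proof
      fix \<omega> assume "\<omega> \<in> E m"
      then obtain x where x: "x \<in> F m" "c < \<bar>dev n x \<omega>\<bar>" and \<omega>: "\<omega> \<in> space W" by (auto simp: E_def)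
      have "c \<le> Max ((\<lambda>x. \<bar>dev n x \<omega>\<bar>) ` F m)"
        using x F by (intro order.trans[OF less_imp_le Max_ge]) auto
      then have "1 \<le> 1 / c * Max ((\<lambda>x. \<bar>dev n x \<omega>\<bar>) ` F m)" using c by (simp add: field_simps)
      then have "ennreal 1 \<le> ennreal (1 / c * Max ((\<lambda>x. \<bar>dev n x \<omega>\<bar>) ` F m))" by (rule ennreal_leI)
      also have "\<dots> = ennreal (1 / c) * Y \<omega>" using c by (simp only: Y_def) (rule ennreal_mult', simp)
      finally show "\<omega> \<in> {\<omega>\<in>space W. 1 \<le> ennreal (1 / c) * Y \<omega>}" using \<omega> by simp
    qed
    have "emeasure W (E m) \<le> emeasure W {\<omega>\<in>space W. 1 \<le> ennreal (1 / c) * Y \<omega>}"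
      by (rule emeasure_mono[OF sub]) measurable
    also have "\<dots> \<le> ennreal (1 / c) * (\<integral>\<^sup>+\<omega>. Y \<omega> * indicator (space W) \<omega> \<partial>W)"
      by (rule nn_integral_Markov_inequality) auto
    also have "(\<integral>\<^sup>+\<omega>. Y \<omega> * indicator (space W) \<omega> \<partial>W) = (\<integral>\<^sup>+\<omega>. Y \<omega> \<partial>W)"
      by (intro nn_integral_cong) auto
    also have "\<dots> \<le> ennreal (D * sqrt (n * Q))"
      unfolding Y_def D_def by (rule nn_integral_Max_dev_le[OF n F r])
    finally have "emeasure W (E m) \<le> ennreal (1 / c) * ennreal (D * sqrt (n * Q))"
      by (simp add: mult_left_mono)
    also have "\<dots> = ennreal (1 / c * (D * sqrt (n * Q)))"
      using c by (intro ennreal_mult'[symmetric]) simp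
    also have "1 / c * (D * sqrt (n * Q)) = D * sqrt Q / t"
      using n t by (simp add: c_def real_sqrt_mult)
    finally show ?thesis
      using D Q_pos t by (simp add: emeasure_eq_measure ennreal_le_iff)
  qed
  have inc: "incseq E" 
  proof (rule incseq_SucI)
    fix m
    have "F m \<subseteq> F (Suc m)" unfolding F_def by (intro image_mono) auto
    then show "E m \<subseteq> E (Suc m)" unfolding E_def by blast
  qed
  have "(\<lambda>m. prob (E m)) \<longlonglongrightarrow> prob (\<Union>m. E m)"
    using E inc by (intro finite_Lim_measure_incseq) blast+
  then have "prob (\<Union>m. E m) \<le> D * sqrt Q / t"
    by (rule LIMSEQ_le_const2) (use bound in blast)
  moreover have "(\<Union>m. E m) \<in> sets W" using E by (intro sets.countable_nat_UN) blast
  moreover have "\<bar>dev n x \<omega>\<bar> \<le> t * sqrt n" if \<omega>: "\<omega> \<in> space W - (\<Union>m. E m)" and x: "x \<in> X \<inter> cball xs r" for \<omega> x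
  proof -
    have A_le: "\<bar>dev n y \<omega>\<bar> \<le> c" if "y \<in> A" for y
    proof -
      obtain k where "y = from_nat_into A k"
        using \<open>y \<in> A\<close> A(1) by (metis from_nat_into_to_nat_on)
      then have "y \<in> F k" by (simp add: F_def)
      moreover have "\<omega> \<notin> E k" "\<omega> \<in> space W" using \<omega> by blast+
      ultimately show ?thesis unfolding E_def by (metis (mono_tags, lifting) mem_Collect_eq not_less)
    qed
    have "continuous_on (closure A) (\<lambda>x. \<bar>dev n x \<omega>\<bar>)"
      using \<omega> cl by (intro continuous_intros continuous_on_subset[OF continuous_on_dev]) (auto simp: S_def)
    then have "\<bar>dev n x \<omega>\<bar> \<le> c"
      by (rule continuous_le_on_closure) (use A_le A x in \<open>auto simp: S_def\<close>)
    then show ?thesis by (simp add: c_def)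
  qed
  ultimately show ?thesis unfolding D_def[symmetric] by (intro bexI[of _ "\<Union>m. E m"]) auto
qed

end

section \<open>Limit theorems\<close>

text \<open>The exceptional sets are measurable, while the sets \<open>{\<omega>. A n \<omega>}\<close> need not be.\<close>

definition whp :: "'w measure \<Rightarrow> (nat \<Rightarrow> 'w \<Rightarrow> bool) \<Rightarrow> bool" where
  "whp M A \<longleftrightarrow> (\<forall>e>0. \<forall>\<^sub>F n in sequentially. \<exists>B\<in>sets M. measure M B \<le> e \<and> (\<forall>\<omega>\<in>space M - B. A n \<omega>))"

lemma whpD:
  "whp M A \<Longrightarrow> 0 < e \<Longrightarrow> \<forall>\<^sub>F n in sequentially. \<exists>B\<in>sets M. measure M B \<le> e \<and> (\<forall>\<omega>\<in>space M - B. A n \<omega>)"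
  by (simp add: whp_def)

lemma whp_mono_eventually:
  assumes "whp M A" "\<forall>\<^sub>F n in sequentially. \<forall>\<omega>\<in>space M. A n \<omega> \<longrightarrow> A' n \<omega>"
  shows "whp M A'"
  unfolding whp_def
proof (intro allI impI)
  fix e :: real assume "0 < e"
  then have "\<forall>\<^sub>F n in sequentially. \<exists>B\<in>sets M. measure M B \<le> e \<and> (\<forall>\<omega>\<in>space M - B. A n \<omega>)"
    using assms(1) by (simp add: whp_def)
  with assms(2) show "\<forall>\<^sub>F n in sequentially. \<exists>B\<in>sets M. measure M B \<le> e \<and> (\<forall>\<omega>\<in>space M - B. A' n \<omega>)"
    by eventually_elim blast
qed

context prob_space
begin

lemma whp_conj:
  assumes "whp M A" "whp M A'"
  shows "whp M (\<lambda>n \<omega>. A n \<omega> \<and> A' n \<omega>)"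
  unfolding whp_def
proof (intro allI impI)
  fix e :: real assume "0 < e"
  then have "0 < e / 2" by simp
  note whpD[OF assms(1) this] whpD[OF assms(2) this]
  then show "\<forall>\<^sub>F n in sequentially. \<exists>B\<in>sets M. measure M B \<le> e \<and> (\<forall>\<omega>\<in>space M - B. A n \<omega> \<and> A' n \<omega>)"
  proof eventually_elim
    case (elim n)
    then obtain B B' where B: "B \<in> sets M" "prob B \<le> e / 2" "\<forall>\<omega>\<in>space M - B. A n \<omega>"
      "B' \<in> sets M" "prob B' \<le> e / 2" "\<forall>\<omega>\<in>space M - B'. A' n \<omega>" by blast
    have "prob (B \<union> B') \<le> prob B + prob B'" using B by (intro measure_Un_le) auto
    also have "\<dots> \<le> e" using B by simp
    finally show ?case using B by (intro bexI[of _ "B \<union> B'"]) auto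
  qed
qed

text \<open>The standard normal law has no atoms, so the limiting probabilities of the two enclosing
  intervals differ little for small \<open>\<tau>\<close>. Half-open intervals are used because they
  are differences of distribution functions.\<close>

lemma whp_sandwich:
  assumes Z [measurable]: "\<And>n. Z n \<in> borel_measurable M"
    and conv: "weak_conv_m (\<lambda>n. distr M borel (Z n)) std_normal_distribution"
    and E [measurable]: "\<And>n. E n \<in> sets M" and y: "0 < y"
    and sandwich: "\<And>\<tau>. 0 < \<tau> \<Longrightarrow> whp M (\<lambda>n \<omega>. (\<bar>Z n \<omega>\<bar> \<le> y - \<tau> \<longrightarrow> \<omega> \<in> E n) \<and> (\<omega> \<in> E n \<longrightarrow> \<bar>Z n \<omega>\<bar> \<le> y + \<tau>))"
  shows "(\<lambda>n. prob (E n)) \<longlonglongrightarrow> measure std_normal_distribution {- y..y}"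
proof -
  interpret N: real_distribution std_normal_distribution by (rule real_dist_normal_dist)
  have atom: "measure std_normal_distribution {x} = 0" for x
  proof -
    have "emeasure std_normal_distribution {x} = 0"
      by (subst emeasure_density) (auto simp: nn_integral_0_iff_AE intro!: AE_I'[of "{x}"])
    then show ?thesis by (simp add: measure_def)
  qed
  have cont: "isCont (cdf std_normal_distribution) x" for x
    using atom N.isCont_cdf by simp
  define G where "G z = cdf std_normal_distribution z - cdf std_normal_distribution (- z)" for z
  define Gn where "Gn n z = prob {\<omega>\<in>space M. - z < Z n \<omega> \<and> Z n \<omega> \<le> z}" for n z
  have Gn_lim: "(\<lambda>n. Gn n z) \<longlonglongrightarrow> G z" if z: "0 < z" for z
  proof -
    have "Gn n z = cdf (distr M borel (Z n)) z - cdf (distr M borel (Z n)) (- z)" for n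
    proof -
      interpret D: real_distribution "distr M borel (Z n)" by (rule real_distribution_distr) simp
      have "cdf (distr M borel (Z n)) z - cdf (distr M borel (Z n)) (- z) = measure (distr M borel (Z n)) {- z<..z}"
        using z by (intro D.cdf_diff_eq) simp
      also have "\<dots> = Gn n z"
        unfolding Gn_def by (subst measure_distr) (auto intro!: arg_cong[where f = prob])
      finally show ?thesis by simp
    qed
    moreover have "(\<lambda>n. cdf (distr M borel (Z n)) x) \<longlonglongrightarrow> cdf std_normal_distribution x" for x
      using conv cont by (simp add: weak_conv_m_def weak_conv_def)
    ultimately show ?thesis unfolding G_def by (simp add: tendsto_diff)
  qed
  have "{- y..y} = {- y} \<union> {- y<..y}" using y by auto
  then have "measure std_normal_distribution {- y..y} = measure std_normal_distribution ({- y} \<union> {- y<..y})" by simp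
  also have "\<dots> = measure std_normal_distribution {- y} + measure std_normal_distribution {- y<..y}"
    by (rule N.finite_measure_Union) auto
  also have "\<dots> = G y"
    using y N.cdf_diff_eq[of "- y" y] by (simp add: atom G_def)
  finally have lim: "measure std_normal_distribution {- y..y} = G y" .
  have "isCont (\<lambda>z. cdf std_normal_distribution (- z)) y"
    by (rule isCont_o2[OF _ cont]) simp
  then have "isCont G y" unfolding G_def[abs_def] using cont by (intro isCont_diff)
  show ?thesis unfolding lim
  proof (rule tendstoI)
    fix e :: real assume e: "0 < e"
    then obtain d where d: "0 < d" "\<And>z. dist z y < d \<Longrightarrow> dist (G z) (G y) < e / 4"
      using \<open>isCont G y\<close> unfolding continuous_at_eps_delta by (metis zero_less_divide_iff zero_less_numeral)
    \<comment> \<open>The upper event uses \<open>y + 2 * \<tau>\<close>: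
      \<open>\<bar>Z n \<omega>\<bar> \<le> y + \<tau>\<close> permits equality at the left end,
      which the half-open interval of radius \<open>y + \<tau>\<close> would exclude.\<close>
    define \<tau> where "\<tau> = min (d / 3) (y / 2)"
    have \<tau>: "0 < \<tau>" "2 * \<tau> < d" "0 < y - \<tau>" using d y by (auto simp: \<tau>_def)
    have G1: "dist (G (y - \<tau>)) (G y) < e / 4" "dist (G (y + 2 * \<tau>)) (G y) < e / 4"
      using d(2)[of "y - \<tau>"] d(2)[of "y + 2 * \<tau>"] \<tau> by (simp_all add: dist_real_def)
    have "\<forall>\<^sub>F n in sequentially. dist (Gn n (y - \<tau>)) (G (y - \<tau>)) < e / 4"
      using Gn_lim[of "y - \<tau>"] \<tau> e by (intro tendstoD) auto
    moreover have "\<forall>\<^sub>F n in sequentially. dist (Gn n (y + 2 * \<tau>)) (G (y + 2 * \<tau>)) < e / 4"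
      using Gn_lim[of "y + 2 * \<tau>"] \<tau> y e by (intro tendstoD) auto
    moreover have "\<forall>\<^sub>F n in sequentially. \<exists>B\<in>sets M. prob B \<le> e / 4 \<and>
        (\<forall>\<omega>\<in>space M - B. (\<bar>Z n \<omega>\<bar> \<le> y - \<tau> \<longrightarrow> \<omega> \<in> E n) \<and> (\<omega> \<in> E n \<longrightarrow> \<bar>Z n \<omega>\<bar> \<le> y + \<tau>))"
      by (rule whpD[OF sandwich[OF \<tau>(1)]]) (use e in simp)
    ultimately show "\<forall>\<^sub>F n in sequentially. dist (prob (E n)) (G y) < e"
    proof eventually_elim
      case (elim n)
      from elim(3) obtain B where B: "B \<in> sets M" "prob B \<le> e / 4"
        "\<And>\<omega>. \<omega> \<in> space M - B \<Longrightarrow> \<bar>Z n \<omega>\<bar> \<le> y - \<tau> \<Longrightarrow> \<omega> \<in> E n"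
        "\<And>\<omega>. \<omega> \<in> space M - B \<Longrightarrow> \<omega> \<in> E n \<Longrightarrow> \<bar>Z n \<omega>\<bar> \<le> y + \<tau>" by blast
      have "Gn n (y - \<tau>) \<le> prob (E n \<union> B)"
        unfolding Gn_def using B(1,3) by (intro finite_measure_mono) auto
      also have "\<dots> \<le> prob (E n) + prob B" using B by (intro measure_Un_le) auto
      finally have lo: "Gn n (y - \<tau>) \<le> prob (E n) + e / 4" using B by simp
      have "prob (E n) \<le> prob ({\<omega>\<in>space M. - (y + 2 * \<tau>) < Z n \<omega> \<and> Z n \<omega> \<le> y + 2 * \<tau>} \<union> B)"
      proof (intro finite_measure_mono subsetI)
        fix \<omega> assume \<omega>: "\<omega> \<in> E n"
        then have "\<omega> \<in> space M" using sets.sets_into_space[OF E] by auto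
        then show "\<omega> \<in> {\<omega>\<in>space M. - (y + 2 * \<tau>) < Z n \<omega> \<and> Z n \<omega> \<le> y + 2 * \<tau>} \<union> B"
          using B(4)[of \<omega>] \<omega> \<tau>(1) by (cases "\<omega> \<in> B") auto
      qed (use B in auto)
      also have "\<dots> \<le> Gn n (y + 2 * \<tau>) + prob B"
        unfolding Gn_def using B by (intro measure_Un_le) auto
      finally have "prob (E n) \<le> Gn n (y + 2 * \<tau>) + e / 4" using B by simp
      then show ?case using lo elim(1,2) G1 unfolding dist_real_def abs_less_iff by linarith
    qed
  qed
qed

end

section \<open>Laws of large numbers and sample maxima under minimal moments\<close>

context iid_sample
begin

text \<open>It will be applied to squares of functions that have only two moments, so no variance is
  at hand. Truncation at a fixed level \<open>k\<close> gives a bounded part, handled by Hoeffding's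
  inequality, and a remainder with small absolute mean, handled by Markov's inequality.\<close>

lemma weak_law_of_large_numbers:
  fixes g :: "'a \<Rightarrow> real"
  assumes g: "integrable P g" and \<kappa>: "0 < \<kappa>"
  shows "whp W (\<lambda>n \<omega>. \<bar>(\<Sum>i<n. g (\<xi> i \<omega>)) / n - (\<integral>z. g z \<partial>P)\<bar> \<le> \<kappa>)"
  unfolding whp_def
proof (intro allI impI)
  fix e :: real assume e: "0 < e"
  note [measurable] = borel_measurable_integrable[OF g]
  define t where "t k z = (if \<bar>g z\<bar> \<le> real k then g z else 0)" for k z
  have t_meas [measurable]: "t k \<in> borel_measurable P" for k unfolding t_def[abs_def] by measurable
  have t_le: "\<bar>t k z\<bar> \<le> \<bar>g z\<bar>" "\<bar>t k z\<bar> \<le> real k" for k z by (auto simp: t_def)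
  have t_int: "integrable P (t k)" for k
    by (rule Bochner_Integration.integrable_bound[OF g]) (use t_le in auto)
  \<comment> \<open>The entry \<open>\<kappa> / 3\<close> controls the bias of the truncated mean;
    \<open>\<kappa> * e / 6\<close> turns Markov's inequality at level \<open>\<kappa> / 3\<close>
    into \<open>e / 2\<close>.\<close>
  define \<delta> where "\<delta> = min (\<kappa> / 3) (\<kappa> * e / 6)"
  have \<delta>: "0 < \<delta>" using \<kappa> e by (simp add: \<delta>_def)
  have "(\<lambda>k. \<integral>z. \<bar>g z - t k z\<bar> \<partial>P) \<longlonglongrightarrow> (\<integral>z. 0 \<partial>P)"
  proof (rule integral_dominated_convergence[where w = "\<lambda>z. \<bar>g z\<bar>"])
    show "AE z in P. (\<lambda>k. \<bar>g z - t k z\<bar>) \<longlonglongrightarrow> 0"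
    proof (intro AE_I2 tendsto_eventually)
      fix z
      obtain k0 where "\<bar>g z\<bar> \<le> real k0" using real_arch_simple by blast
      then show "\<forall>\<^sub>F k in sequentially. \<bar>g z - t k z\<bar> = 0"
        by (intro eventually_sequentiallyI[of k0]) (auto simp: t_def)
    qed
  qed (use g in \<open>auto simp: t_def\<close>)
  then have "\<forall>\<^sub>F k in sequentially. (\<integral>z. \<bar>g z - t k z\<bar> \<partial>P) < \<delta>"
    by (rule order_tendstoD(2)) (use \<delta> in simp)
  then obtain k where k: "(\<integral>z. \<bar>g z - t k z\<bar> \<partial>P) < \<delta>" by (auto simp: eventually_sequentially)
  have d_int: "integrable P (\<lambda>z. \<bar>g z - t k z\<bar>)" using g t_int by simp
  \<comment> \<open>The added 1 keeps the range nondegenerate when \<open>k = 0\<close>.\<close>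
  define b where "b = real k + 1"
  have b: "0 < b" by (simp add: b_def)
  have "(\<lambda>n. 2 * exp (- (\<kappa>\<^sup>2 / (18 * b\<^sup>2)) * real n)) \<longlonglongrightarrow> 0"
    using \<kappa> b by real_asymp
  then have "\<forall>\<^sub>F n in sequentially. 2 * exp (- (\<kappa>\<^sup>2 / (18 * b\<^sup>2)) * real n) < e / 2"
    by (rule order_tendstoD(2)) (use e in simp)
  then show "\<forall>\<^sub>F n in sequentially. \<exists>B\<in>sets W. prob B \<le> e \<and> (\<forall>\<omega>\<in>space W - B. \<bar>(\<Sum>i<n. g (\<xi> i \<omega>)) / n - (\<integral>z. g z \<partial>P)\<bar> \<le> \<kappa>)"
    using eventually_gt_at_top[of 0]
  proof eventually_elim
    case (elim n)
    define R where "R \<omega> = (\<Sum>i<n. \<bar>g (\<xi> i \<omega>) - t k (\<xi> i \<omega>)\<bar>) / n" for \<omega>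
    have R_int: "integrable W R"
      unfolding R_def using integrable_\<xi>[OF d_int] by simp
    have ER: "expectation R = (\<integral>z. \<bar>g z - t k z\<bar> \<partial>P)"
      unfolding R_def using integrable_\<xi>[OF d_int] expectation_\<xi>[of "\<lambda>z. \<bar>g z - t k z\<bar>"] elim by simp
    have "prob {\<omega>\<in>space W. R \<omega> \<ge> \<kappa> / 3} \<le> expectation R / (\<kappa> / 3)"
      by (rule integral_Markov_inequality_measure[OF R_int, of "{}"])
        (use \<kappa> in \<open>auto simp: R_def intro!: divide_nonneg_nonneg sum_nonneg\<close>)
    also have "\<dots> \<le> \<delta> / (\<kappa> / 3)" using \<kappa> k ER by (intro divide_right_mono) auto
    also have "\<dots> \<le> (\<kappa> * e / 6) / (\<kappa> / 3)" using \<kappa> by (intro divide_right_mono) (auto simp: \<delta>_def)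
    also have "\<dots> = e / 2" using \<kappa> by simp
    finally have B1: "prob {\<omega>\<in>space W. R \<omega> \<ge> \<kappa> / 3} \<le> e / 2" .
    interpret H: Hoeffding_ineq W "{..<n}" "\<lambda>i \<omega>. t k (\<xi> i \<omega>)" "\<lambda>_. - b" "\<lambda>_. b" "\<Sum>i\<in>{..<n}. expectation (\<lambda>\<omega>. t k (\<xi> i \<omega>))"
    proof unfold_locales
      show "indep_vars (\<lambda>_. borel) (\<lambda>i \<omega>. t k (\<xi> i \<omega>)) {..<n}"
        by (rule indep_vars_subset[OF indep_vars_\<xi>[OF t_meas]]) auto
      show "AE \<omega> in W. t k (\<xi> i \<omega>) \<in> {- b..b}" for i
        using t_le(2)[of k] by (intro AE_I2) (simp add: b_def abs_le_iff, smt (verit))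
    qed auto
    define m where "m = (\<integral>z. t k z \<partial>P)"
    have m: "(\<Sum>i\<in>{..<n}. expectation (\<lambda>\<omega>. t k (\<xi> i \<omega>))) = n * m"
      using expectation_\<xi>[OF t_meas] by (simp add: m_def)
    have "prob {\<omega>\<in>space W. n * \<kappa> / 3 \<le> \<bar>(\<Sum>i\<in>{..<n}. t k (\<xi> i \<omega>)) - n * m\<bar>}
        \<le> 2 * exp (- 2 * (n * \<kappa> / 3)\<^sup>2 / (\<Sum>i\<in>{..<n}. (b - - b)\<^sup>2))"
      unfolding m[symmetric] using \<kappa> b elim by (intro H.Hoeffding_ineq_abs_ge) auto
    also have "- 2 * (n * \<kappa> / 3)\<^sup>2 / (\<Sum>i\<in>{..<n}. (b - - b)\<^sup>2) = - (\<kappa>\<^sup>2 / (18 * b\<^sup>2)) * real n"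
      using elim b by (simp add: field_simps power2_eq_square)
    finally have B2: "prob {\<omega>\<in>space W. n * \<kappa> / 3 \<le> \<bar>(\<Sum>i\<in>{..<n}. t k (\<xi> i \<omega>)) - n * m\<bar>} \<le> e / 2"
      using elim by simp
    define B where "B = {\<omega>\<in>space W. R \<omega> \<ge> \<kappa> / 3} \<union> {\<omega>\<in>space W. n * \<kappa> / 3 \<le> \<bar>(\<Sum>i\<in>{..<n}. t k (\<xi> i \<omega>)) - n * m\<bar>}"
    have [measurable]: "R \<in> borel_measurable W" using R_int by simp
    have B_sets: "{\<omega>\<in>space W. R \<omega> \<ge> \<kappa> / 3} \<in> sets W"
      "{\<omega>\<in>space W. n * \<kappa> / 3 \<le> \<bar>(\<Sum>i\<in>{..<n}. t k (\<xi> i \<omega>)) - n * m\<bar>} \<in> sets W" by measurable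
    have "prob B \<le> e"
      using measure_Un_le[OF B_sets] B1 B2 unfolding B_def by simp
    moreover have "\<bar>(\<Sum>i<n. g (\<xi> i \<omega>)) / n - (\<integral>z. g z \<partial>P)\<bar> \<le> \<kappa>" if "\<omega> \<in> space W - B" for \<omega>
    proof -
      have 1: "R \<omega> < \<kappa> / 3" and 2: "\<bar>(\<Sum>i<n. t k (\<xi> i \<omega>)) - n * m\<bar> < n * \<kappa> / 3"
        using that by (auto simp: B_def not_le)
      have "\<bar>(\<Sum>i<n. g (\<xi> i \<omega>)) / n - (\<Sum>i<n. t k (\<xi> i \<omega>)) / n\<bar> = \<bar>\<Sum>i<n. g (\<xi> i \<omega>) - t k (\<xi> i \<omega>)\<bar> / n"
        by (simp add: sum_subtractf abs_divide flip: diff_divide_distrib)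
      also have "\<dots> \<le> R \<omega>" unfolding R_def by (intro divide_right_mono sum_abs) auto
      finally have 3: "\<bar>(\<Sum>i<n. g (\<xi> i \<omega>)) / n - (\<Sum>i<n. t k (\<xi> i \<omega>)) / n\<bar> < \<kappa> / 3" using 1 by simp
      have "\<bar>(\<Sum>i<n. t k (\<xi> i \<omega>)) / n - m\<bar> = \<bar>(\<Sum>i<n. t k (\<xi> i \<omega>)) - n * m\<bar> / n"
        using elim by (simp add: field_simps abs_divide)
      also have "\<dots> < \<kappa> / 3" using 2 elim by (simp add: field_simps)
      finally have 4: "\<bar>(\<Sum>i<n. t k (\<xi> i \<omega>)) / n - m\<bar> < \<kappa> / 3" .
      have "\<bar>m - (\<integral>z. g z \<partial>P)\<bar> = \<bar>\<integral>z. g z - t k z \<partial>P\<bar>"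
        using g t_int by (simp add: m_def abs_minus_commute)
      also have "\<dots> \<le> (\<integral>z. \<bar>g z - t k z\<bar> \<partial>P)" by (rule integral_abs_bound)
      also have "\<dots> < \<kappa> / 3" using k by (simp add: \<delta>_def)
      finally show ?thesis using 3 4 by linarith
    qed
    ultimately show ?case using B_sets by (intro bexI[of _ B]) (auto simp: B_def)
  qed
qed

text \<open>By the union bound, \<open>n\<close> times the probability of
  \<open>(g z)^2 > \<kappa>^2 n\<close> is at most the integral of \<open>g^2\<close> over that
  event divided by \<open>\<kappa>^2\<close>, which tends to 0 by dominated convergence. Hence
  sample maxima are o(sqrt n).\<close>

lemma whp_max_le:
  fixes g :: "'a \<Rightarrow> real"
  assumes g [measurable]: "g \<in> borel_measurable P" and g2: "integrable P (\<lambda>z. (g z)\<^sup>2)" and \<kappa>: "0 < \<kappa>"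
  shows "whp W (\<lambda>n \<omega>. \<forall>i<n. \<bar>g (\<xi> i \<omega>)\<bar> \<le> \<kappa> * sqrt n)"
  unfolding whp_def
proof (intro allI impI)
  fix e :: real assume e: "0 < e"
  define u where "u n z = (if \<kappa>\<^sup>2 * real n < (g z)\<^sup>2 then (g z)\<^sup>2 else 0)" for n :: nat and z
  have u_meas [measurable]: "u n \<in> borel_measurable P" for n unfolding u_def[abs_def] by measurable
  have u_int: "integrable P (u n)" for n
    by (rule Bochner_Integration.integrable_bound[OF g2]) (auto simp: u_def)
  have "(\<lambda>n. \<integral>z. u n z \<partial>P) \<longlonglongrightarrow> (\<integral>z. 0 \<partial>P)"
  proof (rule integral_dominated_convergence[where w = "\<lambda>z. (g z)\<^sup>2"])
    show "AE z in P. (\<lambda>n. u n z) \<longlonglongrightarrow> 0"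
    proof (intro AE_I2 tendsto_eventually)
      fix z
      obtain k0 where k0: "(g z)\<^sup>2 / \<kappa>\<^sup>2 \<le> real k0" using real_arch_simple by blast
      show "\<forall>\<^sub>F n in sequentially. u n z = 0"
      proof (intro eventually_sequentiallyI[of k0])
        fix n assume "k0 \<le> n"
        then have "(g z)\<^sup>2 / \<kappa>\<^sup>2 \<le> real n" using k0 by simp
        then show "u n z = 0" using \<kappa> by (simp add: u_def field_simps)
      qed
    qed
  qed (use g2 in \<open>auto simp: u_def\<close>)
  then have "\<forall>\<^sub>F n in sequentially. (\<integral>z. u n z \<partial>P) < e * \<kappa>\<^sup>2"
    by (rule order_tendstoD(2)) (use e \<kappa> in simp)
  then show "\<forall>\<^sub>F n in sequentially. \<exists>B\<in>sets W. prob B \<le> e \<and> (\<forall>\<omega>\<in>space W - B. \<forall>i<n. \<bar>g (\<xi> i \<omega>)\<bar> \<le> \<kappa> * sqrt n)"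
    using eventually_gt_at_top[of 0]
  proof eventually_elim
    case (elim n)
    define b where "b = \<kappa>\<^sup>2 * real n"
    have b: "0 < b" using \<kappa> elim by (simp add: b_def)
    define B where "B i = {\<omega>\<in>space W. u n (\<xi> i \<omega>) \<ge> b}" for i
    have [measurable]: "B i \<in> sets W" for i unfolding B_def by measurable
    have "prob (B i) \<le> expectation (\<lambda>\<omega>. u n (\<xi> i \<omega>)) / b" for i
      unfolding B_def
      by (rule integral_Markov_inequality_measure[OF integrable_\<xi>[OF u_int], of "{}"])
        (use b in \<open>auto simp: u_def\<close>)
    then have Bi: "prob (B i) \<le> (\<integral>z. u n z \<partial>P) / b" for i by (simp add: expectation_\<xi>)
    have "prob (\<Union>i\<in>{..<n}. B i) \<le> (\<Sum>i\<in>{..<n}. prob (B i))"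
      by (intro measure_UNION_le) auto
    also have "\<dots> \<le> (\<Sum>i\<in>{..<n}. (\<integral>z. u n z \<partial>P) / b)" by (intro sum_mono Bi)
    also have "\<dots> = (\<integral>z. u n z \<partial>P) / \<kappa>\<^sup>2" using elim by (simp add: b_def)
    also have "\<dots> \<le> e" using elim \<kappa> by (simp add: field_simps)
    finally have "prob (\<Union>i\<in>{..<n}. B i) \<le> e" .
    moreover have "\<bar>g (\<xi> i \<omega>)\<bar> \<le> \<kappa> * sqrt n" if "\<omega> \<in> space W - (\<Union>i\<in>{..<n}. B i)" "i < n" for \<omega> i
    proof -
      have "\<omega> \<notin> B i" "\<omega> \<in> space W" using that by auto
      then have "u n (\<xi> i \<omega>) < b" by (simp add: B_def not_le)
      then have "(g (\<xi> i \<omega>))\<^sup>2 \<le> b" by (auto simp: u_def b_def split: if_splits)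
      also have "b = (\<kappa> * sqrt n)\<^sup>2" by (simp add: b_def power_mult_distrib)
      finally have "\<bar>g (\<xi> i \<omega>)\<bar>\<^sup>2 \<le> (\<kappa> * sqrt n)\<^sup>2" by simp
      then show ?thesis by (rule power2_le_imp_le) (use \<kappa> in simp)
    qed
    ultimately show ?case by (intro bexI[of _ "\<Union>i\<in>{..<n}. B i"]) auto
  qed
qed

end

section \<open>Divergence generators\<close>

text \<open>The sign condition says that \<open>\<phi>\<close> decreases up to 0 and increases
  afterwards. It serves to integrate first-order bounds on the derivative of a generator.\<close>

lemma nonneg_if_deriv_sign:
  fixes \<phi> :: "real \<Rightarrow> real"
  assumes "\<phi> 0 = 0" and u: "\<bar>u\<bar> \<le> \<eta>"
    and D: "\<And>s. \<bar>s\<bar> \<le> \<eta> \<Longrightarrow> (\<phi> has_real_derivative \<phi>' s) (at s)"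
    and sign: "\<And>s. \<bar>s\<bar> \<le> \<eta> \<Longrightarrow> 0 \<le> s * \<phi>' s"
  shows "0 \<le> \<phi> u"
proof (cases "0 \<le> u")
  case True
  have "\<phi> 0 \<le> \<phi> u"
  proof (rule DERIV_nonneg_imp_increasing_open[OF True])
    fix x assume x: "0 < x" "x < u"
    then show "\<exists>y. DERIV \<phi> x :> y \<and> 0 \<le> y"
      using D[of x] sign[of x] u by (auto simp: zero_le_mult_iff)
  qed (use u in \<open>auto intro!: continuous_at_imp_continuous_on DERIV_isCont[OF D]\<close>)
  then show ?thesis using assms(1) by simp
next
  case False
  have "\<phi> 0 \<le> \<phi> u"
  proof (rule DERIV_nonpos_imp_decreasing_open[of u 0])
    fix x assume x: "u < x" "x < 0"
    then show "\<exists>y. DERIV \<phi> x :> y \<and> y \<le> 0"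
      using D[of x] sign[of x] u by (auto simp: zero_le_mult_iff)
  qed (use u False in \<open>auto intro!: continuous_at_imp_continuous_on DERIV_isCont[OF D]\<close>)
  then show ?thesis using assms(1) by simp
qed

text \<open>The second derivative at 1 gives \<open>g'(1 + s) = 2 s + o(s)\<close>. Integrating the
  two one-sided forms of this from 0 yields the two quadratic bounds.\<close>

lemma smooth_generator_quadratic:
  assumes f: "smooth_generator f" and \<epsilon>: "0 < \<epsilon>"
  shows "\<exists>\<eta>. 0 < \<eta> \<and> \<eta> < 1 \<and> (\<forall>u. \<bar>u\<bar> \<le> \<eta> \<longrightarrow>
    ereal ((1 - \<epsilon>) * u\<^sup>2) \<le> f (1 + u) \<and> f (1 + u) \<le> ereal ((1 + \<epsilon>) * u\<^sup>2))"
proof -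
  define g where "g t = real_of_ereal (f t)" for t
  have *: "(\<exists>U\<subseteq>{0..}. open U \<and> 1 \<in> U \<and>
      (\<forall>t\<in>U. \<bar>f t\<bar> \<noteq> \<infinity> \<and> (\<forall>k<3. (deriv ^^ k) g differentiable (at t)))) \<and>
      f 1 = 0 \<and> deriv g 1 = 0 \<and> (deriv ^^ 2) g 1 = 2"
    using f unfolding smooth_generator_def Let_def g_def[abs_def] by (rule conjunct2)
  then obtain U where U: "U \<subseteq> {0..}" "open U" "1 \<in> U"
    and fd: "\<forall>t\<in>U. \<bar>f t\<bar> \<noteq> \<infinity> \<and> (\<forall>k<3. (deriv ^^ k) g differentiable (at t))"
    by (elim conjE exE) (rule that)
  from * have f1: "f 1 = 0" and g1: "deriv g 1 = 0" and g2: "(deriv ^^ 2) g 1 = 2" by simp_all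
  have fin: "\<bar>f t\<bar> \<noteq> \<infinity>" if "t \<in> U" for t using bspec[OF fd that] by simp
  have diff: "(deriv ^^ k) g differentiable (at t)" if "t \<in> U" "k < 3" for t k using bspec[OF fd that(1)] that(2) by simp
  have Dg: "(g has_real_derivative deriv g t) (at t)" if "t \<in> U" for t
    using diff[OF that, of 0] by (auto simp: DERIV_deriv_iff_real_differentiable)
  have "(deriv g has_real_derivative deriv (deriv g) 1) (at 1)"
    using diff[OF U(3), of 1] by (auto simp: DERIV_deriv_iff_real_differentiable)
  then have "(deriv g has_real_derivative 2) (at 1)"
    using g2 by (simp add: eval_nat_numeral)
  then have "(\<lambda>s. (deriv g (1 + s) - deriv g 1) / s) \<midarrow>0\<rightarrow> 2" by (simp add: DERIV_def)
  then have "eventually (\<lambda>s. dist ((deriv g (1 + s) - deriv g 1) / s) 2 < 2 * \<epsilon>) (at 0)"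
    using \<epsilon> by (intro tendstoD) auto
  then obtain e1 where e1: "0 < e1" "\<And>s. s \<noteq> 0 \<Longrightarrow> \<bar>s\<bar> < e1 \<Longrightarrow> \<bar>deriv g (1 + s) / s - 2\<bar> < 2 * \<epsilon>"
    unfolding eventually_at by (auto simp: dist_real_def g1)
  obtain e2 where e2: "0 < e2" "ball 1 e2 \<subseteq> U" using U(2,3) openE by blast
  define \<eta> where "\<eta> = min (min (e1 / 2) (e2 / 2)) (1/2)"
  have \<eta>: "0 < \<eta>" "\<eta> < e1" "\<eta> < e2" "\<eta> < 1" using e1 e2 by (auto simp: \<eta>_def)
  have inU: "1 + s \<in> U" if "\<bar>s\<bar> \<le> \<eta>" for s
    by (rule subsetD[OF e2(2)]) (use that \<eta> in \<open>simp add: dist_real_def\<close>)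
  have dev: "\<bar>s * deriv g (1 + s) - 2 * s\<^sup>2\<bar> \<le> 2 * \<epsilon> * s\<^sup>2" if s: "\<bar>s\<bar> \<le> \<eta>" for s
  proof (cases "s = 0")
    case False
    have "\<bar>deriv g (1 + s) / s - 2\<bar> * s\<^sup>2 \<le> 2 * \<epsilon> * s\<^sup>2"
      using e1(2)[OF False] s \<eta> by (intro mult_right_mono) auto
    also have "\<bar>deriv g (1 + s) / s - 2\<bar> * s\<^sup>2 = \<bar>(deriv g (1 + s) / s - 2) * s\<^sup>2\<bar>"
      by (simp add: abs_mult)
    also have "(deriv g (1 + s) / s - 2) * s\<^sup>2 = s * deriv g (1 + s) - 2 * s\<^sup>2"
      using False by (simp add: field_simps power2_eq_square)
    finally show ?thesis .
  qed (use \<epsilon> in simp)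
  have D: "((\<lambda>s. g (1 + s)) has_real_derivative deriv g (1 + s)) (at s)" if "\<bar>s\<bar> \<le> \<eta>" for s
    using Dg[OF inU[OF that]] DERIV_shift[of g "deriv g (1 + s)" s 1] by (simp add: add.commute)
  have "g 1 = 0" using f1 by (simp add: g_def)
  have lo: "0 \<le> g (1 + u) - (1 - \<epsilon>) * u\<^sup>2" if u: "\<bar>u\<bar> \<le> \<eta>" for u
  proof (rule nonneg_if_deriv_sign[where \<phi> = "\<lambda>u. g (1 + u) - (1 - \<epsilon>) * u\<^sup>2" and \<phi>' = "\<lambda>s. deriv g (1 + s) - (1 - \<epsilon>) * (2 * s)", OF _ u])
    fix s assume s: "\<bar>s\<bar> \<le> \<eta>"
    show "((\<lambda>u. g (1 + u) - (1 - \<epsilon>) * u\<^sup>2) has_real_derivative deriv g (1 + s) - (1 - \<epsilon>) * (2 * s)) (at s)"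
      using D[OF s] by (auto intro!: derivative_eq_intros)
    show "0 \<le> s * (deriv g (1 + s) - (1 - \<epsilon>) * (2 * s))"
      using dev[OF s] by (simp add: algebra_simps power2_eq_square abs_le_iff)
  qed (simp add: \<open>g 1 = 0\<close>)
  have up: "0 \<le> (1 + \<epsilon>) * u\<^sup>2 - g (1 + u)" if u: "\<bar>u\<bar> \<le> \<eta>" for u
  proof (rule nonneg_if_deriv_sign[where \<phi> = "\<lambda>u. (1 + \<epsilon>) * u\<^sup>2 - g (1 + u)" and \<phi>' = "\<lambda>s. (1 + \<epsilon>) * (2 * s) - deriv g (1 + s)", OF _ u])
    fix s assume s: "\<bar>s\<bar> \<le> \<eta>"
    show "((\<lambda>u. (1 + \<epsilon>) * u\<^sup>2 - g (1 + u)) has_real_derivative (1 + \<epsilon>) * (2 * s) - deriv g (1 + s)) (at s)"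
      using D[OF s] by (auto intro!: derivative_eq_intros)
    show "0 \<le> s * ((1 + \<epsilon>) * (2 * s) - deriv g (1 + s))"
      using dev[OF s] by (simp add: algebra_simps power2_eq_square abs_le_iff)
  qed (simp add: \<open>g 1 = 0\<close>)
  have "f (1 + u) = ereal (g (1 + u))" if "\<bar>u\<bar> \<le> \<eta>" for u
    using fin[OF inU[OF that]] by (simp add: g_def ereal_real')
  then show ?thesis using \<eta> lo up by (intro exI[of _ \<eta>]) auto
qed

lemma divergence_generator_convex:
  assumes "divergence_generator f" "0 \<le> s" "0 \<le> t" "0 \<le> u" "u \<le> 1"
  shows "f (u * s + (1 - u) * t) \<le> ereal u * f s + ereal (1 - u) * f t"
  using assms unfolding divergence_generator_def by auto

text \<open>Since \<open>f 1 = 0\<close>, convexity makes \<open>f\<close> grow along a ray from 1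
  at least like the chord through the point at distance \<open>\<eta>\<close>, where the quadratic
  bound is still valid.\<close>

lemma smooth_generator_linear:
  assumes f: "smooth_generator f" and \<eta>: "0 < \<eta>" "\<eta> < 1"
    and lo: "\<And>u. \<bar>u\<bar> \<le> \<eta> \<Longrightarrow> ereal ((1 - \<epsilon>) * u\<^sup>2) \<le> f (1 + u)"
    and u: "- 1 \<le> u" "\<eta> \<le> \<bar>u\<bar>"
  shows "ereal ((1 - \<epsilon>) * \<eta> * \<bar>u\<bar>) \<le> f (1 + u)"
proof -
  \<comment> \<open>This places \<open>1 + c * u\<close> at distance exactly \<open>\<eta>\<close>
    from 1.\<close>
  define c where "c = \<eta> / \<bar>u\<bar>"
  have u0: "0 < \<bar>u\<bar>" using u \<eta> by linarith
  have c: "0 < c" "c \<le> 1" using u \<eta> by (auto simp: c_def)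
  have gen: "divergence_generator f" "f 1 = 0" using f by (auto simp: smooth_generator_def Let_def)
  have "ereal ((1 - \<epsilon>) * \<eta>\<^sup>2) \<le> f (1 + c * u)"
    using lo[of "c * u"] u0 \<eta> by (simp add: c_def abs_mult power_mult_distrib power_divide)
  also have "1 + c * u = c * (1 + u) + (1 - c) * 1" by (simp add: algebra_simps)
  also have "f \<dots> \<le> ereal c * f (1 + u) + ereal (1 - c) * f 1"
    using c u by (intro divergence_generator_convex[OF gen(1)]) auto
  finally have *: "ereal ((1 - \<epsilon>) * \<eta>\<^sup>2) \<le> ereal c * f (1 + u)" using gen(2) by simp
  show ?thesis
  proof (cases "f (1 + u)")
    case (real r)
    then have "(1 - \<epsilon>) * \<eta>\<^sup>2 \<le> \<eta> / \<bar>u\<bar> * r" using * by (simp add: c_def)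
    then have "\<eta> * ((1 - \<epsilon>) * \<eta> * \<bar>u\<bar>) \<le> \<eta> * r"
      using u0 by (simp add: field_simps power2_eq_square)
    then show ?thesis using real \<eta> by simp
  next
    case MInf
    then show ?thesis using * c by simp
  qed simp
qed

lemma smooth_generator_nonneg:
  assumes f: "smooth_generator f" and t: "0 \<le> t"
  shows "0 \<le> f t"
proof -
  obtain \<eta> where \<eta>: "0 < \<eta>" "\<eta> < 1" "\<And>u. \<bar>u\<bar> \<le> \<eta> \<Longrightarrow> ereal ((1 - 1/2) * u\<^sup>2) \<le> f (1 + u)"
    using smooth_generator_quadratic[OF f, of "1/2"] by auto
  have "0 \<le> f (1 + (t - 1))"
  proof (cases "\<bar>t - 1\<bar> \<le> \<eta>")
    case True
    have "0 \<le> ereal ((1 - 1/2) * (t - 1)\<^sup>2)" by simp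
    also have "\<dots> \<le> f (1 + (t - 1))" by (rule \<eta>(3)[OF True])
    finally show ?thesis .
  next
    case False
    have "0 \<le> ereal ((1 - 1/2) * \<eta> * \<bar>t - 1\<bar>)" using \<eta> by simp
    also have "\<dots> \<le> f (1 + (t - 1))" using t False by (intro smooth_generator_linear[OF f \<eta>]) auto
    finally show ?thesis .
  qed
  then show ?thesis by simp
qed

section \<open>The divergence ball around an empirical measure\<close>

text \<open>\<open>Liminf (at t within {0..})\<close> ignores the value at \<open>t\<close>, so
  closedness is tested on limit points. Both the measurability of \<open>f\<close> and the
  closedness of the weight set rest on this form of lower semicontinuity.\<close>

lemma closed_divergence_sublevel:
  assumes f: "divergence_generator f"
  shows "closed {t. 0 \<le> t \<and> f t \<le> c}"
  unfolding closed_limpt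
proof (intro allI impI)
  fix t assume t: "t islimpt {t. 0 \<le> t \<and> f t \<le> c}"
  have "t islimpt {0..}" by (rule islimpt_subset[OF t]) auto
  then have t0: "0 \<le> t" by (meson atLeast_iff closed_atLeast closed_limpt)
  moreover have "f t \<le> c"
  proof (rule ccontr)
    assume "\<not> f t \<le> c"
    moreover have "f t \<le> Liminf (at t within {0..}) f" using f t0 by (auto simp: divergence_generator_def)
    ultimately have "c < Liminf (at t within {0..}) f" by (simp add: not_le)
    then have "\<forall>\<^sub>F s in at t within {0..}. c < f s" by (rule less_LiminfD)
    then have "\<forall>\<^sub>F s in at t. s \<notin> {t. 0 \<le> t \<and> f t \<le> c}"
      unfolding eventually_at_filter by eventually_elim (auto simp: not_le)
    then show False using t by (simp add: islimpt_iff_eventually)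
  qed
  ultimately show "t \<in> {t. 0 \<le> t \<and> f t \<le> c}" by simp
qed

text \<open>\<open>max 0\<close> hides the arbitrary values of \<open>f\<close> at negative
  arguments.\<close>

lemma borel_measurable_divergence:
  assumes f: "divergence_generator f"
  shows "(\<lambda>t. f (max 0 t)) \<in> borel_measurable borel"
proof (rule borel_measurableI_le)
  fix c
  have "{t\<in>space borel. f (max 0 t) \<le> c} = (\<lambda>t. max 0 t) -` {t. 0 \<le> t \<and> f t \<le> c}" by auto
  also have "closed \<dots>"
    by (intro continuous_closed_vimage closed_divergence_sublevel f continuous_intros)
  finally show "{t\<in>space borel. f (max 0 t) \<le> c} \<in> sets borel" by (rule borel_closed)
qed

section \<open>Finite part of a generator and the feasible weight vectors\<close>

locale nonneg_divergence_generator =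
  fixes f :: "real \<Rightarrow> ereal"
  assumes gen: "divergence_generator f" and nonneg: "\<And>t. 0 \<le> t \<Longrightarrow> 0 \<le> f t"
begin

definition fr :: "real \<Rightarrow> real" where "fr t = real_of_ereal (f t)"
definition dom :: "real set" where "dom = {t. 0 \<le> t \<and> f t \<noteq> \<infinity>}"

lemma f_eq: "t \<in> dom \<Longrightarrow> f t = ereal (fr t)"
  using nonneg[of t] by (cases "f t") (auto simp: dom_def fr_def)

lemma fr_nonneg: "t \<in> dom \<Longrightarrow> 0 \<le> fr t"
  using nonneg[of t] f_eq[of t] by (auto simp: dom_def)

lemma convex_combination:
  assumes "s \<in> dom" "t \<in> dom" "0 \<le> u" "u \<le> 1"
  shows "u * s + (1 - u) * t \<in> dom" "fr (u * s + (1 - u) * t) \<le> u * fr s + (1 - u) * fr t"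
proof -
  have "f (u * s + (1 - u) * t) \<le> ereal u * f s + ereal (1 - u) * f t"
    using assms by (intro divergence_generator_convex[OF gen]) (auto simp: dom_def)
  also have "\<dots> = ereal (u * fr s + (1 - u) * fr t)" using assms by (simp add: f_eq)
  finally have le: "f (u * s + (1 - u) * t) \<le> ereal (u * fr s + (1 - u) * fr t)" .
  then show *: "u * s + (1 - u) * t \<in> dom" using assms by (auto simp: dom_def)
  show "fr (u * s + (1 - u) * t) \<le> u * fr s + (1 - u) * fr t" using le by (simp add: f_eq[OF *])
qed

lemma convex_on_fr: "convex_on dom fr"
proof (rule convex_onI)
  show "convex dom"
    unfolding convex_alt using convex_combination(1) by (auto simp: add.commute)
  fix t x y :: real assume "0 < t" "t < 1" "x \<in> dom" "y \<in> dom"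
  then show "fr ((1 - t) *\<^sub>R x + t *\<^sub>R y) \<le> (1 - t) * fr x + t * fr y"
    using convex_combination(2)[of y x t] by (simp add: add.commute)
qed

lemma sum_f_le_iff:
  assumes "finite I" "\<And>i. i \<in> I \<Longrightarrow> 0 \<le> t i"
  shows "(\<Sum>i\<in>I. f (t i)) \<le> ereal c \<longleftrightarrow> (\<forall>i\<in>I. t i \<in> dom) \<and> (\<Sum>i\<in>I. fr (t i)) \<le> c"
proof (cases "\<forall>i\<in>I. t i \<in> dom")
  case True
  then have "(\<Sum>i\<in>I. f (t i)) = ereal (\<Sum>i\<in>I. fr (t i))" by (simp add: f_eq)
  then show ?thesis using True by simp
next
  case False
  then obtain i where i: "i \<in> I" "f (t i) = \<infinity>" using assms(2) by (auto simp: dom_def)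
  then have "(\<Sum>i\<in>I. f (t i)) = \<infinity>" using assms(1) by (auto simp: sum_Pinfty)
  then show ?thesis using False by simp
qed

text \<open>The radius is \<open>\<rho>\<close> and not \<open>\<rho> / n\<close> because the
  divergence is an average over the sample. Vectors are sequences vanishing from \<open>n\<close>
  on, so that all sample sizes share one topological space.\<close>

definition weight_set :: "real \<Rightarrow> nat \<Rightarrow> (nat \<Rightarrow> real) set" where
  "weight_set \<rho> n = {w. (\<forall>i. 0 \<le> w i) \<and> (\<forall>i\<ge>n. w i = 0) \<and> (\<Sum>i<n. w i) = 1 \<and>
     (\<Sum>i<n. f (real n * w i)) \<le> ereal \<rho>}"

lemma weight_set_iff:
  "w \<in> weight_set \<rho> n \<longleftrightarrow> (\<forall>i. 0 \<le> w i) \<and> (\<forall>i\<ge>n. w i = 0) \<and> (\<Sum>i<n. w i) = 1 \<and>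
     (\<forall>i<n. real n * w i \<in> dom) \<and> (\<Sum>i<n. fr (real n * w i)) \<le> \<rho>"
  unfolding weight_set_def mem_Collect_eq
  using sum_f_le_iff[of "{..<n}" "\<lambda>i. real n * w i" \<rho>] by auto

end

section \<open>Measures carried by the sample points\<close>

locale weighted_points =
  fixes S :: "'a measure" and n :: nat and z :: "nat \<Rightarrow> 'a"
  assumes n: "0 < n" and z: "\<And>i. i < n \<Longrightarrow> z i \<in> space S"
begin

abbreviation emp :: "'a measure" where "emp \<equiv> empirical_measure S n z"

text \<open>Weights sit on indices and are pushed forward, because sample points may coincide or be
  inseparable by the \<sigma>-algebra.\<close>

definition weighted :: "(nat \<Rightarrow> real) \<Rightarrow> 'a measure" where
  "weighted w = distr (point_measure {..<n} (\<lambda>i. ennreal (w i))) S z"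

lemma measurable_z [measurable]: "z \<in> measurable (point_measure {..<n} g) S"
  using z by (auto simp: measurable_def space_point_measure sets_point_measure)

lemma sets_weighted [simp]: "sets (weighted w) = sets S" and space_weighted [simp]: "space (weighted w) = space S"
  by (simp_all add: weighted_def)

lemma nn_integral_weighted:
  "g \<in> borel_measurable S \<Longrightarrow> (\<integral>\<^sup>+y. g y \<partial>weighted w) = (\<Sum>i<n. ennreal (w i) * g (z i))"
  unfolding weighted_def by (subst nn_integral_distr[OF measurable_z]) (auto simp: nn_integral_point_measure_finite)

lemma emeasure_weighted:
  "A \<in> sets S \<Longrightarrow> emeasure (weighted w) A = (\<Sum>i<n. ennreal (w i) * indicator A (z i))"
  using nn_integral_weighted[of "indicator A" w] by simp

lemma integral_weighted:
  fixes g :: "'a \<Rightarrow> real"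
  assumes "g \<in> borel_measurable S" "\<And>i. i < n \<Longrightarrow> 0 \<le> w i"
  shows "(\<integral>y. g y \<partial>weighted w) = (\<Sum>i<n. w i * g (z i))"
  unfolding weighted_def integral_distr[OF measurable_z assms(1)]
  using assms(2) by (subst lebesgue_integral_point_measure_finite) auto

lemma prob_space_weighted:
  assumes "\<And>i. i < n \<Longrightarrow> 0 \<le> w i" "(\<Sum>i<n. w i) = 1"
  shows "prob_space (weighted w)"
proof (rule prob_spaceI)
  have "emeasure (weighted w) (space S) = (\<Sum>i<n. ennreal (w i))"
    using z by (subst emeasure_weighted) (auto intro!: sum.cong)
  also have "\<dots> = ennreal (\<Sum>i<n. w i)" using assms by (intro sum_ennreal) auto
  finally show "emeasure (weighted w) (space (weighted w)) = 1" using assms by simp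
qed

lemma empirical_measure_eq: "emp = weighted (\<lambda>_. 1 / n)"
  unfolding empirical_measure_def weighted_def uniform_count_measure_def by simp

lemma prob_space_empirical: "prob_space emp"
  unfolding empirical_measure_eq using n by (intro prob_space_weighted) auto

text \<open>Every index has positive empirical mass, so an empirical null set contains no sample
  point.\<close>

lemma absolutely_continuous_weighted: "absolutely_continuous (emp) (weighted w)"
  unfolding absolutely_continuous_def empirical_measure_eq
proof
  fix A assume A: "A \<in> null_sets (weighted (\<lambda>_. 1 / n))"
  then have As: "A \<in> sets S" by auto
  have "(\<Sum>i<n. ennreal (1 / n) * indicator A (z i)) = 0"
    using A As emeasure_weighted[of A "\<lambda>_. 1 / n"] by auto
  then have "z i \<notin> A" if "i < n" for i
    using that n by (auto simp: sum_eq_0_iff indicator_def split: if_splits)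
  then show "A \<in> null_sets (weighted w)"
    using As by (intro null_setsI) (auto simp: emeasure_weighted)
qed

lemma density_RN_deriv_empirical:
  assumes "absolutely_continuous (emp) P" "sets P = sets S"
  shows "density (emp) (RN_deriv (emp) P) = P"
proof -
  interpret prob_space emp by (rule prob_space_empirical)
  show ?thesis using assms by (intro density_RN_deriv) (auto simp: empirical_measure_eq)
qed

lemma emeasure_eq_sum_RN_deriv:
  assumes P: "absolutely_continuous (emp) P" "sets P = sets S" and A: "A \<in> sets S"
  shows "emeasure P A = (\<Sum>i<n. ennreal (1 / n) * (RN_deriv (emp) P (z i) * indicator A (z i)))"
proof -
  have sE: "sets emp = sets S" by (simp add: empirical_measure_eq)
  have m: "RN_deriv emp P \<in> borel_measurable S"
    using borel_measurable_RN_deriv[of emp P] by (simp add: measurable_cong_sets[OF sE refl])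
  have "emeasure P A = emeasure (density emp (RN_deriv emp P)) A" by (simp add: density_RN_deriv_empirical[OF P])
  also have "\<dots> = (\<integral>\<^sup>+y. RN_deriv emp P y * indicator A y \<partial>emp)"
    using A by (intro emeasure_density) (auto simp: sE)
  also have "\<dots> = (\<Sum>i<n. ennreal (1 / n) * (RN_deriv emp P (z i) * indicator A (z i)))"
    unfolding empirical_measure_eq using m A
    by (intro nn_integral_weighted) (auto simp: empirical_measure_eq)
  finally show ?thesis .
qed

text \<open>An infinite density at a point of mass at least \<open>1 / n\<close> would give
  \<open>P\<close> infinite total mass. Hence \<open>enn2real\<close> loses nothing at the sample
  points.\<close>

lemma RN_deriv_finite_at:
  assumes P: "absolutely_continuous (emp) P" "sets P = sets S" "prob_space P" and i: "i < n"
  shows "RN_deriv (emp) P (z i) < top"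
proof (rule ccontr)
  let ?H = "RN_deriv (emp) P"
  assume "\<not> ?H (z i) < top"
  then have top: "?H (z i) = top" by (metis less_top)
  have "emeasure P (space S) = 1"
    using prob_space.emeasure_space_1[OF P(3)] sets_eq_imp_space_eq[OF P(2)] by simp
  then have "(\<Sum>j<n. ennreal (1 / n) * (?H (z j) * indicator (space S) (z j))) = 1"
    using emeasure_eq_sum_RN_deriv[OF P(1,2), of "space S"] by simp
  moreover have "ennreal (1 / n) * (?H (z i) * indicator (space S) (z i)) \<le>
      (\<Sum>j<n. ennreal (1 / n) * (?H (z j) * indicator (space S) (z j)))"
    using i by (intro member_le_sum) auto
  ultimately show False using top z[OF i] n by (simp add: ennreal_mult_top top_unique)
qed

end

section \<open>Divergence balls as sets of weight vectors\<close>

locale divergence_ball = weighted_points S n z + nonneg_divergence_generator f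
  for S :: "'a measure" and n z f
begin

text \<open>The negative part of the extended integral vanishes because \<open>f\<close> is
  nonnegative, and the positive part is an average over the sample. An infinite value of
  \<open>f\<close> at a sample point makes both sides false.\<close>

lemma f_divergence_le_iff:
  assumes sP: "sets P = sets S"
  shows "f_divergence f P (emp) \<le> ereal (\<rho> / n) \<longleftrightarrow>
    (\<Sum>i<n. f (enn2real (RN_deriv (emp) P (z i)))) \<le> ereal \<rho>"
proof -
  define h where "h y = enn2real (RN_deriv emp P y)" for y
  have sE: "sets emp = sets S" by (simp add: empirical_measure_eq)
  have h0: "0 \<le> h y" for y by (simp add: h_def)
  have [measurable]: "h \<in> borel_measurable S"
    using borel_measurable_RN_deriv[of emp P] unfolding h_def[abs_def]
    by (simp add: measurable_cong_sets[OF sE refl])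
  have "(\<lambda>y. f (max 0 (h y))) \<in> borel_measurable S"
    by (rule measurable_compose[OF _ borel_measurable_divergence[OF gen]]) measurable
  then have fh: "(\<lambda>y. f (h y)) \<in> borel_measurable S" using h0 by (simp add: max_absorb2)
  have "(\<integral>\<^sup>+y. e2ennreal (- f (h y)) \<partial>emp) = 0"
    using nonneg h0 by (simp add: e2ennreal_neg)
  moreover have "(\<integral>\<^sup>+y. e2ennreal (f (h y)) \<partial>emp) = (\<Sum>i<n. ennreal (1 / n) * e2ennreal (f (h (z i))))"
    unfolding empirical_measure_eq
    by (intro nn_integral_weighted measurable_compose[OF fh measurable_e2ennreal])
  ultimately have D: "f_divergence f P emp = enn2ereal (\<Sum>i<n. ennreal (1 / n) * e2ennreal (f (h (z i))))"
    unfolding f_divergence_def ext_integral_def h_def by (simp add: zero_ennreal.rep_eq)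
  show ?thesis
  proof (cases "\<forall>i<n. h (z i) \<in> dom")
    case True
    have "(\<Sum>i<n. ennreal (1 / n) * e2ennreal (f (h (z i)))) = (\<Sum>i<n. ennreal (1 / n * fr (h (z i))))"
    proof (intro sum.cong refl)
      fix i assume "i \<in> {..<n}"
      then have d: "h (z i) \<in> dom" using True by auto
      have "ennreal (1 / n * fr (h (z i))) = ennreal (1 / n) * ennreal (fr (h (z i)))"
        by (rule ennreal_mult) (use d in \<open>auto simp: fr_nonneg\<close>)
      then show "ennreal (1 / n) * e2ennreal (f (h (z i))) = ennreal (1 / n * fr (h (z i)))"
        by (simp only: f_eq[OF d] e2ennreal_ereal)
    qed
    also have "\<dots> = ennreal ((\<Sum>i<n. fr (h (z i))) / n)"
      using True by (subst sum_ennreal) (auto simp: fr_nonneg sum_divide_distrib)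
    finally have calculation: "(\<Sum>i<n. ennreal (1 / n) * e2ennreal (f (h (z i)))) = ennreal ((\<Sum>i<n. fr (h (z i))) / n)" .
    have "f_divergence f P emp = ereal ((\<Sum>i<n. fr (h (z i))) / n)"
    proof -
      have "0 \<le> (\<Sum>i<n. fr (h (z i))) / n"
        using True by (intro divide_nonneg_nonneg sum_nonneg) (auto simp: fr_nonneg)
      then show ?thesis using D calculation by simp
    qed
    moreover have "(\<Sum>i<n. f (h (z i))) = ereal (\<Sum>i<n. fr (h (z i)))" using True by (simp add: f_eq)
    ultimately show ?thesis using n by (simp add: divide_le_cancel flip: h_def)
  next
    case False
    then obtain i where i: "i < n" "f (h (z i)) = \<infinity>" using h0 by (auto simp: dom_def)
    have "ennreal (1 / n) * e2ennreal (f (h (z i))) \<le> (\<Sum>i<n. ennreal (1 / n) * e2ennreal (f (h (z i))))"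
      using i by (intro member_le_sum) auto
    then have "(\<Sum>i<n. ennreal (1 / n) * e2ennreal (f (h (z i)))) = top"
      using i n by (simp add: ennreal_mult_top top_unique)
    then have "f_divergence f P emp = \<infinity>" using D by simp
    moreover have "\<not> (\<Sum>i<n. f (h (z i))) \<le> ereal \<rho>"
      using sum_f_le_iff[of "{..<n}" "\<lambda>i. h (z i)" \<rho>] False h0 by auto
    ultimately show ?thesis by (simp flip: h_def)
  qed
qed

text \<open>Points that the \<open>\<sigma>\<close>-algebra does not separate get the same Radon-Nikodym derivative, namely
  the mean of the weights over the class; by Jensen's inequality this does not increase the
  divergence.\<close>

lemma f_divergence_weighted_le:
  assumes w: "w \<in> weight_set \<rho> n"
  shows "f_divergence f (weighted w) (emp) \<le> ereal (\<rho> / n)"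
proof -
  let ?P = "weighted w"
  have w0: "0 \<le> w i" and w1: "(\<Sum>i<n. w i) = 1" and wd: "i < n \<Longrightarrow> real n * w i \<in> dom"
    and wr: "(\<Sum>i<n. fr (real n * w i)) \<le> \<rho>" for i
    using w by (auto simp: weight_set_iff)
  have ac: "absolutely_continuous emp ?P" by (rule absolutely_continuous_weighted)
  have pP: "prob_space ?P" using w0 w1 by (intro prob_space_weighted) auto
  define H where "H = RN_deriv emp ?P"
  have sE: "sets emp = sets S" by (simp add: empirical_measure_eq)
  have H_meas [measurable]: "H \<in> borel_measurable S"
    using borel_measurable_RN_deriv[of emp ?P] unfolding H_def by (simp add: measurable_cong_sets[OF sE refl])
  \<comment> \<open>The indices whose points lie in every measurable set containing
    \<open>z i\<close>. Passing to complements makes this an equivalence relation on the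
    sample.\<close>
  define C where "C i = {j. j < n \<and> (\<forall>A\<in>sets S. z i \<in> A \<longrightarrow> z j \<in> A)}" for i
  have C_D: "z j \<in> A" if "j \<in> C i" "A \<in> sets S" "z i \<in> A" for i j A
    using that unfolding C_def by blast
  have C_fin: "finite (C i)" for i by (simp add: C_def)
  have C_self: "i \<in> C i" if "i < n" for i using that by (simp add: C_def)
  have C_sym: "i \<in> C j" if "j \<in> C i" "i < n" for i j
  proof -
    have "z i \<in> A" if A: "A \<in> sets S" "z j \<in> A" for A
    proof (rule ccontr)
      assume "z i \<notin> A"
      then have "z i \<in> space S - A" using z \<open>i < n\<close> by auto
      moreover have "space S - A \<in> sets S" using A by auto
      ultimately have "z j \<in> space S - A" using \<open>j \<in> C i\<close> unfolding C_def by blast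
      then show False using A by simp
    qed
    then show ?thesis using \<open>i < n\<close> unfolding C_def by blast
  qed
  have C_eq: "C j = C i" if "j \<in> C i" "i < n" for i j
    using that(1) C_sym[OF that] unfolding C_def by blast
  have H_eq: "enn2real (H (z i)) = (\<Sum>j\<in>C i. 1 / card (C i) * (n * w j))" if i: "i < n" for i
  proof -
    have "\<exists>A\<in>sets S. z i \<in> A \<and> z j \<notin> A" if "j \<in> {..<n} - C i" for j
      using that by (auto simp: C_def)
    then obtain B where B: "\<And>j. j \<in> {..<n} - C i \<Longrightarrow> B j \<in> sets S \<and> z i \<in> B j \<and> z j \<notin> B j" by metis
    \<comment> \<open>A finite intersection of separating sets is measurable and meets the sample
      exactly in the class of \<open>z i\<close>.\<close>
    define A where "A = space S \<inter> (\<Inter>j\<in>{..<n} - C i. B j)"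
    have A: "A \<in> sets S"
    proof (cases "{..<n} - C i = {}")
      case False
      then show ?thesis unfolding A_def using B by (intro sets.Int sets.finite_INT) auto
    next
      case True
      then have "A = space S" unfolding A_def by (simp only: True) simp
      then show ?thesis by simp
    qed
    have "z i \<in> A" using z i B by (auto simp: A_def)
    have zA: "z j \<in> A \<longleftrightarrow> j \<in> C i" if j: "j < n" for j
    proof
      assume "z j \<in> A"
      then show "j \<in> C i" using B j by (auto simp: A_def)
    next
      assume "j \<in> C i"
      then show "z j \<in> A" using A \<open>z i \<in> A\<close> unfolding C_def by blast
    qed
    \<comment> \<open>A level set of the measurable \<open>H\<close> that contains
      \<open>z i\<close> contains its whole class.\<close>
    have Hj: "H (z j) = H (z i)" if "j \<in> C i" for j
    proof -
      define K where "K = {y\<in>space S. H y = H (z i)}"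
      have "K \<in> sets S" unfolding K_def by measurable
      moreover have "z i \<in> K" unfolding K_def using z i by simp
      ultimately have "z j \<in> K" by (rule C_D[OF that])
      then show ?thesis unfolding K_def by simp
    qed
    have Csub: "C i \<subseteq> {..<n}" by (auto simp: C_def)
    have cC: "0 < card (C i)" using C_self[OF i] C_fin[of i] by (auto simp: card_gt_0_iff)
    define h where "h = enn2real (H (z i))"
    have h: "H (z i) = ennreal h" "0 \<le> h"
      using RN_deriv_finite_at[OF ac sets_weighted pP i] by (auto simp: h_def H_def)
    have "(\<Sum>j\<in>C i. ennreal (w j)) = (\<Sum>j<n. ennreal (w j) * indicator A (z j))"
      using Csub zA by (intro sum.mono_neutral_cong_left) (auto simp: indicator_def)
    also have "\<dots> = emeasure ?P A" using A by (simp add: emeasure_weighted)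
    also have "\<dots> = (\<Sum>j<n. ennreal (1 / n) * (H (z j) * indicator A (z j)))"
      unfolding H_def by (rule emeasure_eq_sum_RN_deriv[OF ac sets_weighted A])
    also have "\<dots> = (\<Sum>j\<in>C i. ennreal (1 / n) * ennreal h)"
      using Csub zA Hj h by (intro sum.mono_neutral_cong_right) (auto simp: indicator_def)
    also have "\<dots> = (\<Sum>j\<in>C i. ennreal (1 / n * h))" using h by (simp only: ennreal_mult'')
    finally have "ennreal (\<Sum>j\<in>C i. w j) = ennreal (\<Sum>j\<in>C i. 1 / n * h)"
      using w0 h by (subst (asm) (1 2) sum_ennreal) auto
    then have "(\<Sum>j\<in>C i. w j) = card (C i) * (1 / n * h)"
      using w0 h by (subst (asm) ennreal_inj) (auto intro: sum_nonneg)
    then have "h = n * (\<Sum>j\<in>C i. w j) / card (C i)" using cC n by (simp add: field_simps)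
    also have "\<dots> = (\<Sum>j\<in>C i. 1 / card (C i) * (n * w j))"
      by (simp add: sum_distrib_left sum_divide_distrib)
    finally show ?thesis by (simp add: h_def)
  qed
  have Jensen: "enn2real (H (z i)) \<in> dom \<and> fr (enn2real (H (z i))) \<le> (\<Sum>j\<in>C i. 1 / card (C i) * fr (n * w j))"
    if i: "i < n" for i
  proof -
    have C: "finite (C i)" "C i \<noteq> {}" using C_fin C_self[OF i] by auto
    have s1: "(\<Sum>j\<in>C i. 1 / card (C i)) = 1" using C by simp
    have y: "n * w j \<in> dom" if "j \<in> C i" for j using that wd by (auto simp: C_def)
    have "fr (\<Sum>j\<in>C i. (1 / card (C i)) *\<^sub>R (n * w j)) \<le> (\<Sum>j\<in>C i. 1 / card (C i) * fr (n * w j))"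
      using y s1 by (intro convex_on_sum[OF C convex_on_fr]) auto
    moreover have "(\<Sum>j\<in>C i. (1 / card (C i)) *\<^sub>R (n * w j)) \<in> dom"
      using y s1 by (intro convex_sum[OF C(1)] convex_on_imp_convex[OF convex_on_fr]) auto
    ultimately show ?thesis unfolding H_eq[OF i] by (simp only: real_scaleR_def)
  qed
  have "(\<Sum>i<n. fr (enn2real (H (z i)))) \<le> (\<Sum>i<n. \<Sum>j\<in>C i. 1 / card (C i) * fr (n * w j))"
    using Jensen by (intro sum_mono) auto
  also have "\<dots> = (\<Sum>i\<in>{..<n}. \<Sum>j\<in>{j\<in>{..<n}. j \<in> C i}. 1 / card (C i) * fr (n * w j))"
    by (intro sum.cong refl) (auto simp: C_def)
  \<comment> \<open>After the exchange of sums, each \<open>j\<close> is counted once per member of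
    its own class, with weight one over the class size, so the averaging leaves the total
    unchanged.\<close>
  also have "\<dots> = (\<Sum>j\<in>{..<n}. \<Sum>i\<in>{i\<in>{..<n}. j \<in> C i}. 1 / card (C i) * fr (n * w j))"
    by (rule sum.swap_restrict) auto
  also have "\<dots> = (\<Sum>j\<in>{..<n}. \<Sum>i\<in>C j. 1 / card (C j) * fr (n * w j))"
  proof (intro sum.cong refl)
    fix j assume "j \<in> {..<n}"
    have "C k \<subseteq> {..<n}" for k unfolding C_def by blast
    then show "{i\<in>{..<n}. j \<in> C i} = C j" using C_sym \<open>j \<in> {..<n}\<close> by blast
    fix i assume "i \<in> C j"
    then show "1 / card (C i) * fr (n * w j) = 1 / card (C j) * fr (n * w j)"
      using C_eq \<open>j \<in> {..<n}\<close> by auto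
  qed
  also have "\<dots> = (\<Sum>j<n. fr (n * w j))"
    using C_self C_fin by (intro sum.cong) (auto simp: card_eq_0_iff)
  also have "\<dots> \<le> \<rho>" by (rule wr)
  finally have "(\<Sum>i<n. fr (enn2real (H (z i)))) \<le> \<rho>" .
  then show ?thesis
    using Jensen sum_f_le_iff[of "{..<n}" "\<lambda>i. enn2real (H (z i))" \<rho>]
    by (subst f_divergence_le_iff) (auto simp: H_def)
qed

text \<open>The correspondence is not bijective when points are inseparable, but only the sets of
  attained values have to agree. From measures to weights the divergence is preserved; from weights
  to measures it can only decrease.\<close>

lemma divergence_ball_iff:
  assumes l: "\<And>x. x \<in> X \<Longrightarrow> l x \<in> borel_measurable S"
  shows "(\<exists>P. c = T_opt X l P \<and> prob_space P \<and> sets P = sets S \<and>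
      absolutely_continuous (emp) P \<and>
      f_divergence f P (emp) \<le> ereal (\<rho> / n)) \<longleftrightarrow>
    (\<exists>w\<in>weight_set \<rho> n. (INF x\<in>X. \<Sum>i<n. w i * l x (z i)) = c)"
proof
  assume "\<exists>w\<in>weight_set \<rho> n. (INF x\<in>X. \<Sum>i<n. w i * l x (z i)) = c"
  then obtain w where w: "w \<in> weight_set \<rho> n" and c: "(INF x\<in>X. \<Sum>i<n. w i * l x (z i)) = c" by blast
  have w': "0 \<le> w i" "(\<Sum>i<n. w i) = 1" for i using w by (auto simp: weight_set_iff)
  have "T_opt X l (weighted w) = c"
    unfolding T_opt_def c[symmetric] using l w' by (intro INF_cong refl integral_weighted) auto
  then show "\<exists>P. c = T_opt X l P \<and> prob_space P \<and> sets P = sets S \<and>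
      absolutely_continuous (emp) P \<and>
      f_divergence f P (emp) \<le> ereal (\<rho> / n)"
    using f_divergence_weighted_le[OF w] absolutely_continuous_weighted prob_space_weighted[of w] w'
    by (intro exI[of _ "weighted w"]) auto
next
  assume "\<exists>P. c = T_opt X l P \<and> prob_space P \<and> sets P = sets S \<and>
      absolutely_continuous (emp) P \<and>
      f_divergence f P (emp) \<le> ereal (\<rho> / n)"
  then obtain P where c: "c = T_opt X l P" and P: "absolutely_continuous (emp) P"
    "sets P = sets S" "prob_space P" and D: "f_divergence f P (emp) \<le> ereal (\<rho> / n)" by blast
  define h where "h y = enn2real (RN_deriv (emp) P y)" for y
  \<comment> \<open>These weights share the mass of an inseparable class equally among its
    indices.\<close>
  define w where "w i = (if i < n then h (z i) / n else 0)" for i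
  have h0: "0 \<le> h y" for y by (simp add: h_def)
  have w0: "0 \<le> w i" for i by (simp add: w_def h0)
  have eq: "P = weighted w"
  proof (rule measure_eqI)
    fix A assume "A \<in> sets P"
    then have A: "A \<in> sets S" using P by simp
    have "emeasure P A = (\<Sum>i<n. ennreal (1 / n) * (RN_deriv (emp) P (z i) * indicator A (z i)))"
      by (rule emeasure_eq_sum_RN_deriv[OF P(1,2) A])
    also have "\<dots> = (\<Sum>i<n. ennreal (w i) * indicator A (z i))"
    proof (intro sum.cong refl)
      fix i assume i: "i \<in> {..<n}"
      have "RN_deriv (emp) P (z i) = ennreal (h (z i))"
        using RN_deriv_finite_at[OF P, of i] i by (simp add: h_def)
      moreover have "ennreal (w i) = ennreal (1 / n) * ennreal (h (z i))"
        using i h0 by (simp add: w_def flip: ennreal_mult'')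
      ultimately show "ennreal (1 / n) * (RN_deriv (emp) P (z i) * indicator A (z i)) =
          ennreal (w i) * indicator A (z i)" by (simp add: mult.assoc)
    qed
    finally show "emeasure P A = emeasure (weighted w) A" using A by (simp add: emeasure_weighted)
  qed (simp add: P)
  have "emeasure (weighted w) (space S) = 1"
    using prob_space.emeasure_space_1[OF P(3)] sets_eq_imp_space_eq[OF P(2)] eq by simp
  moreover have "(\<Sum>i<n. ennreal (w i) * indicator (space S) (z i)) = (\<Sum>i<n. ennreal (w i))"
    using z by (intro sum.cong) auto
  ultimately have "(\<Sum>i<n. ennreal (w i)) = 1" by (simp add: emeasure_weighted)
  then have "ennreal (\<Sum>i<n. w i) = ennreal 1" using w0 by (subst (asm) sum_ennreal) auto
  then have w1: "(\<Sum>i<n. w i) = 1" using w0 by (subst (asm) ennreal_inj) (auto intro: sum_nonneg)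
  have "(\<Sum>i<n. f (real n * w i)) = (\<Sum>i<n. f (h (z i)))"
    using n by (intro sum.cong) (auto simp: w_def)
  also have "\<dots> \<le> ereal \<rho>" using D f_divergence_le_iff[OF P(2)] by (simp add: h_def)
  finally have "w \<in> weight_set \<rho> n" using w0 w1 by (auto simp: weight_set_def) (simp add: w_def)
  moreover have "(INF x\<in>X. \<Sum>i<n. w i * l x (z i)) = c"
    unfolding c T_opt_def eq using l w0 by (intro INF_cong refl integral_weighted[symmetric]) auto
  ultimately show "\<exists>w\<in>weight_set \<rho> n. (INF x\<in>X. \<Sum>i<n. w i * l x (z i)) = c" by blast
qed

end

section \<open>Compactness and measurability\<close>

context nonneg_divergence_generator
begin

lemma lower_semicontinuous_sequence:
  assumes "t \<longlonglongrightarrow> s" "\<And>k. 0 \<le> t k" "0 \<le> s"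
  shows "f s \<le> liminf (\<lambda>k. f (t k))"
  unfolding le_Liminf_iff
proof (intro allI impI)
  fix y assume y: "y < f s"
  have "open (- {t. 0 \<le> t \<and> f t \<le> y})" using closed_divergence_sublevel[OF gen] by (simp add: open_closed)
  moreover have "s \<in> - {t. 0 \<le> t \<and> f t \<le> y}" using y by auto
  ultimately have "\<forall>\<^sub>F k in sequentially. t k \<in> - {t. 0 \<le> t \<and> f t \<le> y}"
    using assms(1) by (rule topological_tendstoD[rotated])
  then show "\<forall>\<^sub>F k in sequentially. y < f (t k)"
    by eventually_elim (use assms(2) in \<open>auto simp: not_le\<close>)
qed

text \<open>The divergence sum is lower semicontinuous because liminf is superadditive on
  nonnegative terms; the other conditions pass to coordinatewise limits.\<close>

lemma closed_weight_set: "closed (weight_set \<rho> n)"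
  unfolding closed_sequential_limits
proof (intro allI impI, elim conjE)
  fix v :: "nat \<Rightarrow> nat \<Rightarrow> real" and w
  assume v: "\<forall>k. v k \<in> weight_set \<rho> n" and lim: "v \<longlonglongrightarrow> w"
  have lim_i: "(\<lambda>k. v k i) \<longlonglongrightarrow> w i" for i
    using continuous_on_tendsto_compose[OF continuous_on_product_coordinates[of i] lim] by simp
  have vk: "0 \<le> v k i" "n \<le> i \<Longrightarrow> v k i = 0" "(\<Sum>i<n. v k i) = 1" "(\<Sum>i<n. f (real n * v k i)) \<le> ereal \<rho>" for k i
    using v by (auto simp: weight_set_def)
  have w0: "0 \<le> w i" for i by (rule LIMSEQ_le_const[OF lim_i]) (use vk in auto)
  have wz: "w i = 0" if "n \<le> i" for i
    using lim_i[of i] vk(2)[OF that] LIMSEQ_unique[OF _ tendsto_const] by auto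
  have "(\<lambda>k. \<Sum>i<n. v k i) \<longlonglongrightarrow> (\<Sum>i<n. w i)" by (intro tendsto_sum lim_i)
  then have w1: "(\<Sum>i<n. w i) = 1" using LIMSEQ_unique[OF _ tendsto_const] by (simp add: vk(3))
  have "(\<Sum>i<m. f (real n * w i)) \<le> liminf (\<lambda>k. \<Sum>i<m. f (real n * v k i))" for m
  proof (induction m)
    case (Suc m)
    have "(\<Sum>i<Suc m. f (real n * w i)) \<le> liminf (\<lambda>k. \<Sum>i<m. f (real n * v k i)) + liminf (\<lambda>k. f (real n * v k m))"
    proof -
      have "(\<lambda>k. real n * v k m) \<longlonglongrightarrow> real n * w m" by (intro tendsto_intros lim_i)
      then have "f (real n * w m) \<le> liminf (\<lambda>k. f (real n * v k m))"
        by (rule lower_semicontinuous_sequence) (use vk(1) w0 in auto)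
      then show ?thesis using Suc by (simp add: add_mono)
    qed
    also have "\<dots> \<le> liminf (\<lambda>k. (\<Sum>i<m. f (real n * v k i)) + f (real n * v k m))"
      using vk(1) by (intro Liminf_add_le always_eventually allI sum_nonneg nonneg) auto
    finally show ?case by simp
  qed (simp add: Liminf_const)
  also have "liminf (\<lambda>k. \<Sum>i<n. f (real n * v k i)) \<le> limsup (\<lambda>k. \<Sum>i<n. f (real n * v k i))"
    by (intro Liminf_le_Limsup) simp
  also have "\<dots> \<le> ereal \<rho>" by (intro Limsup_bounded always_eventually allI vk(4))
  finally show "w \<in> weight_set \<rho> n" using w0 wz w1 by (simp add: weight_set_def)
qed

text \<open>A closed subset of a cube that is compact by Tychonoff's theorem.\<close>

lemma compact_weight_set: "compact (weight_set \<rho> n)"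
proof -
  have "compactin (product_topology (\<lambda>i. euclidean) UNIV) (PiE UNIV (\<lambda>i::nat. {0..1::real}))"
    by (subst compactin_PiE) auto
  then have "compact (PiE UNIV (\<lambda>i::nat. {0..1::real}))" by (simp add: euclidean_product_topology)
  moreover have "weight_set \<rho> n \<subseteq> PiE UNIV (\<lambda>i. {0..1})"
  proof
    fix w assume w: "w \<in> weight_set \<rho> n"
    have "w i \<le> 1" for i
    proof (cases "i < n")
      case True
      then have "w i \<le> (\<Sum>i<n. w i)" using w by (intro member_le_sum) (auto simp: weight_set_def)
      then show ?thesis using w by (simp add: weight_set_def)
    qed (use w in \<open>auto simp: weight_set_def\<close>)
    then show "w \<in> PiE UNIV (\<lambda>i. {0..1})" using w by (auto simp: weight_set_def)
  qed
  ultimately show ?thesis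
    using closed_weight_set[of \<rho> n] by (metis compact_Int_closed inf.absorb_iff2)
qed

lemma weight_set_convex:
  assumes "v \<in> weight_set \<rho> n" "w \<in> weight_set \<rho> n" "0 \<le> u" "u \<le> 1"
  shows "(\<lambda>i. u * v i + (1 - u) * w i) \<in> weight_set \<rho> n"
proof -
  have v: "0 \<le> v i" "n \<le> i \<Longrightarrow> v i = 0" "(\<Sum>i<n. v i) = 1" "i < n \<Longrightarrow> real n * v i \<in> dom" "(\<Sum>i<n. fr (real n * v i)) \<le> \<rho>" for i
    using assms(1) by (auto simp: weight_set_iff)
  have w: "0 \<le> w i" "n \<le> i \<Longrightarrow> w i = 0" "(\<Sum>i<n. w i) = 1" "i < n \<Longrightarrow> real n * w i \<in> dom" "(\<Sum>i<n. fr (real n * w i)) \<le> \<rho>" for i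
    using assms(2) by (auto simp: weight_set_iff)
  have eq: "real n * (u * v i + (1 - u) * w i) = u * (real n * v i) + (1 - u) * (real n * w i)" for i
    by (simp add: algebra_simps)
  have "(\<Sum>i<n. fr (real n * (u * v i + (1 - u) * w i))) \<le> (\<Sum>i<n. u * fr (real n * v i) + (1 - u) * fr (real n * w i))"
    unfolding eq using v(4) w(4) assms by (intro sum_mono convex_combination(2)) auto
  also have "\<dots> = u * (\<Sum>i<n. fr (real n * v i)) + (1 - u) * (\<Sum>i<n. fr (real n * w i))"
    by (simp add: sum.distrib sum_distrib_left)
  also have "\<dots> \<le> u * \<rho> + (1 - u) * \<rho>" using assms v(5) w(5) by (intro add_mono mult_left_mono) auto
  finally have "(\<Sum>i<n. fr (real n * (u * v i + (1 - u) * w i))) \<le> \<rho>" by (simp add: algebra_simps)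
  moreover have "real n * (u * v i + (1 - u) * w i) \<in> dom" if "i < n" for i
    unfolding eq using v(4)[OF that] w(4)[OF that] assms by (intro convex_combination(1)) auto
  moreover have "(\<Sum>i<n. u * v i + (1 - u) * w i) = 1"
    using v(3) w(3) by (simp add: sum.distrib flip: sum_distrib_left)
  ultimately show ?thesis using v w assms by (auto simp: weight_set_iff)
qed

end

lemma bdd_below_continuous_image:
  fixes g :: "'b::topological_space \<Rightarrow> real"
  assumes "compact K" "continuous_on K g"
  shows "bdd_below (g ` K)"
  using compact_imp_bounded[OF compact_continuous_image[OF assms(2,1)]] by (rule bounded_imp_bdd_below)

text \<open>Replaces an infimum over a continuum by a countable one, first over decisions and later
  over weights; measurability comes from this.\<close>

lemma INF_dense_subset:
  fixes g :: "'b::topological_space \<Rightarrow> real"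
  assumes K: "compact K" "closed K" "K \<noteq> {}" and g: "continuous_on K g" and D: "D \<subseteq> K" "K \<subseteq> closure D"
  shows "(INF w\<in>D. g w) = (INF w\<in>K. g w)"
proof (rule antisym)
  have cl: "closure D = K" using D K by (simp add: closure_minimal subset_antisym)
  then have ne: "D \<noteq> {}" using K by auto
  have bdd: "bdd_below (g ` K)" by (rule bdd_below_continuous_image[OF K(1) g])
  then have bddD: "bdd_below (g ` D)" using D by (meson bdd_below_mono image_mono)
  show "(INF w\<in>K. g w) \<le> (INF w\<in>D. g w)"
    using ne bdd D by (intro cINF_superset_mono) auto
  show "(INF w\<in>D. g w) \<le> (INF w\<in>K. g w)"
  proof (rule cINF_greatest[OF K(3)])
    fix w assume "w \<in> K"
    show "(INF w\<in>D. g w) \<le> g w"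
    proof (rule continuous_ge_on_closure[of D g])
      show "continuous_on (closure D) g" using g cl by simp
      show "w \<in> closure D" using \<open>w \<in> K\<close> cl by simp
      show "(INF w\<in>D. g w) \<le> g x" if "x \<in> D" for x by (rule cINF_lower[OF bddD that])
    qed
  qed
qed

section \<open>The robust value and measurability of the coverage event\<close>

locale robust_loss = lipschitz_loss W P \<xi> X l V xs + nonneg_divergence_generator f
  for W :: "'w measure" and P :: "'a measure" and \<xi> :: "nat \<Rightarrow> 'w \<Rightarrow> 'a"
    and X :: "(real ^ 'd) set" and l :: "real ^ 'd \<Rightarrow> 'a \<Rightarrow> real" and V :: "'a \<Rightarrow> real" and xs :: "real ^ 'd"
    and f :: "real \<Rightarrow> ereal" +
  fixes \<rho> :: real
  assumes smooth: "smooth_generator f" and rho: "0 < \<rho>"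
begin

definition robust_value :: "nat \<Rightarrow> 'w \<Rightarrow> (nat \<Rightarrow> real) \<Rightarrow> real" where
  "robust_value n \<omega> w = (INF x\<in>X. \<Sum>i<n. w i * l x (\<xi> i \<omega>))"

definition covered :: "nat \<Rightarrow> 'w set" where
  "covered n = {\<omega>\<in>space W. \<exists>w\<in>weight_set \<rho> n. robust_value n \<omega> w = (\<integral>z. l xs z \<partial>P)}"

lemma X_nonempty: "X \<noteq> {}" using xs by auto

lemma weight_set_nonempty: "0 < n \<Longrightarrow> weight_set \<rho> n \<noteq> {}"
proof -
  assume n: "0 < n"
  have "f 1 = 0" using smooth by (simp add: smooth_generator_def Let_def)
  then have "(\<lambda>i. if i < n then 1 / n else 0) \<in> weight_set \<rho> n"
    using n rho by (auto simp: weight_set_def)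
  then show ?thesis by auto
qed

lemma continuous_on_weighted_loss:
  "\<omega> \<in> space W \<Longrightarrow> continuous_on X (\<lambda>x. \<Sum>i<n. w i * l x (\<xi> i \<omega>))"
  by (intro continuous_intros continuous_on_l \<xi>_in_space)

lemma bdd_below_weighted_loss: "\<omega> \<in> space W \<Longrightarrow> bdd_below ((\<lambda>x. \<Sum>i<n. w i * l x (\<xi> i \<omega>)) ` X)"
  by (intro bdd_below_continuous_image compact_X continuous_on_weighted_loss)

lemma robust_value_le: "\<omega> \<in> space W \<Longrightarrow> x \<in> X \<Longrightarrow> robust_value n \<omega> w \<le> (\<Sum>i<n. w i * l x (\<xi> i \<omega>))"
  unfolding robust_value_def by (rule cINF_lower[OF bdd_below_weighted_loss])

text \<open>Losses at the sample points are bounded over the compact \<open>X\<close>, so the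
  infimum moves by at most a weighted sum of the first \<open>n\<close> coordinate changes.\<close>

lemma continuous_on_robust_value:
  assumes \<omega>: "\<omega> \<in> space W"
  shows "continuous_on UNIV (robust_value n \<omega>)"
proof -
  have "\<exists>b. \<forall>x\<in>X. \<bar>l x (\<xi> i \<omega>)\<bar> \<le> b" for i
  proof -
    have "bounded ((\<lambda>x. l x (\<xi> i \<omega>)) ` X)"
      by (intro compact_imp_bounded compact_continuous_image compact_X continuous_on_l \<xi>_in_space \<omega>)
    then show ?thesis by (auto simp: bounded_iff)
  qed
  then obtain b where b: "\<And>i x. x \<in> X \<Longrightarrow> \<bar>l x (\<xi> i \<omega>)\<bar> \<le> b i" by metis
  have le: "robust_value n \<omega> v \<le> robust_value n \<omega> w + (\<Sum>i<n. \<bar>v i - w i\<bar> * b i)" for v w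
  proof -
    have "robust_value n \<omega> v - (\<Sum>i<n. \<bar>v i - w i\<bar> * b i) \<le> robust_value n \<omega> w"
      unfolding robust_value_def[of n \<omega> w]
    proof (rule cINF_greatest[OF X_nonempty])
      fix x assume x: "x \<in> X"
      have "robust_value n \<omega> v \<le> (\<Sum>i<n. v i * l x (\<xi> i \<omega>))" by (rule robust_value_le[OF \<omega> x])
      also have "\<dots> = (\<Sum>i<n. w i * l x (\<xi> i \<omega>)) + (\<Sum>i<n. (v i - w i) * l x (\<xi> i \<omega>))"
        by (simp add: sum.distrib[symmetric] algebra_simps)
      also have "(\<Sum>i<n. (v i - w i) * l x (\<xi> i \<omega>)) \<le> (\<Sum>i<n. \<bar>v i - w i\<bar> * b i)"
      proof (intro sum_mono)
        fix i
        have "(v i - w i) * l x (\<xi> i \<omega>) \<le> \<bar>v i - w i\<bar> * \<bar>l x (\<xi> i \<omega>)\<bar>" by (metis abs_ge_self abs_mult)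
        also have "\<dots> \<le> \<bar>v i - w i\<bar> * b i" using b[OF x] by (intro mult_left_mono) auto
        finally show "(v i - w i) * l x (\<xi> i \<omega>) \<le> \<bar>v i - w i\<bar> * b i" .
      qed
      finally show "robust_value n \<omega> v - (\<Sum>i<n. \<bar>v i - w i\<bar> * b i) \<le> (\<Sum>i<n. w i * l x (\<xi> i \<omega>))" by simp
    qed
    then show ?thesis by simp
  qed
  have "isCont (robust_value n \<omega>) w" for w
  proof -
    have cont: "isCont (\<lambda>v::nat\<Rightarrow>real. v i) w" for i
      using continuous_on_product_coordinates[of i] continuous_on_eq_continuous_at[OF open_UNIV] by blast
    have "((\<lambda>v. \<Sum>i<n. \<bar>v i - w i\<bar> * b i) \<longlongrightarrow> (\<Sum>i<n. \<bar>w i - w i\<bar> * b i)) (at w)"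
      by (intro tendsto_intros isContD cont)
    then have 0: "((\<lambda>v. \<Sum>i<n. \<bar>v i - w i\<bar> * b i) \<longlongrightarrow> 0) (at w)" by simp
    have "((\<lambda>v. robust_value n \<omega> v - robust_value n \<omega> w) \<longlongrightarrow> 0) (at w)"
    proof (rule Lim_null_comparison[OF always_eventually 0], intro allI)
      fix v
      show "norm (robust_value n \<omega> v - robust_value n \<omega> w) \<le> (\<Sum>i<n. \<bar>v i - w i\<bar> * b i)"
        using le[of v w] le[of w v] by (simp add: abs_le_iff abs_minus_commute)
    qed
    then show ?thesis unfolding isCont_def using LIM_zero_iff by blast
  qed
  then show ?thesis by (simp add: continuous_on_eq_continuous_at)
qed

lemma measurable_robust_value: "(\<lambda>\<omega>. robust_value n \<omega> w) \<in> borel_measurable W"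
proof -
  obtain D where D: "countable D" "D \<subseteq> X" "X \<subseteq> closure D" using separable by blast
  have D_ne: "D \<noteq> {}" using D X_nonempty by auto
  have "(\<lambda>\<omega>. INF x\<in>D. \<Sum>i<n. w i * l x (\<xi> i \<omega>)) \<in> borel_measurable W"
  proof (rule borel_measurable_cINF[OF D(1)])
    show "(\<lambda>\<omega>. \<Sum>i<n. w i * l x (\<xi> i \<omega>)) \<in> borel_measurable W" if "x \<in> D" for x
      using D that by (intro borel_measurable_sum borel_measurable_times measurable_compose[OF measurable_\<xi> l_meas]) auto
    show "bdd_below ((\<lambda>x. \<Sum>i<n. w i * l x (\<xi> i \<omega>)) ` D)" if "\<omega> \<in> space W" for \<omega>
      using bdd_below_weighted_loss[OF that] D by (meson bdd_below_mono image_mono)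
  qed
  also have "(\<lambda>\<omega>. INF x\<in>D. \<Sum>i<n. w i * l x (\<xi> i \<omega>)) \<in> borel_measurable W \<longleftrightarrow> ?thesis"
    unfolding robust_value_def
    by (intro measurable_cong INF_dense_subset compact_X compact_imp_closed X_nonempty continuous_on_weighted_loss D)
  finally show ?thesis .
qed

text \<open>The intermediate value theorem along the segment from \<open>w0\<close> to
  \<open>w1\<close>, which stays in the convex weight set. It turns two inequalities into the exact
  equation that defines coverage.\<close>

lemma coveredI:
  assumes \<omega>: "\<omega> \<in> space W" and w0: "w0 \<in> weight_set \<rho> n" "robust_value n \<omega> w0 \<le> (\<integral>z. l xs z \<partial>P)"
    and w1: "w1 \<in> weight_set \<rho> n" "(\<integral>z. l xs z \<partial>P) \<le> robust_value n \<omega> w1"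
  shows "\<omega> \<in> covered n"
proof -
  define p where "p u = (\<lambda>i. u * w1 i + (1 - u) * w0 i)" for u :: real
  have "continuous_on {0..1} (\<lambda>u. robust_value n \<omega> (p u))"
  proof (rule continuous_on_compose2[OF continuous_on_robust_value[OF \<omega>]])
    show "continuous_on {0..1} p"
      unfolding p_def by (intro continuous_on_coordinatewise_then_product continuous_intros)
  qed simp
  moreover have "p 0 = w0" "p 1 = w1" by (auto simp: p_def)
  ultimately obtain u where u: "0 \<le> u" "u \<le> 1" "robust_value n \<omega> (p u) = (\<integral>z. l xs z \<partial>P)"
    using IVT'[of "\<lambda>u. robust_value n \<omega> (p u)" 0 "\<integral>z. l xs z \<partial>P" 1] w0 w1 by auto
  moreover have "p u \<in> weight_set \<rho> n"
    unfolding p_def using w0 w1 u by (intro weight_set_convex) auto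
  ultimately show ?thesis using \<omega> by (auto simp: covered_def)
qed

text \<open>Extrema over the compact weight set are attained, so the existential statement says that
  the target lies between the minimum and the maximum. Both are countable infima of measurable
  functions.\<close>

lemma covered_measurable:
  assumes n: "0 < n"
  shows "covered n \<in> sets W"
proof -
  define K where "K = weight_set \<rho> n"
  have K: "compact K" "closed K" "K \<noteq> {}"
    unfolding K_def by (intro compact_weight_set closed_weight_set weight_set_nonempty n)+
  obtain D where D: "countable D" "D \<subseteq> K" "K \<subseteq> closure D" by (rule separable)
  define T where "T = (\<integral>z. l xs z \<partial>P)"
  have cont: "continuous_on K (robust_value n \<omega>)" if "\<omega> \<in> space W" for \<omega>
    using continuous_on_robust_value[OF that] continuous_on_subset by blast
  \<comment> \<open>\<open>s = 1\<close> yields the minimum and \<open>s = - 1\<close> the negated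
    maximum.\<close>
  have meas_INF: "(\<lambda>\<omega>. INF w\<in>K. s * robust_value n \<omega> w) \<in> borel_measurable W" for s :: real
  proof -
    have bdd: "bdd_below ((\<lambda>w. s * robust_value n \<omega> w) ` K)" if "\<omega> \<in> space W" for \<omega>
      by (intro bdd_below_continuous_image K continuous_intros cont that)
    have "(\<lambda>\<omega>. INF w\<in>D. s * robust_value n \<omega> w) \<in> borel_measurable W"
    proof (rule borel_measurable_cINF[OF D(1)])
      show "bdd_below ((\<lambda>w. s * robust_value n \<omega> w) ` D)" if "\<omega> \<in> space W" for \<omega>
        using bdd[OF that] D by (meson bdd_below_mono image_mono)
    qed (intro borel_measurable_times borel_measurable_const measurable_robust_value)
    also have "(\<lambda>\<omega>. INF w\<in>D. s * robust_value n \<omega> w) \<in> borel_measurable W \<longleftrightarrow> ?thesis"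
      by (intro measurable_cong INF_dense_subset K D continuous_intros cont)
    finally show ?thesis .
  qed
  have "covered n = {\<omega>\<in>space W. (INF w\<in>K. 1 * robust_value n \<omega> w) \<le> T \<and> (INF w\<in>K. (-1) * robust_value n \<omega> w) \<le> - T}"
    unfolding covered_def K_def[symmetric] T_def[symmetric]
  proof (intro Collect_cong conj_cong refl)
    fix \<omega> assume \<omega>: "\<omega> \<in> space W"
    have bdd: "bdd_below ((\<lambda>w. s * robust_value n \<omega> w) ` K)" for s
      by (intro bdd_below_continuous_image K continuous_intros cont \<omega>)
    have attain: "\<exists>w0\<in>K. s * robust_value n \<omega> w0 = (INF w\<in>K. s * robust_value n \<omega> w)" for s
    proof -
      obtain w0 where w0: "w0 \<in> K" "\<And>w. w \<in> K \<Longrightarrow> s * robust_value n \<omega> w0 \<le> s * robust_value n \<omega> w"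
        using continuous_attains_inf[OF K(1,3), of "\<lambda>w. s * robust_value n \<omega> w"]
        by (metis continuous_on_mult_left cont \<omega>)
      then show ?thesis
        using bdd[of s] K by (intro bexI[of _ w0] antisym cINF_greatest cINF_lower) auto
    qed
    show "(\<exists>w\<in>K. robust_value n \<omega> w = T) \<longleftrightarrow> (INF w\<in>K. 1 * robust_value n \<omega> w) \<le> T \<and> (INF w\<in>K. (-1) * robust_value n \<omega> w) \<le> - T"
    proof
      assume "\<exists>w\<in>K. robust_value n \<omega> w = T"
      then obtain w where "w \<in> K" "robust_value n \<omega> w = T" by blast
      then show "(INF w\<in>K. 1 * robust_value n \<omega> w) \<le> T \<and> (INF w\<in>K. (-1) * robust_value n \<omega> w) \<le> - T"
        using cINF_lower[OF bdd[of 1], of w] cINF_lower[OF bdd[of "- 1"], of w] by auto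
    next
      assume le: "(INF w\<in>K. 1 * robust_value n \<omega> w) \<le> T \<and> (INF w\<in>K. (-1) * robust_value n \<omega> w) \<le> - T"
      obtain w0 w1 where w0: "w0 \<in> K" "robust_value n \<omega> w0 \<le> T" and w1: "w1 \<in> K" "T \<le> robust_value n \<omega> w1"
        using attain[of 1] attain[of "- 1"] le by auto
      have "\<omega> \<in> covered n"
        using w0 w1 by (intro coveredI[OF \<omega>]) (auto simp: K_def T_def)
      then show "\<exists>w\<in>K. robust_value n \<omega> w = T" by (simp add: covered_def K_def T_def)
    qed
  qed
  also have "\<dots> \<in> sets W" using meas_INF[of 1] meas_INF[of "- 1"] by measurable
  finally show ?thesis .
qed

end

section \<open>Quadratic behaviour of the divergence ball\<close>

context nonneg_divergence_generator
begin

lemma generator_bounds: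
  assumes smooth: "smooth_generator f" and \<epsilon>: "0 < \<epsilon>"
  obtains \<eta> where "0 < \<eta>" "\<eta> < 1" "\<And>u. \<bar>u\<bar> \<le> \<eta> \<Longrightarrow> 1 + u \<in> dom"
    "\<And>u. \<bar>u\<bar> \<le> \<eta> \<Longrightarrow> (1 - \<epsilon>) * u\<^sup>2 \<le> fr (1 + u)" "\<And>u. \<bar>u\<bar> \<le> \<eta> \<Longrightarrow> fr (1 + u) \<le> (1 + \<epsilon>) * u\<^sup>2"
    "\<And>u. 1 + u \<in> dom \<Longrightarrow> \<eta> \<le> \<bar>u\<bar> \<Longrightarrow> (1 - \<epsilon>) * \<eta> * \<bar>u\<bar> \<le> fr (1 + u)"
proof -
  obtain \<eta> where \<eta>: "0 < \<eta>" "\<eta> < 1"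
    and lo: "\<And>u. \<bar>u\<bar> \<le> \<eta> \<Longrightarrow> ereal ((1 - \<epsilon>) * u\<^sup>2) \<le> f (1 + u)"
    and up: "\<And>u. \<bar>u\<bar> \<le> \<eta> \<Longrightarrow> f (1 + u) \<le> ereal ((1 + \<epsilon>) * u\<^sup>2)"
    using smooth_generator_quadratic[OF smooth \<epsilon>] by auto
  have dom: "1 + u \<in> dom" if "\<bar>u\<bar> \<le> \<eta>" for u
    using up[OF that] that \<eta> by (auto simp: dom_def)
  show ?thesis
  proof (rule that[OF \<eta> dom])
    show "(1 - \<epsilon>) * u\<^sup>2 \<le> fr (1 + u)" "fr (1 + u) \<le> (1 + \<epsilon>) * u\<^sup>2" if "\<bar>u\<bar> \<le> \<eta>" for u
      using lo[OF that] up[OF that] by (simp_all add: f_eq[OF dom[OF that]])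
    show "(1 - \<epsilon>) * \<eta> * \<bar>u\<bar> \<le> fr (1 + u)" if u: "1 + u \<in> dom" "\<eta> \<le> \<bar>u\<bar>" for u
    proof -
      have "- 1 \<le> u" using u by (auto simp: dom_def)
      from smooth_generator_linear[OF smooth \<eta> lo this u(2)] show ?thesis by (simp add: f_eq[OF u(1)])
    qed
  qed
qed

text \<open>The indices are split by the relative deviation \<open>n * w i - 1\<close>. Where it is
  at most \<open>\<eta>\<close>, the quadratic bound limits the sum of squares and Cauchy-Schwarz
  applies. Where it is larger, the linear bound limits the sum of absolute values, which is paired
  with the maximum \<open>\<beta>\<close>; this second part is negligible once
  \<open>\<beta>\<close> is o(sqrt n).\<close>

lemma weight_deviation_le:
  assumes \<epsilon>: "\<epsilon> < 1" and \<eta>: "0 < \<eta>"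
    and quad: "\<And>u. \<bar>u\<bar> \<le> \<eta> \<Longrightarrow> (1 - \<epsilon>) * u\<^sup>2 \<le> fr (1 + u)"
    and lin: "\<And>u. 1 + u \<in> dom \<Longrightarrow> \<eta> \<le> \<bar>u\<bar> \<Longrightarrow> (1 - \<epsilon>) * \<eta> * \<bar>u\<bar> \<le> fr (1 + u)"
    and w: "w \<in> weight_set \<rho> n" and n: "0 < n" and b: "\<And>i. i < n \<Longrightarrow> \<bar>b i\<bar> \<le> \<beta>"
  shows "\<bar>\<Sum>i<n. (w i - 1 / n) * b i\<bar> \<le> (sqrt (\<rho> / (1 - \<epsilon>) * (\<Sum>i<n. (b i)\<^sup>2)) + \<rho> / ((1 - \<epsilon>) * \<eta>) * \<beta>) / n"
proof -
  define u where "u i = real n * w i - 1" for i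
  have nw: "real n * w i = 1 + u i" for i by (simp add: u_def)
  have d: "1 + u i \<in> dom" if "i < n" for i using w that by (auto simp: weight_set_iff nw)
  have sum: "(\<Sum>i<n. fr (1 + u i)) \<le> \<rho>" using w by (simp add: weight_set_iff nw)
  have \<beta>: "0 \<le> \<beta>" using b[OF n] by simp
  define S where "S = {i\<in>{..<n}. \<bar>u i\<bar> \<le> \<eta>}"
  define L where "L = {i\<in>{..<n}. \<not> \<bar>u i\<bar> \<le> \<eta>}"
  have SL: "{..<n} = S \<union> L" "S \<inter> L = {}" "finite S" "finite L" by (auto simp: S_def L_def)
  have split: "(\<Sum>i<n. g i) = (\<Sum>i\<in>S. g i) + (\<Sum>i\<in>L. g i)" for g :: "nat \<Rightarrow> real"
    unfolding SL(1) using SL by (intro sum.union_disjoint) auto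
  have part: "(\<Sum>i\<in>S. fr (1 + u i)) \<le> \<rho>" "(\<Sum>i\<in>L. fr (1 + u i)) \<le> \<rho>"
    using sum split[of "\<lambda>i. fr (1 + u i)"] sum_nonneg[of S "\<lambda>i. fr (1 + u i)"] sum_nonneg[of L "\<lambda>i. fr (1 + u i)"]
    by (auto simp: S_def L_def d fr_nonneg)
  have "(1 - \<epsilon>) * (\<Sum>i\<in>S. (u i)\<^sup>2) \<le> (\<Sum>i\<in>S. fr (1 + u i))"
    unfolding sum_distrib_left by (intro sum_mono quad) (auto simp: S_def)
  then have S_le: "(\<Sum>i\<in>S. (u i)\<^sup>2) \<le> \<rho> / (1 - \<epsilon>)" using part \<epsilon> by (simp add: field_simps)
  have "(1 - \<epsilon>) * \<eta> * (\<Sum>i\<in>L. \<bar>u i\<bar>) \<le> (\<Sum>i\<in>L. fr (1 + u i))"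
    unfolding sum_distrib_left by (intro sum_mono lin d) (auto simp: L_def)
  then have L_le: "(\<Sum>i\<in>L. \<bar>u i\<bar>) \<le> \<rho> / ((1 - \<epsilon>) * \<eta>)"
    using part \<epsilon> \<eta> by (simp add: pos_le_divide_eq mult.commute)
  have "\<bar>\<Sum>i\<in>S. u i * b i\<bar> \<le> sqrt (\<rho> / (1 - \<epsilon>) * (\<Sum>i<n. (b i)\<^sup>2))"
  proof (rule real_le_rsqrt[of "\<bar>\<Sum>i\<in>S. u i * b i\<bar>", simplified])
    have "(\<Sum>i\<in>S. u i * b i)\<^sup>2 \<le> (\<Sum>i\<in>S. (u i)\<^sup>2) * (\<Sum>i\<in>S. (b i)\<^sup>2)" by (rule Cauchy_Schwarz_ineq_sum)
    also have "\<dots> \<le> \<rho> / (1 - \<epsilon>) * (\<Sum>i<n. (b i)\<^sup>2)"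
    proof (rule mult_mono[OF S_le])
      show "(\<Sum>i\<in>S. (b i)\<^sup>2) \<le> (\<Sum>i<n. (b i)\<^sup>2)" using SL by (intro sum_mono2) auto
      show "0 \<le> \<rho> / (1 - \<epsilon>)" using S_le sum_nonneg[of S "\<lambda>i. (u i)\<^sup>2"] by simp
    qed (auto intro: sum_nonneg)
    finally show "(\<Sum>i\<in>S. u i * b i)\<^sup>2 \<le> \<rho> / (1 - \<epsilon>) * (\<Sum>i<n. (b i)\<^sup>2)" .
  qed
  moreover have "\<bar>\<Sum>i\<in>L. u i * b i\<bar> \<le> \<rho> / ((1 - \<epsilon>) * \<eta>) * \<beta>"
  proof -
    have "\<bar>\<Sum>i\<in>L. u i * b i\<bar> \<le> (\<Sum>i\<in>L. \<bar>u i\<bar> * \<bar>b i\<bar>)" using sum_abs[of "\<lambda>i. u i * b i" L] by (simp add: abs_mult)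
    also have "\<dots> \<le> (\<Sum>i\<in>L. \<bar>u i\<bar> * \<beta>)" by (intro sum_mono mult_left_mono b) (auto simp: L_def)
    also have "\<dots> = (\<Sum>i\<in>L. \<bar>u i\<bar>) * \<beta>" by (simp add: sum_distrib_right)
    also have "\<dots> \<le> \<rho> / ((1 - \<epsilon>) * \<eta>) * \<beta>" by (intro mult_right_mono L_le \<beta>)
    finally show ?thesis .
  qed
  ultimately have "\<bar>\<Sum>i<n. u i * b i\<bar> \<le> sqrt (\<rho> / (1 - \<epsilon>) * (\<Sum>i<n. (b i)\<^sup>2)) + \<rho> / ((1 - \<epsilon>) * \<eta>) * \<beta>"
    unfolding split by linarith
  moreover have "(\<Sum>i<n. (w i - 1 / n) * b i) = (\<Sum>i<n. u i * b i) / n"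
    unfolding sum_divide_distrib using n by (intro sum.cong) (auto simp: u_def field_simps)
  ultimately show ?thesis using n by (simp add: abs_divide divide_right_mono)
qed

text \<open>Deviations proportional to \<open>a i - m\<close> give equality in Cauchy-Schwarz, so
  this weight is nearly extremal in the ball. Centring keeps the total mass 1; smallness keeps the
  weights positive and within range of the quadratic upper bound.\<close>

lemma tilted_weight:
  fixes a :: "nat \<Rightarrow> real"
  assumes \<eta>: "\<eta> < 1" and dom: "\<And>u. \<bar>u\<bar> \<le> \<eta> \<Longrightarrow> 1 + u \<in> dom"
    and up: "\<And>u. \<bar>u\<bar> \<le> \<eta> \<Longrightarrow> fr (1 + u) \<le> (1 + \<epsilon>) * u\<^sup>2" and n: "0 < n"
  defines "m \<equiv> (\<Sum>i<n. a i) / n"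
  assumes \<theta>: "(1 + \<epsilon>) * \<theta>\<^sup>2 * (\<Sum>i<n. (a i - m)\<^sup>2) \<le> \<rho>" and small: "\<And>i. i < n \<Longrightarrow> \<bar>\<theta> * (a i - m)\<bar> \<le> \<eta>"
  shows "\<exists>w\<in>weight_set \<rho> n. (\<Sum>i<n. w i * a i) = m + \<theta> * (\<Sum>i<n. (a i - m)\<^sup>2) / n"
proof -
  define w where "w i = (if i < n then (1 + \<theta> * (a i - m)) / n else 0)" for i
  have nw: "real n * w i = 1 + \<theta> * (a i - m)" if "i < n" for i using that n by (simp add: w_def)
  have zero: "(\<Sum>i<n. a i - m) = 0" using n by (simp add: m_def sum_subtractf)
  have w0: "0 \<le> w i" for i
  proof (cases "i < n")
    case True
    then have "0 \<le> 1 + \<theta> * (a i - m)" using small[OF True] \<eta> by linarith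
    then show ?thesis by (simp add: w_def)
  qed (simp add: w_def)
  have "(\<Sum>i<n. w i) = (\<Sum>i<n. (1 + \<theta> * (a i - m)) / n)" by (intro sum.cong) (auto simp: w_def)
  also have "\<dots> = (n + \<theta> * (\<Sum>i<n. a i - m)) / n"
    by (simp add: sum.distrib flip: sum_divide_distrib sum_distrib_left)
  finally have w1: "(\<Sum>i<n. w i) = 1" using n zero by simp
  have "(\<Sum>i<n. fr (real n * w i)) \<le> (\<Sum>i<n. (1 + \<epsilon>) * (\<theta> * (a i - m))\<^sup>2)"
    by (intro sum_mono) (simp add: nw up small)
  also have "\<dots> = (1 + \<epsilon>) * \<theta>\<^sup>2 * (\<Sum>i<n. (a i - m)\<^sup>2)"
    by (simp add: power_mult_distrib sum_distrib_left mult.assoc)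
  finally have "(\<Sum>i<n. fr (real n * w i)) \<le> \<rho>" using \<theta> by simp
  then have "w \<in> weight_set \<rho> n"
    using w0 w1 by (auto simp: weight_set_iff nw intro!: dom small) (simp add: w_def)
  moreover have "(\<Sum>i<n. w i * a i) = m + \<theta> * (\<Sum>i<n. (a i - m)\<^sup>2) / n"
  proof -
    have "(\<Sum>i<n. w i * a i) = (\<Sum>i<n. a i / n + \<theta> * (a i - m) * m / n + \<theta> * (a i - m)\<^sup>2 / n)"
      using n by (intro sum.cong refl) (auto simp: w_def field_simps power2_eq_square)
    also have "\<dots> = (\<Sum>i<n. a i) / n + \<theta> * (\<Sum>i<n. a i - m) * m / n + \<theta> * (\<Sum>i<n. (a i - m)\<^sup>2) / n"
      by (simp add: sum.distrib sum_distrib_left sum_distrib_right sum_divide_distrib)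
    finally show ?thesis using zero by (simp add: m_def)
  qed
  ultimately show ?thesis by blast
qed

end

section \<open>Localization at the optimizer\<close>

context robust_loss
begin

text \<open>\<open>gap x + dev n x \<omega> / n\<close> is the unweighted mean of the loss
  differences. The tolerance of the generator is fixed at \<open>1/2\<close>, since only the order
  \<open>s / sqrt n\<close> of the error matters here.\<close>

lemma weighted_deviation_at:
  assumes \<eta>: "0 < \<eta>"
    and quad: "\<And>u. \<bar>u\<bar> \<le> \<eta> \<Longrightarrow> (1 - 1/2) * u\<^sup>2 \<le> fr (1 + u)"
    and lin: "\<And>u. 1 + u \<in> dom \<Longrightarrow> \<eta> \<le> \<bar>u\<bar> \<Longrightarrow> (1 - 1/2) * \<eta> * \<bar>u\<bar> \<le> fr (1 + u)"
    and \<omega>: "\<omega> \<in> space W" and n: "0 < n"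
    and V_max: "\<And>i. i < n \<Longrightarrow> V (\<xi> i \<omega>) \<le> sqrt n" and V_sum: "(\<Sum>i<n. (V (\<xi> i \<omega>))\<^sup>2) \<le> n * Q"
    and w: "w \<in> weight_set \<rho> n" and x: "x \<in> X" "norm (x - xs) \<le> s" and s: "0 \<le> s"
  shows "\<bar>(\<Sum>i<n. w i * (l x (\<xi> i \<omega>) - l xs (\<xi> i \<omega>))) - (gap x + dev n x \<omega> / n)\<bar>
    \<le> (sqrt (\<rho> / (1 - 1/2) * Q) + \<rho> / ((1 - 1/2) * \<eta>)) * s / sqrt n"
proof -
  define b where "b i = l x (\<xi> i \<omega>) - l xs (\<xi> i \<omega>)" for i
  have b: "\<bar>b i\<bar> \<le> V (\<xi> i \<omega>) * s" for i
  proof -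
    have "\<bar>b i\<bar> \<le> V (\<xi> i \<omega>) * norm (x - xs)"
      unfolding b_def by (rule Lipschitz[OF \<xi>_in_space[OF \<omega>] x(1) xs])
    also have "\<dots> \<le> V (\<xi> i \<omega>) * s" using x V_nonneg[OF \<xi>_in_space[OF \<omega>]] by (intro mult_left_mono)
    finally show ?thesis .
  qed
  have bmax: "\<bar>b i\<bar> \<le> sqrt n * s" if "i < n" for i
    using b[of i] mult_right_mono[OF V_max[OF that] s] by simp
  have "(\<Sum>i<n. (b i)\<^sup>2) \<le> (\<Sum>i<n. (V (\<xi> i \<omega>) * s)\<^sup>2)"
    by (intro sum_mono) (metis b abs_ge_zero power2_abs power_mono)
  also have "\<dots> = (\<Sum>i<n. (V (\<xi> i \<omega>))\<^sup>2) * s\<^sup>2" by (simp add: power_mult_distrib sum_distrib_right)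
  also have "\<dots> \<le> n * Q * s\<^sup>2" by (intro mult_right_mono V_sum) simp
  finally have bsq: "(\<Sum>i<n. (b i)\<^sup>2) \<le> n * Q * s\<^sup>2" .
  have "gap x + dev n x \<omega> / n = (\<Sum>i<n. 1 / n * b i)"
    using n by (simp add: dev_def b_def sum_subtractf sum.distrib field_simps flip: sum_distrib_left sum_divide_distrib)
  then have "(\<Sum>i<n. w i * b i) - (gap x + dev n x \<omega> / n) = (\<Sum>i<n. (w i - 1 / n) * b i)"
    by (simp add: left_diff_distrib sum_subtractf)
  also have "\<bar>\<dots>\<bar> \<le> (sqrt (\<rho> / (1 - 1/2) * (\<Sum>i<n. (b i)\<^sup>2)) + \<rho> / ((1 - 1/2) * \<eta>) * (sqrt n * s)) / n"
    by (rule weight_deviation_le[OF _ \<eta> quad lin w n bmax]) auto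
  also have "\<dots> \<le> (sqrt (\<rho> / (1 - 1/2) * (n * Q * s\<^sup>2)) + \<rho> / ((1 - 1/2) * \<eta>) * (sqrt n * s)) / n"
    using rho by (intro divide_right_mono add_right_mono real_sqrt_le_mono mult_left_mono bsq) auto
  also have "sqrt (\<rho> / (1 - 1/2) * (n * Q * s\<^sup>2)) = sqrt (\<rho> / (1 - 1/2) * Q) * s * sqrt n"
    using s by (simp add: real_sqrt_mult)
  also have "(sqrt (\<rho> / (1 - 1/2) * Q) * s * sqrt n + \<rho> / ((1 - 1/2) * \<eta>) * (sqrt n * s)) / n
      = (sqrt (\<rho> / (1 - 1/2) * Q) + \<rho> / ((1 - 1/2) * \<eta>)) * s * (sqrt n / n)"
    by (simp add: algebra_simps add_divide_distrib)
  also have "sqrt n / n = 1 / sqrt n" by (simp add: sqrt_divide_self_eq inverse_eq_divide)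
  finally show ?thesis by (simp add: b_def)
qed

text \<open>Outside an open ball around \<open>xs\<close> the continuous gap attains a minimum on a
  compact set, and uniqueness of the optimizer makes it positive.\<close>

lemma gap_separated:
  assumes r: "0 < r"
  obtains c where "0 < c" "\<And>x. x \<in> X \<Longrightarrow> r \<le> norm (x - xs) \<Longrightarrow> c \<le> gap x"
proof (cases "X - ball xs r = {}")
  case True
  show ?thesis
    by (rule that[of 1]) (use True in \<open>auto simp: dist_norm norm_minus_commute\<close>)
next
  case False
  have "compact (X - ball xs r)" using compact_X by (simp add: compact_diff)
  moreover have "continuous_on (X - ball xs r) gap" using continuous_on_gap continuous_on_subset by blast
  ultimately obtain y where y: "y \<in> X - ball xs r" "\<And>x. x \<in> X - ball xs r \<Longrightarrow> gap y \<le> gap x"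
    using continuous_attains_inf[OF _ False] by metis
  have "y \<noteq> xs" using y(1) r by auto
  then have "0 < gap y" using y(1) minimal[of y] by (simp add: gap_def)
  then show ?thesis
    by (rule that) (auto intro!: y(2) simp: dist_norm norm_minus_commute)
qed

text \<open>Within a small radius of the optimizer the modulus of continuity of the empirical process
  is small; outside, the population gap dominates every term of order \<open>1 / sqrt n\<close>.\<close>

lemma localization:
  assumes \<delta>: "0 < \<delta>"
  shows "whp W (\<lambda>n \<omega>. \<forall>w\<in>weight_set \<rho> n. (\<Sum>i<n. w i * l xs (\<xi> i \<omega>)) - \<delta> / sqrt n \<le> robust_value n \<omega> w)"
  unfolding whp_def
proof (intro allI impI)
  fix e :: real assume e: "0 < e"
  obtain \<eta> where \<eta>: "0 < \<eta>"
    and quad: "\<And>u. \<bar>u\<bar> \<le> \<eta> \<Longrightarrow> (1 - 1/2) * u\<^sup>2 \<le> fr (1 + u)"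
    and lin: "\<And>u. 1 + u \<in> dom \<Longrightarrow> \<eta> \<le> \<bar>u\<bar> \<Longrightarrow> (1 - 1/2) * \<eta> * \<bar>u\<bar> \<le> fr (1 + u)"
    using generator_bounds[OF smooth, of "1/2"] by (metis half_gt_zero_iff zero_less_one)
  define C where "C = sqrt (\<rho> / (1 - 1/2) * Q) + \<rho> / ((1 - 1/2) * \<eta>)"
  have C: "0 < C" unfolding C_def using rho Q_pos \<eta> by (intro add_pos_pos) auto
  define D where "D = 2 * chaining_const CARD('d) * sqrt Q"
  have D: "0 \<le> D" using Q_pos by (simp add: D_def chaining_const_def)
  obtain R where R: "0 < R" "X \<subseteq> cball xs R"
  proof -
    obtain R where "\<forall>y\<in>X. dist xs y \<le> R" using compact_imp_bounded[OF compact_X] bounded_any_center by blast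
    then show ?thesis using that[of "max R 1"] by fastforce
  qed
  \<comment> \<open>The first entry makes the reweighting error \<open>C * r\<close> at most
    \<open>\<delta> / 2\<close>; the second makes the tail bound at level
    \<open>\<delta> / 2\<close> at most \<open>e / 3\<close>. The denominator \<open>D + 1\<close>
    is positive given only \<open>0 \<le> D\<close>.\<close>
  define r where "r = min (\<delta> / (2 * C)) (e * \<delta> / (6 * (D + 1)))"
  have r: "0 < r" using \<delta> C D e by (simp add: r_def)
  have "C * r \<le> C * (\<delta> / (2 * C))" using C by (intro mult_left_mono) (auto simp: r_def)
  then have Cr: "C * r \<le> \<delta> / 2" using C by simp
  have "D * r \<le> (D + 1) * (e * \<delta> / (6 * (D + 1)))" using D r by (intro mult_mono) (auto simp: r_def)
  also have "\<dots> = e * \<delta> / 6"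
  proof -
    have "k * (y / (6 * k)) = y / 6" if "k \<noteq> 0" for k y :: real using that by simp
    from this[of "D + 1" "e * \<delta>"] show ?thesis using D by linarith
  qed
  finally have "D * r / (\<delta> / 2) \<le> (e * \<delta> / 6) / (\<delta> / 2)" using \<delta> by (intro divide_right_mono) auto
  then have Dr: "D * r / (\<delta> / 2) \<le> e / 3" using \<delta> by simp
  \<comment> \<open>A threshold for the ball of radius \<open>R\<close>, which contains all of
    \<open>X\<close>, again with tail bound \<open>e / 3\<close>. It may be large, because the gap
    \<open>c\<close> does not shrink with \<open>n\<close>.\<close>
  define t where "t = 3 * D * R / e + 1"
  have t: "0 < t" unfolding t_def using D R e by (intro add_nonneg_pos) auto
  have "D * R \<le> e / 3 * t" unfolding t_def using e by (simp add: field_simps)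
  then have DR: "D * R / t \<le> e / 3" using t by (simp add: pos_divide_le_eq)
  obtain c where c: "0 < c" "\<And>x. x \<in> X \<Longrightarrow> r \<le> norm (x - xs) \<Longrightarrow> c \<le> gap x"
    using gap_separated[OF r] by metis
  have lln: "whp W (\<lambda>n \<omega>. \<bar>(\<Sum>i<n. (V (\<xi> i \<omega>))\<^sup>2) / n - (\<integral>z. (V z)\<^sup>2 \<partial>P)\<bar> \<le> 1)"
    by (rule weak_law_of_large_numbers[OF integrable_V_sq]) simp
  have max: "whp W (\<lambda>n \<omega>. \<forall>i<n. \<bar>V (\<xi> i \<omega>)\<bar> \<le> 1 * sqrt n)"
    by (rule whp_max_le[OF V_meas integrable_V_sq]) simp
  have "\<forall>\<^sub>F n in sequentially. \<exists>B\<in>sets W. prob B \<le> e / 3 \<and> (\<forall>\<omega>\<in>space W - B.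
      \<bar>(\<Sum>i<n. (V (\<xi> i \<omega>))\<^sup>2) / n - (\<integral>z. (V z)\<^sup>2 \<partial>P)\<bar> \<le> 1 \<and> (\<forall>i<n. \<bar>V (\<xi> i \<omega>)\<bar> \<le> 1 * sqrt n))"
    by (rule whpD[OF whp_conj[OF lln max]]) (use e in simp)
  \<comment> \<open>From here on the gap away from \<open>xs\<close> exceeds both the reweighting
    error and the empirical fluctuation.\<close>
  moreover have "\<forall>\<^sub>F n in sequentially. (C * R + t) / c \<le> sqrt (real n)"
    by real_asymp
  ultimately show "\<forall>\<^sub>F n in sequentially. \<exists>B\<in>sets W. prob B \<le> e \<and>
      (\<forall>\<omega>\<in>space W - B. \<forall>w\<in>weight_set \<rho> n. (\<Sum>i<n. w i * l xs (\<xi> i \<omega>)) - \<delta> / sqrt n \<le> robust_value n \<omega> w)"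
    using eventually_gt_at_top[of 0]
  proof eventually_elim
    case (elim n)
    from elim(1) obtain B1 where B1: "B1 \<in> sets W" "prob B1 \<le> e / 3"
      and good: "\<And>\<omega>. \<omega> \<in> space W - B1 \<Longrightarrow> \<bar>(\<Sum>i<n. (V (\<xi> i \<omega>))\<^sup>2) / n - (\<integral>z. (V z)\<^sup>2 \<partial>P)\<bar> \<le> 1"
        "\<And>\<omega> i. \<omega> \<in> space W - B1 \<Longrightarrow> i < n \<Longrightarrow> \<bar>V (\<xi> i \<omega>)\<bar> \<le> 1 * sqrt n" by blast
    have "0 < \<delta> / 2" using \<delta> by simp
    from dev_tail[OF elim(3) r this] obtain B2 where B2: "B2 \<in> sets W"
        "prob B2 \<le> 2 * chaining_const CARD('d) * r * sqrt Q / (\<delta> / 2)"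
      and near: "\<And>\<omega> x. \<omega> \<in> space W - B2 \<Longrightarrow> x \<in> X \<inter> cball xs r \<Longrightarrow> \<bar>dev n x \<omega>\<bar> \<le> \<delta> / 2 * sqrt n" by blast
    from dev_tail[OF elim(3) R(1) t] obtain B3 where B3: "B3 \<in> sets W"
        "prob B3 \<le> 2 * chaining_const CARD('d) * R * sqrt Q / t"
      and far: "\<And>\<omega> x. \<omega> \<in> space W - B3 \<Longrightarrow> x \<in> X \<inter> cball xs R \<Longrightarrow> \<bar>dev n x \<omega>\<bar> \<le> t * sqrt n" by blast
    have D_eq: "2 * chaining_const CARD('d) * s * sqrt Q = D * s" for s by (simp add: D_def)
    have "prob B2 \<le> e / 3" using B2(2) Dr unfolding D_eq by linarith
    moreover have "prob B3 \<le> e / 3" using B3(2) DR unfolding D_eq by linarith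
    moreover have "prob (B1 \<union> B2 \<union> B3) \<le> prob B1 + prob B2 + prob B3"
      using measure_Un_le[of "B1 \<union> B2" W B3] measure_Un_le[of B1 W B2] B1 B2 B3 by auto
    ultimately have "prob (B1 \<union> B2 \<union> B3) \<le> e" using B1 by linarith
    moreover have "(\<Sum>i<n. w i * l xs (\<xi> i \<omega>)) - \<delta> / sqrt n \<le> robust_value n \<omega> w"
      if \<omega>: "\<omega> \<in> space W - (B1 \<union> B2 \<union> B3)" and w: "w \<in> weight_set \<rho> n" for \<omega> w
      unfolding robust_value_def
    proof (rule cINF_greatest[OF X_nonempty])
      fix x assume x: "x \<in> X"
      have sn: "0 < sqrt n" "sqrt n * sqrt n = n" using elim(3) by auto
      have \<omega>s: "\<omega> \<in> space W" using \<omega> by simp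
      have "(\<Sum>i<n. (V (\<xi> i \<omega>))\<^sup>2) / n \<le> Q" using good(1)[of \<omega>] \<omega> by (auto simp: Q_def abs_le_iff)
      then have V_sum: "(\<Sum>i<n. (V (\<xi> i \<omega>))\<^sup>2) \<le> n * Q" using elim(3) by (simp add: field_simps)
      have V_max: "V (\<xi> i \<omega>) \<le> sqrt n" if "i < n" for i using good(2)[of \<omega> i] \<omega> that by auto
      have dev_le: "gap x + dev n x \<omega> / n - C * s / sqrt n \<le> (\<Sum>i<n. w i * (l x (\<xi> i \<omega>) - l xs (\<xi> i \<omega>)))"
        if "norm (x - xs) \<le> s" "0 \<le> s" for s
        using weighted_deviation_at[OF \<eta> quad lin \<omega>s elim(3) V_max V_sum w x that] unfolding C_def abs_le_iff by linarith
      have "- \<delta> / sqrt n \<le> (\<Sum>i<n. w i * (l x (\<xi> i \<omega>) - l xs (\<xi> i \<omega>)))"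
      proof (cases "norm (x - xs) \<le> r")
        case True
        have "0 \<le> gap x" using minimal[OF x] by (cases "x = xs") (auto simp: gap_def)
        moreover have "- (\<delta> / 2) / sqrt n \<le> dev n x \<omega> / n"
        proof -
          have "\<bar>dev n x \<omega>\<bar> \<le> \<delta> / 2 * sqrt n"
            using near[of \<omega> x] \<omega> x True by (auto simp: dist_norm norm_minus_commute)
          then have "- (\<delta> / 2 * sqrt n) / n \<le> dev n x \<omega> / n" by (intro divide_right_mono) auto
          also have "- (\<delta> / 2 * sqrt n) / n = - (\<delta> / 2) / sqrt n" using sn by (simp add: field_simps)
          finally show ?thesis .
        qed
        moreover have "C * r / sqrt n \<le> \<delta> / 2 / sqrt n" by (intro divide_right_mono Cr) simp
        moreover have "- (\<delta> / 2) / sqrt n - \<delta> / 2 / sqrt n = - \<delta> / sqrt n" by (simp add: field_simps)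
        ultimately show ?thesis using dev_le[OF True] r by linarith
      next
        case False
        have xR: "norm (x - xs) \<le> R" using R(2) x by (auto simp: dist_norm norm_minus_commute)
        have "\<bar>dev n x \<omega>\<bar> \<le> t * sqrt n" using far[of \<omega> x] \<omega> x R(2) by auto
        then have "- (t * sqrt n) / n \<le> dev n x \<omega> / n" by (intro divide_right_mono) auto
        also have "- (t * sqrt n) / n = - t / sqrt n" using sn by (simp add: field_simps)
        finally have 1: "- t / sqrt n \<le> dev n x \<omega> / n" .
        have "(C * R + t) / sqrt n \<le> c" using elim(2) c(1) sn by (simp add: field_simps)
        then have 2: "C * R / sqrt n + t / sqrt n \<le> c" by (simp add: add_divide_distrib)
        have 3: "c \<le> gap x" using c(2)[OF x] False by simp
        have "0 \<le> \<delta> / sqrt n" using \<delta> sn by simp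
        then show ?thesis using dev_le[OF xR] R(1) 1 2 3 by simp
      qed
      then show "(\<Sum>i<n. w i * l xs (\<xi> i \<omega>)) - \<delta> / sqrt n \<le> (\<Sum>i<n. w i * l x (\<xi> i \<omega>))"
        by (simp add: right_diff_distrib sum_subtractf)
    qed
    ultimately show ?case using B1 B2 B3 by (intro bexI[of _ "B1 \<union> B2 \<union> B3"]) auto
  qed
qed

end

section \<open>Coverage\<close>

text \<open>The expressions are the two interval radii obtained later. In
  \<open>1 - 2 * \<epsilon>\<close> one \<open>\<epsilon>\<close> comes from the empirical second
  moment and one from centring at the sample mean; \<open>3/8\<close> ensures
  \<open>1 - 2 * \<epsilon> \<ge> 1/4\<close>.\<close>

lemma central_interval_tolerance:
  fixes \<rho> \<tau> :: real
  assumes "0 < \<rho>" "0 < \<tau>"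
  obtains \<epsilon> where "0 < \<epsilon>" "\<epsilon> < 3/8" "sqrt (\<rho> * (1 + \<epsilon>) / (1 - \<epsilon>)) \<le> sqrt \<rho> + \<tau>"
    "sqrt \<rho> - \<tau> \<le> sqrt (\<rho> * (1 - 2 * \<epsilon>) / (1 + \<epsilon>))"
proof -
  have "((\<lambda>\<epsilon>. sqrt (\<rho> * (1 + \<epsilon>) / (1 - \<epsilon>))) \<longlongrightarrow> sqrt (\<rho> * (1 + 0) / (1 - 0))) (at_right 0)"
    by (intro tendsto_intros) auto
  then have "\<forall>\<^sub>F \<epsilon> in at_right 0. sqrt (\<rho> * (1 + \<epsilon>) / (1 - \<epsilon>)) < sqrt \<rho> + \<tau>"
    using assms by (intro order_tendstoD(2)) auto
  moreover have "((\<lambda>\<epsilon>. sqrt (\<rho> * (1 - 2 * \<epsilon>) / (1 + \<epsilon>))) \<longlongrightarrow> sqrt (\<rho> * (1 - 2 * 0) / (1 + 0))) (at_right 0)"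
    by (intro tendsto_intros) auto
  then have "\<forall>\<^sub>F \<epsilon> in at_right 0. sqrt \<rho> - \<tau> < sqrt (\<rho> * (1 - 2 * \<epsilon>) / (1 + \<epsilon>))"
    using assms by (intro order_tendstoD(1)) auto
  moreover have "\<forall>\<^sub>F \<epsilon> in at_right 0. \<epsilon> \<in> {0<..<3/8::real}"
    by (rule eventually_at_right_real) simp
  ultimately have "\<forall>\<^sub>F \<epsilon> in at_right 0. 0 < \<epsilon> \<and> \<epsilon> < 3/8 \<and> sqrt (\<rho> * (1 + \<epsilon>) / (1 - \<epsilon>)) \<le> sqrt \<rho> + \<tau> \<and>
      sqrt \<rho> - \<tau> \<le> sqrt (\<rho> * (1 - 2 * \<epsilon>) / (1 + \<epsilon>))"
    by eventually_elim auto
  then show ?thesis using that eventually_happens'[OF trivial_limit_at_right_real] by blast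
qed

context robust_loss
begin

definition T :: real where "T = (\<integral>z. l xs z \<partial>P)"

definition \<sigma> :: real where "\<sigma> = sqrt (P.variance (l xs))"

text \<open>The scale is the population standard deviation, so this is literally the variable of the
  central limit theorem. The sample second moment is compared with it by the law of large numbers in
  \<open>covered_sandwich\<close>.\<close>

definition studentized :: "nat \<Rightarrow> 'w \<Rightarrow> real" where
  "studentized n \<omega> = (\<Sum>i<n. l xs (\<xi> i \<omega>) - T) / sqrt (n * \<sigma>\<^sup>2)"

lemma integrable_centred_sq: "integrable P (\<lambda>z. (l xs z - T)\<^sup>2)"
  using integrable_l_sq integrable_l_xs by (simp add: power2_diff)

lemma \<sigma>_sq: "\<sigma>\<^sup>2 = (\<integral>z. (l xs z - T)\<^sup>2 \<partial>P)"
  unfolding \<sigma>_def T_def by simp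

lemma measurable_studentized [measurable]: "studentized n \<in> borel_measurable W"
  unfolding studentized_def[abs_def] using xs by measurable

lemma studentized_weak_conv:
  assumes "0 < \<sigma>"
  shows "weak_conv_m (\<lambda>n. distr W borel (studentized n)) std_normal_distribution"
proof -
  have lm: "l xs \<in> borel_measurable P" by (rule l_meas[OF xs])
  have "weak_conv_m (\<lambda>n. distr W borel (\<lambda>\<omega>. (\<Sum>i<n. l xs (\<xi> i \<omega>) - T) / sqrt (n * \<sigma>\<^sup>2))) std_normal_distribution"
  proof (rule central_limit_theorem)
    show "indep_vars (\<lambda>i. borel) (\<lambda>i \<omega>. l xs (\<xi> i \<omega>)) UNIV" by (rule indep_vars_\<xi>[OF lm])
    show E: "expectation (\<lambda>\<omega>. l xs (\<xi> n \<omega>)) = T" for n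
      unfolding T_def by (rule expectation_\<xi>[OF lm])
    show "0 < \<sigma>" by fact
    show "integrable W (\<lambda>\<omega>. (l xs (\<xi> n \<omega>))\<^sup>2)" for n by (rule integrable_\<xi>[OF integrable_l_sq])
    show "variance (\<lambda>\<omega>. l xs (\<xi> n \<omega>)) = \<sigma>\<^sup>2" for n
      unfolding E \<sigma>_sq by (rule expectation_\<xi>[of "\<lambda>z. (l xs z - T)\<^sup>2"]) (use lm in measurable)
    show "distr W borel (\<lambda>\<omega>. l xs (\<xi> n \<omega>)) = distr P borel (l xs)" for n
      using distr_distr[OF lm measurable_\<xi>[of n]] distr_\<xi>[of n] by (simp add: comp_def)
  qed
  then show ?thesis by (simp add: studentized_def[abs_def])
qed

text \<open>The tolerance \<open>\<tau>\<close> is divided into thirds: the distortion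
  \<open>\<epsilon>\<close> of the quadratic form, the contribution of far weights, and the
  localization error \<open>\<delta>\<close>. If \<open>\<omega>\<close> is covered, the deviation
  bound limits the sample mean; conversely, two opposite tilts move the weighted mean past the
  target on either side.\<close>

lemma covered_sandwich:
  assumes \<sigma>: "0 < \<sigma>" and \<tau>: "0 < \<tau>"
  shows "whp W (\<lambda>n \<omega>. (\<bar>studentized n \<omega>\<bar> \<le> sqrt \<rho> - \<tau> \<longrightarrow> \<omega> \<in> covered n) \<and>
    (\<omega> \<in> covered n \<longrightarrow> \<bar>studentized n \<omega>\<bar> \<le> sqrt \<rho> + \<tau>))"
proof -
  obtain \<epsilon> where \<epsilon>: "0 < \<epsilon>" "\<epsilon> < 3/8" "sqrt (\<rho> * (1 + \<epsilon>) / (1 - \<epsilon>)) \<le> sqrt \<rho> + \<tau> / 3"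
    "sqrt \<rho> - \<tau> / 3 \<le> sqrt (\<rho> * (1 - 2 * \<epsilon>) / (1 + \<epsilon>))"
    using central_interval_tolerance[OF rho, of "\<tau> / 3"] \<tau> by auto
  obtain \<eta> where \<eta>: "0 < \<eta>" "\<eta> < 1" and dom: "\<And>u. \<bar>u\<bar> \<le> \<eta> \<Longrightarrow> 1 + u \<in> dom"
    and quad: "\<And>u. \<bar>u\<bar> \<le> \<eta> \<Longrightarrow> (1 - \<epsilon>) * u\<^sup>2 \<le> fr (1 + u)" and up: "\<And>u. \<bar>u\<bar> \<le> \<eta> \<Longrightarrow> fr (1 + u) \<le> (1 + \<epsilon>) * u\<^sup>2"
    and lin: "\<And>u. 1 + u \<in> dom \<Longrightarrow> \<eta> \<le> \<bar>u\<bar> \<Longrightarrow> (1 - \<epsilon>) * \<eta> * \<bar>u\<bar> \<le> fr (1 + u)"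
    using generator_bounds[OF smooth \<epsilon>(1)] by metis
  define C where "C = \<rho> / ((1 - \<epsilon>) * \<eta>)"
  have C: "0 < C" using rho \<epsilon> \<eta> by (simp add: C_def)
  \<comment> \<open>The first entry bounds the contribution of far weights,
    \<open>C * \<kappa> \<le> \<sigma> * \<tau> / 3\<close>; the second keeps the tilt within the
    range \<open>\<eta>\<close> of the quadratic bounds.\<close>
  define \<kappa> where "\<kappa> = min (\<sigma> * \<tau> / (3 * C)) (\<sigma> * \<eta> / (4 * sqrt \<rho>))"
  have \<kappa>: "0 < \<kappa>" using \<sigma> \<tau> C \<eta> rho by (simp add: \<kappa>_def)
  have "C * \<kappa> \<le> C * (\<sigma> * \<tau> / (3 * C))" using C by (intro mult_left_mono) (auto simp: \<kappa>_def)
  then have C\<kappa>: "C * \<kappa> \<le> \<sigma> * \<tau> / 3" using C by simp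
  have "4 * sqrt \<rho> * \<kappa> \<le> 4 * sqrt \<rho> * (\<sigma> * \<eta> / (4 * sqrt \<rho>))"
    using rho by (intro mult_left_mono) (auto simp: \<kappa>_def)
  then have \<kappa>\<eta>: "4 * sqrt \<rho> * \<kappa> \<le> \<sigma> * \<eta>" using rho by simp
  define \<delta> where "\<delta> = \<sigma> * \<tau> / 3"
  have \<delta>: "0 < \<delta>" using \<sigma> \<tau> by (simp add: \<delta>_def)
  have lm: "l xs \<in> borel_measurable P" by (rule l_meas[OF xs])
  have ev_max: "whp W (\<lambda>n \<omega>. \<forall>i<n. \<bar>l xs (\<xi> i \<omega>) - T\<bar> \<le> \<kappa> * sqrt n)"
    by (rule whp_max_le[OF _ integrable_centred_sq \<kappa>]) (use lm in measurable)
  have ev_sq: "whp W (\<lambda>n \<omega>. \<bar>(\<Sum>i<n. (l xs (\<xi> i \<omega>) - T)\<^sup>2) / n - \<sigma>\<^sup>2\<bar> \<le> \<epsilon> * \<sigma>\<^sup>2)"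
    unfolding \<sigma>_sq by (rule weak_law_of_large_numbers[OF integrable_centred_sq]) (use \<sigma> \<epsilon> in \<open>simp flip: \<sigma>_sq\<close>)
  have "whp W (\<lambda>n \<omega>. \<bar>(\<Sum>i<n. l xs (\<xi> i \<omega>) - T) / n - (\<integral>z. l xs z - T \<partial>P)\<bar> \<le> \<sigma> * sqrt \<epsilon>)"
    by (rule weak_law_of_large_numbers) (use integrable_l_xs \<sigma> \<epsilon> in auto)
  \<comment> \<open>The bound \<open>\<sigma> * sqrt \<epsilon>\<close> is chosen so that centring
    at the sample mean lowers the normalized second moment by at most
    \<open>\<epsilon> * \<sigma>^2\<close>.\<close>
  then have ev_mean: "whp W (\<lambda>n \<omega>. \<bar>(\<Sum>i<n. l xs (\<xi> i \<omega>) - T) / n\<bar> \<le> \<sigma> * sqrt \<epsilon>)"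
    using integrable_l_xs by (simp add: T_def P.prob_space)
  show ?thesis
  proof (rule whp_mono_eventually[OF whp_conj[OF whp_conj[OF ev_max ev_sq] whp_conj[OF ev_mean localization[OF \<delta>]]]],
      rule eventually_mono[OF eventually_gt_at_top[of 0]], intro ballI impI)
    fix n :: nat and \<omega>
    assume n: "0 < n" and \<omega>: "\<omega> \<in> space W"
    assume "((\<forall>i<n. \<bar>l xs (\<xi> i \<omega>) - T\<bar> \<le> \<kappa> * sqrt n) \<and> \<bar>(\<Sum>i<n. (l xs (\<xi> i \<omega>) - T)\<^sup>2) / n - \<sigma>\<^sup>2\<bar> \<le> \<epsilon> * \<sigma>\<^sup>2) \<and>
      \<bar>(\<Sum>i<n. l xs (\<xi> i \<omega>) - T) / n\<bar> \<le> \<sigma> * sqrt \<epsilon> \<and>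
      (\<forall>w\<in>weight_set \<rho> n. (\<Sum>i<n. w i * l xs (\<xi> i \<omega>)) - \<delta> / sqrt n \<le> robust_value n \<omega> w)"
    then have H: "\<And>i. i < n \<Longrightarrow> \<bar>l xs (\<xi> i \<omega>) - T\<bar> \<le> \<kappa> * sqrt n"
      "\<bar>(\<Sum>i<n. (l xs (\<xi> i \<omega>) - T)\<^sup>2) / n - \<sigma>\<^sup>2\<bar> \<le> \<epsilon> * \<sigma>\<^sup>2"
      "\<bar>(\<Sum>i<n. l xs (\<xi> i \<omega>) - T) / n\<bar> \<le> \<sigma> * sqrt \<epsilon>"
      "\<And>w. w \<in> weight_set \<rho> n \<Longrightarrow> (\<Sum>i<n. w i * l xs (\<xi> i \<omega>)) - \<delta> / sqrt n \<le> robust_value n \<omega> w" by auto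
    define a where "a i = l xs (\<xi> i \<omega>) - T" for i
    define m where "m = (\<Sum>i<n. a i) / n"
    define A where "A = (\<Sum>i<n. (a i)\<^sup>2)"
    have sn: "0 < sqrt n" "sqrt n * sqrt n = n" "(sqrt n)\<^sup>2 = n" using n by auto
    have a_max: "\<bar>a i\<bar> \<le> \<kappa> * sqrt n" if "i < n" for i using H(1)[OF that] by (simp add: a_def)
    have "\<bar>A / n - \<sigma>\<^sup>2\<bar> \<le> \<epsilon> * \<sigma>\<^sup>2" using H(2) by (simp add: A_def a_def)
    then have "A / n \<le> (1 + \<epsilon>) * \<sigma>\<^sup>2" "(1 - \<epsilon>) * \<sigma>\<^sup>2 \<le> A / n" by (auto simp: abs_le_iff algebra_simps)
    then have A: "A \<le> n * ((1 + \<epsilon>) * \<sigma>\<^sup>2)" "n * ((1 - \<epsilon>) * \<sigma>\<^sup>2) \<le> A" using n by (auto simp: field_simps)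
    have m_le: "\<bar>m\<bar> \<le> \<sigma> * sqrt \<epsilon>" using H(3) by (simp add: m_def a_def)
    have m_max: "\<bar>m\<bar> \<le> \<kappa> * sqrt n"
    proof -
      have "\<bar>\<Sum>i<n. a i\<bar> \<le> (\<Sum>i<n. \<bar>a i\<bar>)" by (rule sum_abs)
      also have "\<dots> \<le> (\<Sum>i<n. \<kappa> * sqrt n)" by (intro sum_mono a_max) auto
      finally show ?thesis using n by (simp add: m_def abs_divide field_simps)
    qed
    have Z: "\<bar>studentized n \<omega>\<bar> = \<bar>m\<bar> * sqrt n / \<sigma>"
      using n \<sigma> sn by (simp add: studentized_def m_def a_def real_sqrt_mult abs_divide abs_mult field_simps)
    have weighted: "(\<Sum>i<n. w i * a i) = (\<Sum>i<n. w i * l xs (\<xi> i \<omega>)) - T" if "w \<in> weight_set \<rho> n" for w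
      using that by (simp add: a_def right_diff_distrib sum_subtractf weight_set_iff flip: sum_distrib_right)
    show "(\<bar>studentized n \<omega>\<bar> \<le> sqrt \<rho> - \<tau> \<longrightarrow> \<omega> \<in> covered n) \<and> (\<omega> \<in> covered n \<longrightarrow> \<bar>studentized n \<omega>\<bar> \<le> sqrt \<rho> + \<tau>)"
    proof (intro conjI impI)
      assume "\<omega> \<in> covered n"
      then obtain w where w: "w \<in> weight_set \<rho> n" and val: "robust_value n \<omega> w = T"
        by (auto simp: covered_def T_def)
      \<comment> \<open>Since \<open>xs\<close> competes in the infimum, the weighted mean at
        \<open>xs\<close> is at least the optimal value; localization bounds the excess.\<close>
      have "0 \<le> (\<Sum>i<n. w i * a i)" using robust_value_le[OF \<omega> xs, of n w] val weighted[OF w] by simp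
      moreover have "(\<Sum>i<n. w i * a i) \<le> \<delta> / sqrt n" using H(4)[OF w] val weighted[OF w] by simp
      moreover have "\<bar>\<Sum>i<n. (w i - 1 / n) * a i\<bar> \<le> (sqrt (\<rho> / (1 - \<epsilon>) * A) + C * (\<kappa> * sqrt n)) / n"
        unfolding C_def A_def by (rule weight_deviation_le[OF _ \<eta>(1) quad lin w n a_max]) (use \<epsilon> in auto)
      moreover have "(\<Sum>i<n. (w i - 1 / n) * a i) = (\<Sum>i<n. w i * a i) - m"
        by (simp add: m_def left_diff_distrib sum_subtractf sum_divide_distrib)
      ultimately have "\<bar>m\<bar> \<le> \<delta> / sqrt n + (sqrt (\<rho> / (1 - \<epsilon>) * A) + C * (\<kappa> * sqrt n)) / n" by linarith
      also have "sqrt (\<rho> / (1 - \<epsilon>) * A) \<le> sqrt n * \<sigma> * (sqrt \<rho> + \<tau> / 3)"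
      proof -
        have "\<rho> / (1 - \<epsilon>) * A \<le> \<rho> / (1 - \<epsilon>) * (n * ((1 + \<epsilon>) * \<sigma>\<^sup>2))"
          using rho \<epsilon> by (intro mult_left_mono A) auto
        also have "\<dots> = n * \<sigma>\<^sup>2 * (\<rho> * (1 + \<epsilon>) / (1 - \<epsilon>))" by simp
        finally have "sqrt (\<rho> / (1 - \<epsilon>) * A) \<le> sqrt (n * \<sigma>\<^sup>2 * (\<rho> * (1 + \<epsilon>) / (1 - \<epsilon>)))" by (rule real_sqrt_le_mono)
        also have "\<dots> = sqrt n * \<sigma> * sqrt (\<rho> * (1 + \<epsilon>) / (1 - \<epsilon>))" using \<sigma> by (simp add: real_sqrt_mult del: times_divide_eq_right)
        also have "\<dots> \<le> sqrt n * \<sigma> * (sqrt \<rho> + \<tau> / 3)" using \<sigma> by (intro mult_left_mono \<epsilon>) auto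
        finally show ?thesis .
      qed
      finally have "\<bar>m\<bar> \<le> \<delta> / sqrt n + (sqrt n * \<sigma> * (sqrt \<rho> + \<tau> / 3) + C * (\<kappa> * sqrt n)) / n"
        using n by (simp add: divide_right_mono)
      then have "\<bar>m\<bar> * sqrt n \<le> (\<delta> / sqrt n + (sqrt n * \<sigma> * (sqrt \<rho> + \<tau> / 3) + C * (\<kappa> * sqrt n)) / n) * sqrt n"
        using sn by (intro mult_right_mono) auto
      also have "\<dots> = \<delta> + \<sigma> * (sqrt \<rho> + \<tau> / 3) + C * \<kappa>"
      proof -
        have "(d / s + (s * g * h + C * (\<kappa> * s)) / (s * s)) * s = d + g * h + C * \<kappa>" if "0 < s" for s d g h :: real
          using that by (simp add: field_simps)
        from this[OF sn(1)] show ?thesis unfolding sn(2) .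
      qed
      also have "\<dots> \<le> \<sigma> * (sqrt \<rho> + \<tau>)" using C\<kappa> by (simp add: \<delta>_def algebra_simps)
      finally show "\<bar>studentized n \<omega>\<bar> \<le> sqrt \<rho> + \<tau>" unfolding Z using \<sigma> by (simp add: pos_divide_le_eq mult.commute)
    next
      assume le: "\<bar>studentized n \<omega>\<bar> \<le> sqrt \<rho> - \<tau>"
      define q where "q = (\<Sum>i<n. (a i - m)\<^sup>2)"
      have "q = (\<Sum>i<n. (a i)\<^sup>2 - 2 * m * a i + m\<^sup>2)"
        unfolding q_def by (intro sum.cong) (auto simp: power2_eq_square algebra_simps)
      also have "\<dots> = A - 2 * m * (\<Sum>i<n. a i) + n * m\<^sup>2"
        by (simp add: A_def sum.distrib sum_subtractf sum_distrib_left)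
      also have "(\<Sum>i<n. a i) = n * m" using n by (simp add: m_def)
      finally have q_eq: "q = A - n * m\<^sup>2" by (simp add: power2_eq_square)
      have "m\<^sup>2 \<le> (\<sigma> * sqrt \<epsilon>)\<^sup>2" using m_le by (metis abs_ge_zero power2_abs power_mono)
      also have "\<dots> = \<epsilon> * \<sigma>\<^sup>2" using \<epsilon> by (simp add: power_mult_distrib)
      finally have "n * m\<^sup>2 \<le> n * (\<epsilon> * \<sigma>\<^sup>2)" by (intro mult_left_mono) auto
      then have q_ge: "n * \<sigma>\<^sup>2 * (1 - 2 * \<epsilon>) \<le> q" using A(2) by (simp add: q_eq algebra_simps)
      have "n * \<sigma>\<^sup>2 * (1/4) \<le> n * \<sigma>\<^sup>2 * (1 - 2 * \<epsilon>)" using \<epsilon> by (intro mult_left_mono) auto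
      then have q_ge': "n * \<sigma>\<^sup>2 / 4 \<le> q" using q_ge by simp
      have q: "0 < q" by (rule less_le_trans[OF _ q_ge']) (use n \<sigma> in simp)
      \<comment> \<open>This tilt spends the whole divergence budget:
        \<open>(1 + \<epsilon>) * \<theta>^2 * q = \<rho>\<close>.\<close>
      define \<theta> where "\<theta> = sqrt (\<rho> / ((1 + \<epsilon>) * q))"
      have \<theta>0: "0 \<le> \<theta>" using rho \<epsilon> q by (simp add: \<theta>_def)
      have "\<theta>\<^sup>2 = \<rho> / ((1 + \<epsilon>) * q)" using rho \<epsilon> q by (simp add: \<theta>_def)
      then have \<theta>_sq: "(1 + \<epsilon>) * \<theta>\<^sup>2 * q \<le> \<rho>" using \<epsilon> q by simp
      \<comment> \<open>The tilt is of order \<open>1 / sqrt n\<close>, while the centred data are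
        at most \<open>2 * \<kappa> * sqrt n\<close>; the product is therefore small uniformly in
        \<open>i\<close>.\<close>
      have \<theta>_le: "\<theta> \<le> 2 * sqrt \<rho> / (\<sigma> * sqrt n)"
      proof -
        have "\<rho> / ((1 + \<epsilon>) * q) \<le> \<rho> / (n * \<sigma>\<^sup>2 / 4)"
        proof (rule divide_left_mono)
          have "q \<le> (1 + \<epsilon>) * q" using \<epsilon> q by simp
          then show "n * \<sigma>\<^sup>2 / 4 \<le> (1 + \<epsilon>) * q" using q_ge' by simp
        qed (use rho \<epsilon> q n \<sigma> in auto)
        also have "\<dots> = (2 * sqrt \<rho> / (\<sigma> * sqrt n))\<^sup>2"
          using rho \<sigma> n by (simp add: power_divide power_mult_distrib mult.commute)
        finally have "\<theta> \<le> sqrt ((2 * sqrt \<rho> / (\<sigma> * sqrt n))\<^sup>2)" unfolding \<theta>_def by (rule real_sqrt_le_mono)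
        then show ?thesis using rho \<sigma> by simp
      qed
      have small: "\<theta> * \<bar>a i - m\<bar> \<le> \<eta>" if "i < n" for i
      proof -
        have "\<bar>a i - m\<bar> \<le> 2 * \<kappa> * sqrt n" using a_max[OF that] m_max by linarith
        then have "\<theta> * \<bar>a i - m\<bar> \<le> (2 * sqrt \<rho> / (\<sigma> * sqrt n)) * (2 * \<kappa> * sqrt n)"
          using \<theta>0 \<theta>_le rho \<sigma> by (intro mult_mono) auto
        also have "\<dots> = 4 * sqrt \<rho> * \<kappa> / \<sigma>" using sn \<sigma> by (simp add: field_simps)
        also have "\<dots> \<le> \<eta>" using \<kappa>\<eta> \<sigma> by (simp add: pos_divide_le_eq mult.commute)
        finally show ?thesis .
      qed
      have shift: "(sqrt \<rho> - \<tau> / 3) * \<sigma> / sqrt n \<le> \<theta> * q / n"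
      proof -
        have "(sqrt \<rho> - \<tau> / 3) * \<sigma> * sqrt n \<le> sqrt (\<rho> * (1 - 2 * \<epsilon>) / (1 + \<epsilon>)) * (\<sigma> * sqrt n)"
          using mult_right_mono[OF \<epsilon>(4), of "\<sigma> * sqrt n"] \<sigma> by simp
        also have "\<dots> = sqrt (\<rho> / (1 + \<epsilon>) * (n * \<sigma>\<^sup>2 * (1 - 2 * \<epsilon>)))"
        proof -
          have "\<rho> / (1 + \<epsilon>) * (n * \<sigma>\<^sup>2 * (1 - 2 * \<epsilon>)) = (\<rho> * (1 - 2 * \<epsilon>) / (1 + \<epsilon>)) * (\<sigma>\<^sup>2 * n)" by simp
          then show ?thesis using \<sigma> by (simp only: real_sqrt_mult) simp
        qed
        also have "\<dots> \<le> sqrt (\<rho> / (1 + \<epsilon>) * q)"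
          using rho \<epsilon> by (intro real_sqrt_le_mono mult_left_mono q_ge) auto
        also have "\<rho> / (1 + \<epsilon>) * q = \<rho> / ((1 + \<epsilon>) * q) * q\<^sup>2" using q by (simp add: power2_eq_square)
        also have "sqrt \<dots> = \<theta> * q" using q by (simp only: \<theta>_def real_sqrt_mult real_sqrt_abs abs_of_pos)
        finally have "(sqrt \<rho> - \<tau> / 3) * \<sigma> * sqrt n / n \<le> \<theta> * q / n" by (intro divide_right_mono) auto
        moreover have "(sqrt \<rho> - \<tau> / 3) * \<sigma> * sqrt n / n = (sqrt \<rho> - \<tau> / 3) * \<sigma> / sqrt n"
        proof -
          have "k * s / (s * s) = k / s" if "0 < s" for k s :: real using that by simp
          from this[OF sn(1)] show ?thesis unfolding sn(2) .
        qed
        ultimately show ?thesis by simp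
      qed
      have m_small: "\<bar>m\<bar> \<le> \<sigma> * (sqrt \<rho> - \<tau>) / sqrt n"
        using le sn \<sigma> unfolding Z by (simp add: field_simps)
      have "\<exists>w\<in>weight_set \<rho> n. (\<Sum>i<n. w i * a i) = m + t * q / n" if t: "t = \<theta> \<or> t = - \<theta>" for t
      proof -
        have "t\<^sup>2 = \<theta>\<^sup>2" "\<bar>t\<bar> = \<theta>" using t \<theta>0 by auto
        then show ?thesis unfolding m_def q_def
          by (intro tilted_weight[OF \<eta>(2) dom up n]) (use \<theta>_sq small in \<open>auto simp: abs_mult q_def m_def\<close>)
      qed
      from this[of \<theta>] this[of "- \<theta>"] obtain w1 w0 where
        w1: "w1 \<in> weight_set \<rho> n" "(\<Sum>i<n. w1 i * a i) = m + \<theta> * q / n" and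
        w0: "w0 \<in> weight_set \<rho> n" "(\<Sum>i<n. w0 i * a i) = m - \<theta> * q / n" by auto
      \<comment> \<open>The definition of \<open>\<delta>\<close> makes the left side equal to
        \<open>\<sigma> * (sqrt \<rho> - \<tau> / 3) / sqrt n\<close>, the lower bound for the
        shift.\<close>
      have key: "\<sigma> * (sqrt \<rho> - \<tau>) / sqrt n + \<delta> / sqrt n + \<delta> / sqrt n \<le> \<theta> * q / n"
      proof -
        have "\<sigma> * (sqrt \<rho> - \<tau>) / sqrt n + \<delta> / sqrt n + \<delta> / sqrt n = (sqrt \<rho> - \<tau> / 3) * \<sigma> / sqrt n"
          unfolding add_divide_distrib[symmetric] by (simp add: \<delta>_def algebra_simps)
        then show ?thesis using shift by simp
      qed
      have \<delta>n: "0 < \<delta> / sqrt n" using \<delta> sn by simp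
      \<comment> \<open>For \<open>w0\<close>, evaluation at \<open>xs\<close> bounds the infimum
        from above; for \<open>w1\<close>, localization bounds it from below at the cost of
        \<open>\<delta> / sqrt n\<close>.\<close>
      have "robust_value n \<omega> w0 \<le> T"
        using robust_value_le[OF \<omega> xs, of n w0] weighted[OF w0(1)] w0(2) m_small key \<delta>n by linarith
      moreover have "T \<le> robust_value n \<omega> w1"
        using H(4)[OF w1(1)] weighted[OF w1(1)] w1(2) m_small key \<delta>n by linarith
      ultimately show "\<omega> \<in> covered n" using w0 w1 by (intro coveredI[OF \<omega>]) (auto simp: T_def)
    qed
  qed
qed

text \<open>Nonzero variance permits the normalization, and the limit depends on it: if
  \<open>X = {xs}\<close> and the loss at \<open>xs\<close> is almost surely constant, every
  reweighting has the same optimal value, and coverage has probability 1 for all positive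
  \<open>n\<close>.\<close>

lemma coverage_limit:
  assumes "P.variance (l xs) \<noteq> 0"
  shows "(\<lambda>n. prob (covered n)) \<longlonglongrightarrow> measure std_normal_distribution {- sqrt \<rho>..sqrt \<rho>}"
proof (rule whp_sandwich)
  have "0 \<le> P.variance (l xs)" by (rule P.variance_positive)
  then have "0 < P.variance (l xs)" using assms by linarith
  then have \<sigma>: "0 < \<sigma>" by (simp add: \<sigma>_def)
  show "weak_conv_m (\<lambda>n. distr W borel (studentized n)) std_normal_distribution"
    by (rule studentized_weak_conv[OF \<sigma>])
  show "covered n \<in> sets W" for n
  \<comment> \<open>For \<open>n = 0\<close> the weights would have to satisfy \<open>0 = 1\<close>,
    so the weight set is empty.\<close>
  proof (cases "n = 0")
    case True
    then have "covered n = {}" by (simp add: covered_def weight_set_def)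
    then show ?thesis by simp
  qed (simp add: covered_measurable)
  show "0 < sqrt \<rho>" using rho by simp
  show "whp W (\<lambda>n \<omega>. (\<bar>studentized n \<omega>\<bar> \<le> sqrt \<rho> - \<tau> \<longrightarrow> \<omega> \<in> covered n) \<and>
      (\<omega> \<in> covered n \<longrightarrow> \<bar>studentized n \<omega>\<bar> \<le> sqrt \<rho> + \<tau>))" if "0 < \<tau>" for \<tau>
    by (rule covered_sandwich[OF \<sigma> that])
qed simp

end

section \<open>Passage to the Euclidean norm and to the chi-squared law\<close>

text \<open>Expansion in the standard basis. This turns a Lipschitz bound in an arbitrary norm into
  a Euclidean one, at the price of a constant factor in the modulus.\<close>

lemma is_norm_le_norm:
  fixes N :: "'v::euclidean_space \<Rightarrow> real"
  assumes N: "is_norm N"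
  obtains c where "0 \<le> c" "\<And>x. N x \<le> c * norm x"
proof -
  have zero: "N 0 = 0" and scale: "N (a *\<^sub>R x) = \<bar>a\<bar> * N x" and tri: "N (x + y) \<le> N x + N y" for a x y
    using N by (auto simp: is_norm_def)
  have nonneg: "0 \<le> N x" for x
    using tri[of x "(- 1) *\<^sub>R x"] scale[of "- 1" x] zero by simp
  have sum: "finite S \<Longrightarrow> N (\<Sum>i\<in>S. g i) \<le> (\<Sum>i\<in>S. N (g i))" for S and g :: "'v \<Rightarrow> 'v"
  proof (induction S rule: finite_induct)
    case (insert i S)
    then show ?case using tri[of "g i" "\<Sum>i\<in>S. g i"] by simp
  qed (simp add: zero)
  have "N x \<le> (\<Sum>b\<in>Basis. N b) * norm x" for x
  proof -
    have "N x = N (\<Sum>b\<in>Basis. (x \<bullet> b) *\<^sub>R b)" by (simp add: euclidean_representation)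
    also have "\<dots> \<le> (\<Sum>b\<in>Basis. N ((x \<bullet> b) *\<^sub>R b))" by (rule sum) simp
    also have "\<dots> \<le> (\<Sum>b\<in>Basis. norm x * N b)"
      unfolding scale by (intro sum_mono mult_right_mono Basis_le_norm nonneg)
    finally show ?thesis by (simp add: sum_distrib_left mult.commute)
  qed
  then show ?thesis using that[of "\<Sum>b\<in>Basis. N b"] nonneg by (simp add: sum_nonneg)
qed

lemma measure_chi_squared_1:
  assumes "0 < \<rho>"
  shows "measure (chi_squared 1) {..\<rho>} = measure std_normal_distribution {- sqrt \<rho>..sqrt \<rho>}"
proof -
  let ?N = "std_normal_distribution"
  let ?M = "PiM {..<1::nat} (\<lambda>_. ?N)"
  have N: "prob_space ?N" by (rule prob_space_normal_density) simp
  have "measure (chi_squared 1) {..\<rho>} = measure ?M ((\<lambda>z. \<Sum>i<1. (z i)\<^sup>2) -` {..\<rho>} \<inter> space ?M)"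
    unfolding chi_squared_def by (subst measure_distr) auto
  also have "(\<lambda>z. \<Sum>i<1. (z i)\<^sup>2) -` {..\<rho>} \<inter> space ?M = (\<lambda>z. z 0) -` {- sqrt \<rho>..sqrt \<rho>} \<inter> space ?M"
  proof -
    have "y\<^sup>2 \<le> \<rho> \<longleftrightarrow> - sqrt \<rho> \<le> y \<and> y \<le> sqrt \<rho>" for y :: real
      using real_sqrt_le_iff[of "y\<^sup>2" \<rho>] by (auto simp: abs_le_iff)
    then show ?thesis by auto
  qed
  also have "measure ?M \<dots> = measure (distr ?M ?N (\<lambda>z. z 0)) {- sqrt \<rho>..sqrt \<rho>}"
    by (subst measure_distr) auto
  also have "distr ?M ?N (\<lambda>z. z 0) = ?N"
    using distr_PiM_component[of "{..<1::nat}" "\<lambda>_. ?N" 0] N by simp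
  finally show ?thesis .
qed

theorem theorem2:
  fixes P0 :: "'a::{metric_space, second_countable_topology} measure"
    and W :: "'w measure"
    and \<xi> :: "nat \<Rightarrow> 'w \<Rightarrow> 'a"
    and X :: "(real ^ 'd) set"
    and l :: "real ^ 'd \<Rightarrow> 'a \<Rightarrow> real"
    and N :: "real ^ 'd \<Rightarrow> real"
    and L :: "'a \<Rightarrow> real"
    and x0 xs :: "real ^ 'd"
    and f :: "real \<Rightarrow> ereal"
    and \<rho> :: real
  assumes P0: "prob_space P0"
    and X: "X \<noteq> {}" "compact X"
    and l_measurable: "\<And>x. x \<in> X \<Longrightarrow> l x \<in> borel_measurable P0"
    and N: "is_norm N"
    and L_measurable: "L \<in> borel_measurable P0"
    and L_nonneg: "\<And>z. z \<in> space P0 \<Longrightarrow> 0 \<le> L z"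
    and l_Lipschitz:
      "\<And>z x y. z \<in> space P0 \<Longrightarrow> x \<in> X \<Longrightarrow> y \<in> X \<Longrightarrow> \<bar>l x z - l y z\<bar> \<le> L z * N (x - y)"
    and L_square_integrable: "integrable P0 (\<lambda>z. (L z)\<^sup>2)"
    and x0: "x0 \<in> X" "integrable P0 (\<lambda>z. \<bar>l x0 z\<bar>\<^sup>2)"
    and f: "smooth_generator f"
    and rho: "0 < \<rho>"
    and W: "prob_space W"
    and \<xi>_indep: "prob_space.indep_vars W (\<lambda>_. P0) \<xi> UNIV"
    and \<xi>_distr: "\<And>i. distr W P0 (\<xi> i) = P0"
    and unique_optimizer: "{x. is_arg_min (\<lambda>x. \<integral>z. l x z \<partial>P0) (\<lambda>x. x \<in> X) x} = {xs}"
    and nondegenerate: "prob_space.variance P0 (l xs) \<noteq> 0"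
  shows "(\<lambda>n. measure W {\<omega> \<in> space W.
            T_opt X l P0 \<in>
              {T_opt X l P | P.
                 prob_space P \<and>
                 sets P = sets P0 \<and>
                 absolutely_continuous (empirical_measure P0 n (\<lambda>i. \<xi> i \<omega>)) P \<and>
                 f_divergence f P (empirical_measure P0 n (\<lambda>i. \<xi> i \<omega>)) \<le> ereal (\<rho> / real n)}})
         \<longlonglongrightarrow> measure (chi_squared 1) {..\<rho>}"
proof -
  obtain c where c: "0 \<le> c" "\<And>x. N x \<le> c * norm x" using is_norm_le_norm[OF N] by blast
  define V where "V z = c * L z" for z
  interpret P0: prob_space P0 by (rule P0)
  have arg: "is_arg_min (\<lambda>x. \<integral>z. l x z \<partial>P0) (\<lambda>x. x \<in> X) x \<longleftrightarrow> x = xs" for x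
    using unique_optimizer by blast
  have xs: "xs \<in> X" using arg[of xs] by (simp add: is_arg_min_def)
  have le: "(\<integral>z. l xs z \<partial>P0) \<le> (\<integral>z. l x z \<partial>P0)" if "x \<in> X" for x
    using arg[of xs] that by (auto simp: is_arg_min_def not_less)
  \<comment> \<open>A point other than \<open>xs\<close> with no larger expected loss would be a
    second member of the singleton of minimizers.\<close>
  have min: "(\<integral>z. l xs z \<partial>P0) < (\<integral>z. l x z \<partial>P0)" if "x \<in> X" "x \<noteq> xs" for x
  proof (rule ccontr)
    assume "\<not> (\<integral>z. l xs z \<partial>P0) < (\<integral>z. l x z \<partial>P0)"
    then have "is_arg_min (\<lambda>x. \<integral>z. l x z \<partial>P0) (\<lambda>x. x \<in> X) x"
      using le that by (force simp: is_arg_min_def not_less)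
    then show False using arg that by simp
  qed
  \<comment> \<open>Square integrability passes from \<open>x0\<close> to \<open>xs\<close> by
    \<open>a^2 \<le> 2 b^2 + 2 (a - b)^2\<close> and the Lipschitz bound.\<close>
  have lxs: "integrable P0 (\<lambda>z. (l xs z)\<^sup>2)"
  proof (rule Bochner_Integration.integrable_bound)
    show "integrable P0 (\<lambda>z. 2 * \<bar>l x0 z\<bar>\<^sup>2 + 2 * (N (xs - x0))\<^sup>2 * (L z)\<^sup>2)"
      using x0 L_square_integrable by simp
    show "(\<lambda>z. (l xs z)\<^sup>2) \<in> borel_measurable P0"
      using l_measurable[OF xs] by measurable
    show "AE z in P0. norm ((l xs z)\<^sup>2) \<le> norm (2 * \<bar>l x0 z\<bar>\<^sup>2 + 2 * (N (xs - x0))\<^sup>2 * (L z)\<^sup>2)"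
    proof (rule AE_I2)
      fix z assume "z \<in> space P0"
      then have "\<bar>l xs z - l x0 z\<bar> \<le> L z * N (xs - x0)" using l_Lipschitz xs x0(1) by blast
      then have "(l xs z - l x0 z)\<^sup>2 \<le> (L z * N (xs - x0))\<^sup>2" by (metis abs_ge_zero power2_abs power_mono)
      moreover have "(l xs z)\<^sup>2 \<le> 2 * (l x0 z)\<^sup>2 + 2 * (l xs z - l x0 z)\<^sup>2"
        using zero_le_power2[of "l xs z - 2 * l x0 z"] by (simp add: power2_eq_square algebra_simps)
      ultimately show "norm ((l xs z)\<^sup>2) \<le> norm (2 * \<bar>l x0 z\<bar>\<^sup>2 + 2 * (N (xs - x0))\<^sup>2 * (L z)\<^sup>2)"
        by (simp add: power_mult_distrib mult.commute)
    qed
  qed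
  have robust: "robust_loss W P0 \<xi> X l V xs f \<rho>"
  proof -
    interpret W: prob_space W by (rule W)
    have Lip: "\<bar>l x z - l y z\<bar> \<le> V z * norm (x - y)" if "z \<in> space P0" "x \<in> X" "y \<in> X" for x y z
    proof -
      have "\<bar>l x z - l y z\<bar> \<le> L z * N (x - y)" by (rule l_Lipschitz[OF that])
      also have "\<dots> \<le> L z * (c * norm (x - y))" by (intro mult_left_mono c L_nonneg that)
      finally show ?thesis by (simp only: V_def mult.assoc mult.left_commute)
    qed
    have Vsq: "integrable P0 (\<lambda>z. (V z)\<^sup>2)"
      using L_square_integrable by (simp add: V_def power_mult_distrib)
    have gen: "divergence_generator f" using f by (simp add: smooth_generator_def)
    show ?thesis
    proof unfold_locales
      show "V \<in> borel_measurable P0" using L_measurable by (simp add: V_def[abs_def])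
      show "0 \<le> V z" if "z \<in> space P0" for z using c L_nonneg[OF that] by (simp add: V_def)
      show "0 \<le> f t" if "0 \<le> t" for t by (rule smooth_generator_nonneg[OF f that])
    qed (fact P0 \<xi>_indep \<xi>_distr X xs l_measurable Lip Vsq lxs min gen f rho)+
  qed
  interpret robust_loss W P0 \<xi> X l V xs f \<rho> by (rule robust)
  have opt: "T_opt X l P0 = (\<integral>z. l xs z \<partial>P0)"
    unfolding T_opt_def using xs le by (intro cInf_eq_minimum) auto
  \<comment> \<open>The two events agree for positive \<open>n\<close>; at \<open>n = 0\<close> the
    empirical measure is not a probability measure, and one term does not affect the limit.\<close>
  have "\<forall>\<^sub>F n in sequentially. prob (covered n) = measure W {\<omega> \<in> space W.
            T_opt X l P0 \<in>
              {T_opt X l P | P.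
                 prob_space P \<and>
                 sets P = sets P0 \<and>
                 absolutely_continuous (empirical_measure P0 n (\<lambda>i. \<xi> i \<omega>)) P \<and>
                 f_divergence f P (empirical_measure P0 n (\<lambda>i. \<xi> i \<omega>)) \<le> ereal (\<rho> / real n)}}"
    using eventually_gt_at_top[of 0]
  proof eventually_elim
    case (elim n)
    show ?case unfolding covered_def
    proof (intro arg_cong[where f = "measure W"] Collect_cong conj_cong refl)
      fix \<omega> assume \<omega>: "\<omega> \<in> space W"
      interpret divergence_ball P0 n "\<lambda>i. \<xi> i \<omega>" f
        by unfold_locales (use elim \<xi>_in_space[OF \<omega>] in auto)
      show "(\<exists>w\<in>weight_set \<rho> n. robust_value n \<omega> w = (\<integral>z. l xs z \<partial>P0)) \<longleftrightarrow> T_opt X l P0 \<in>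
              {T_opt X l P | P.
                 prob_space P \<and>
                 sets P = sets P0 \<and>
                 absolutely_continuous (empirical_measure P0 n (\<lambda>i. \<xi> i \<omega>)) P \<and>
                 f_divergence f P (empirical_measure P0 n (\<lambda>i. \<xi> i \<omega>)) \<le> ereal (\<rho> / real n)}"
        unfolding mem_Collect_eq opt robust_value_def
        using divergence_ball_iff[of X l "\<integral>z. l xs z \<partial>P0" \<rho>] l_measurable by simp
    qed
  qed
  moreover have "(\<lambda>n. prob (covered n)) \<longlonglongrightarrow> measure (chi_squared 1) {..\<rho>}"
    unfolding measure_chi_squared_1[OF rho] by (rule coverage_limit[OF nondegenerate])
  ultimately show ?thesis by (rule Lim_transform_eventually[rotated])
qed

end
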